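(* Let $\mathsf{p}: P \to M$ be a principal fibre bundle with structure Lie group $G$ and let $\star$ be a star product on $M$. Then the principal fibre bundle admits a deformation quantization with respect to $\star$, and any two deformation quantizations of the principal fibre bundle with respect to $\star$ are equivalent (as deformation quantizations of a principal fibre bundle, i.e. via a $G$-invariant equivalence). Moreover, there exists a deformation quantization of the principal fibre bundle with respect to $\star$ which preserves the fibration.
   Context: All functions are smooth and complex valued; $\lambda$ is a formal parameter; maps are extended $\mathbb{C}[[\lambda]]$-(multi)linearly to formal power series. The principal right action is $\mathsf{r}:P\times G\to P$, $\mathsf{r}_g(u)=\mathsf{r}(u,g)$. Star product: a star product $\star$ on $M$ is an associative $\mathbb{C}[[\lambda]]$-bilinear product on $C^\infty(M)[[\lambda]]$ of the form $a \star b = \sum_{r=0}^\infty \lambda^r C_r(a,b)$ with $C_0(a,b)=ab$, all $C_r$ bidifferential operators, and $1\star a = a = a\star 1$. Deformation quantization of the principal fibre bundle (with respect to $\star$): a right module structure $\bullet$ of $(C^\infty(M)[[\lambda]],\star)$ on $C^\infty(P)[[\lambda]]$ of the form $f\bullet a = f\cdot \mathsf{p}^*a + \sum_{r=1}^\infty \lambda^r \rho_r(f,a)$ with bidifferential operators $\rho_r$, which is $G$-invariant: $\mathsf{r}_g^*(f\bullet a)=(\mathsf{r}_g^*f)\bullet a$ for all $f\in C^\infty(P)[[\lambda]]$, $a\in C^\infty(M)[[\lambda]]$, $g\in G$. Equivalence: two such $\bullet$ and $\tilde\bullet$ (for the same $\star$) are equivalent if there is a formal series $T=\mathrm{id}+\sum_{r=1}^\infty\lambda^r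 T_r$ of differential operators $T_r$ on $C^\infty(P)$ with $\mathsf{r}_g^*\circ T_r=T_r\circ\mathsf{r}_g^*$ for all $g\in G$, such that $T(f\bullet a)=T(f)\mathbin{\tilde\bullet} a$ for all $f,a$. Preserving the fibration: $(\mathsf{p}^*a)\bullet b=\mathsf{p}^*(a\star b)$ for all $a,b\in C^\infty(M)[[\lambda]]$. *)

theory Defs
  imports "HOL-Analysis.Analysis" "HOL-Algebra.Group"
begin

section \<open>Smooth functions on open subsets of n-dimensional Euclidean space\<close>

text \<open>
  The model space is \<open>Euclidean_space n\<close>, whose points are the functions \<open>nat \<Rightarrow> real\<close> that
  vanish from index \<open>n\<close> on. Unlike a type of class \<open>euclidean_space\<close>, this allows
  dimension 0 (discrete structure groups, the one-point base).
\<close>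

definition partial_deriv :: "nat \<Rightarrow> ((nat \<Rightarrow> real) \<Rightarrow> 'b::real_normed_vector) \<Rightarrow> (nat \<Rightarrow> real) \<Rightarrow> 'b"
  where "partial_deriv i f x = vector_derivative (\<lambda>t. f (x(i := t))) (at (x i))"

definition has_partial_deriv :: "nat \<Rightarrow> ((nat \<Rightarrow> real) \<Rightarrow> 'b::real_normed_vector) \<Rightarrow> (nat \<Rightarrow> real) \<Rightarrow> bool"
  where "has_partial_deriv i f x \<longleftrightarrow> (\<lambda>t. f (x(i := t))) differentiable (at (x i))"

text \<open>
  \<open>W\<close> is meant to be open in \<open>Euclidean_space n\<close>; a list \<open>is\<close> of indices below \<open>n\<close> encodes
  the iterated partial derivative in these directions.
\<close>

definition smooth_on :: "nat \<Rightarrow> (nat \<Rightarrow> real) set \<Rightarrow> ((nat \<Rightarrow> real) \<Rightarrow> 'b::real_normed_vector) \<Rightarrow> bool"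
  where "smooth_on n W f \<longleftrightarrow>
    (\<forall>is. set is \<subseteq> {..<n} \<longrightarrow>
       continuous_on W (foldr partial_deriv is f) \<and>
       (\<forall>i<n. \<forall>x\<in>W. has_partial_deriv i (foldr partial_deriv is f) x))"


section \<open>Smooth manifolds\<close>

text \<open>
  A chart is a pair of its domain and its coordinate map (its values elsewhere are irrelevant).
  \<open>charts\<close> is an atlas, not necessarily maximal.
\<close>

record 'm manifold =
  mtop :: "'m topology"
  mdim :: nat
  charts :: "('m set \<times> ('m \<Rightarrow> nat \<Rightarrow> real)) set"

abbreviation points :: "'m manifold \<Rightarrow> 'm set"
  where "points M \<equiv> topspace (mtop M)"

definition smooth_manifold :: "'m manifold \<Rightarrow> bool"
  where "smooth_manifold M \<longleftrightarrow>
    Hausdorff_space (mtop M) \<and> second_countable (mtop M) \<and>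
    \<Union> (fst ` charts M) = points M \<and>
    (\<forall>(U, \<phi>)\<in>charts M. openin (mtop M) U \<and> openin (Euclidean_space (mdim M)) (\<phi> ` U) \<and>
       homeomorphic_map (subtopology (mtop M) U) (subtopology (Euclidean_space (mdim M)) (\<phi> ` U)) \<phi>) \<and>
    (\<forall>(U, \<phi>)\<in>charts M. \<forall>(V, \<psi>)\<in>charts M. \<forall>j<mdim M.
       smooth_on (mdim M) (\<phi> ` (U \<inter> V)) (\<lambda>x. \<psi> (inv_into U \<phi> x) j))"

definition smooth_map :: "'m manifold \<Rightarrow> 'n manifold \<Rightarrow> ('m \<Rightarrow> 'n) \<Rightarrow> bool"
  where "smooth_map M N f \<longleftrightarrow>
    continuous_map (mtop M) (mtop N) f \<and>
    (\<forall>(U, \<phi>)\<in>charts M. \<forall>(V, \<psi>)\<in>charts N. \<forall>j<mdim N.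
       smooth_on (mdim M) (\<phi> ` {x \<in> U. f x \<in> V}) (\<lambda>y. \<psi> (f (inv_into U \<phi> y)) j))"

definition diffeomorphism :: "'m manifold \<Rightarrow> 'n manifold \<Rightarrow> ('m \<Rightarrow> 'n) \<Rightarrow> bool"
  where "diffeomorphism M N f \<longleftrightarrow>
    smooth_map M N f \<and>
    (\<exists>h. smooth_map N M h \<and> (\<forall>x\<in>points M. h (f x) = x) \<and> (\<forall>y\<in>points N. f (h y) = y))"

definition open_submanifold :: "'m manifold \<Rightarrow> 'm set \<Rightarrow> 'm manifold"
  where "open_submanifold M W =
    \<lparr>mtop = subtopology (mtop M) W, mdim = mdim M,
     charts = (\<lambda>(U, \<phi>). (U \<inter> W, \<phi>)) ` charts M\<rparr>"

definition product_chart :: "nat \<Rightarrow> ('m \<Rightarrow> nat \<Rightarrow> real) \<Rightarrow> ('n \<Rightarrow> nat \<Rightarrow> real) \<Rightarrow> 'm \<times> 'n \<Rightarrow> nat \<Rightarrow> real"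
  where "product_chart m \<phi> \<psi> = (\<lambda>(x, y) i. if i < m then \<phi> x i else \<psi> y (i - m))"

definition product_manifold :: "'m manifold \<Rightarrow> 'n manifold \<Rightarrow> ('m \<times> 'n) manifold"
  where "product_manifold M N =
    \<lparr>mtop = prod_topology (mtop M) (mtop N), mdim = mdim M + mdim N,
     charts = {(U \<times> V, product_chart (mdim M) \<phi> \<psi>) | U \<phi> V \<psi>.
                 (U, \<phi>) \<in> charts M \<and> (V, \<psi>) \<in> charts N}\<rparr>"


section \<open>Lie groups and principal fibre bundles\<close>

definition lie_group :: "'g manifold \<Rightarrow> 'g monoid \<Rightarrow> bool"
  where "lie_group GM G \<longleftrightarrow>
    smooth_manifold GM \<and> group G \<and> carrier G = points GM \<and>
    smooth_map (product_manifold GM GM) GM (\<lambda>(g, h). g \<otimes>\<^bsub>G\<^esub> h) \<and>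
    smooth_map GM GM (\<lambda>g. inv\<^bsub>G\<^esub> g)"

text \<open>
  \<open>r u g\<close> is the right action of \<open>g\<close> on \<open>u\<close>. Surjectivity of \<open>p\<close>, freeness of the action and
  its transitivity on the fibres are consequences of equivariant local triviality.
\<close>

definition principal_bundle ::
  "'p manifold \<Rightarrow> 'm manifold \<Rightarrow> 'g manifold \<Rightarrow> 'g monoid \<Rightarrow> ('p \<Rightarrow> 'g \<Rightarrow> 'p) \<Rightarrow> ('p \<Rightarrow> 'm) \<Rightarrow> bool"
  where "principal_bundle P M GM G r p \<longleftrightarrow>
    smooth_manifold P \<and> smooth_manifold M \<and> lie_group GM G \<and>
    smooth_map P M p \<and>
    smooth_map (product_manifold P GM) P (\<lambda>(u, g). r u g) \<and>
    (\<forall>u\<in>points P. r u \<one>\<^bsub>G\<^esub> = u) \<and>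
    (\<forall>u\<in>points P. \<forall>g\<in>carrier G. \<forall>h\<in>carrier G. r (r u g) h = r u (g \<otimes>\<^bsub>G\<^esub> h)) \<and>
    (\<forall>u\<in>points P. \<forall>g\<in>carrier G. p (r u g) = p u) \<and>
    (\<forall>x\<in>points M. \<exists>U \<tau>. openin (mtop M) U \<and> x \<in> U \<and>
       diffeomorphism (open_submanifold P {u \<in> points P. p u \<in> U})
                      (product_manifold (open_submanifold M U) GM) \<tau> \<and>
       (\<forall>u\<in>points P. p u \<in> U \<longrightarrow>
          fst (\<tau> u) = p u \<and>
          (\<forall>g\<in>carrier G. \<tau> (r u g) = (fst (\<tau> u), snd (\<tau> u) \<otimes>\<^bsub>G\<^esub> g))))"


section \<open>Smooth functions and differential operators\<close>

text \<open>
  Complex-valued smooth functions. They are normalised to be 0 outside of the manifold, so that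
  equality in HOL is equality of functions on the manifold.
\<close>

definition Cinf :: "'m manifold \<Rightarrow> ('m \<Rightarrow> complex) set"
  where "Cinf M = {f. (\<forall>x. x \<notin> points M \<longrightarrow> f x = 0) \<and>
    (\<forall>(U, \<phi>)\<in>charts M. smooth_on (mdim M) (\<phi> ` U) (\<lambda>y. f (inv_into U \<phi> y)))}"

definition one_fun :: "'m manifold \<Rightarrow> 'm \<Rightarrow> complex"
  where "one_fun M = (\<lambda>x. if x \<in> points M then 1 else 0)"

definition pullback :: "'y manifold \<Rightarrow> ('y \<Rightarrow> 'x) \<Rightarrow> ('x \<Rightarrow> complex) \<Rightarrow> 'y \<Rightarrow> complex"
  where "pullback Y q f = (\<lambda>y. if y \<in> points Y then f (q y) else 0)"

definition linear_op :: "'x manifold \<Rightarrow> 'y manifold \<Rightarrow> (('x \<Rightarrow> complex) \<Rightarrow> 'y \<Rightarrow> complex) \<Rightarrow> bool"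
  where "linear_op X Y D \<longleftrightarrow>
    (\<forall>f\<in>Cinf X. D f \<in> Cinf Y) \<and>
    (\<forall>f\<in>Cinf X. \<forall>h\<in>Cinf X. D (\<lambda>x. f x + h x) = (\<lambda>y. D f y + D h y)) \<and>
    (\<forall>c. \<forall>f\<in>Cinf X. D (\<lambda>x. c * f x) = (\<lambda>y. c * D f y))"

text \<open>
  Differential operators in the algebraic sense of Grothendieck. For smooth \<open>q\<close> from \<open>Y\<close> to \<open>X\<close>,
  \<open>Cinf Y\<close> is a \<open>Cinf X\<close>-module via \<open>q\<close>, and \<open>diffop_lt X Y q k D\<close> says that the linear operator
  \<open>D\<close> from \<open>Cinf X\<close> to \<open>Cinf Y\<close> is a differential operator of order strictly less than \<open>k\<close>
  along \<open>q\<close>: commutators with multiplication by functions lower the order, and only the zero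
  operator has negative order. In local coordinates these are the finite sums of
  terms \<open>c\<^sub>I \<cdot> (\<partial>\<^sub>I f \<circ> q)\<close> with smooth coefficients \<open>c\<^sub>I\<close>.
\<close>

fun diffop_lt :: "'x manifold \<Rightarrow> 'y manifold \<Rightarrow> ('y \<Rightarrow> 'x) \<Rightarrow> nat \<Rightarrow> (('x \<Rightarrow> complex) \<Rightarrow> 'y \<Rightarrow> complex) \<Rightarrow> bool"
  where
    "diffop_lt X Y q 0 D \<longleftrightarrow> (\<forall>f\<in>Cinf X. D f = (\<lambda>y. 0))"
  | "diffop_lt X Y q (Suc k) D \<longleftrightarrow>
       linear_op X Y D \<and>
       (\<forall>h\<in>Cinf X. diffop_lt X Y q k (\<lambda>f y. pullback Y q h y * D f y - D (\<lambda>x. h x * f x) y))"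

definition differential_operator :: "'x manifold \<Rightarrow> (('x \<Rightarrow> complex) \<Rightarrow> 'x \<Rightarrow> complex) \<Rightarrow> bool"
  where "differential_operator X D \<longleftrightarrow> (\<exists>k. diffop_lt X X (\<lambda>x. x) k D) \<and> linear_op X X D"

text \<open>
  Bidifferential operators from \<open>Cinf X \<times> Cinf X'\<close> to \<open>Cinf Y\<close>, where functions on \<open>X\<close>
  and on \<open>X'\<close> act on \<open>Cinf Y\<close> via \<open>q\<close> and \<open>q'\<close>: bilinear, and differential of bounded order in
  each argument (the bound for one argument being uniform in the other).
\<close>

definition bidifferential_operator ::
  "'x manifold \<Rightarrow> 'x2 manifold \<Rightarrow> 'y manifold \<Rightarrow> ('y \<Rightarrow> 'x) \<Rightarrow> ('y \<Rightarrow> 'x2) \<Rightarrow>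
   (('x \<Rightarrow> complex) \<Rightarrow> ('x2 \<Rightarrow> complex) \<Rightarrow> 'y \<Rightarrow> complex) \<Rightarrow> bool"
  where "bidifferential_operator X X' Y q q' D \<longleftrightarrow>
    (\<forall>a\<in>Cinf X'. linear_op X Y (\<lambda>f. D f a)) \<and>
    (\<forall>f\<in>Cinf X. linear_op X' Y (\<lambda>a. D f a)) \<and>
    (\<exists>k l. (\<forall>a\<in>Cinf X'. diffop_lt X Y q k (\<lambda>f. D f a)) \<and>
           (\<forall>f\<in>Cinf X. diffop_lt X' Y q' l (\<lambda>a. D f a)))"


section \<open>Formal power series of smooth functions\<close>

definition formal_Cinf :: "'m manifold \<Rightarrow> ('m \<Rightarrow> complex) fps set"
  where "formal_Cinf M = {a. \<forall>n. fps_nth a n \<in> Cinf M}"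

text \<open>
  The extensions, linear resp. bilinear over formal power series with complex coefficients, of
  the formal series of operators with coefficients \<open>T r\<close> resp. \<open>C r\<close> of the \<open>r\<close>-th power of
  the formal parameter.
\<close>

definition formal_linear ::
  "(nat \<Rightarrow> ('x \<Rightarrow> complex) \<Rightarrow> 'y \<Rightarrow> complex) \<Rightarrow> ('x \<Rightarrow> complex) fps \<Rightarrow> ('y \<Rightarrow> complex) fps"
  where "formal_linear T f = Abs_fps (\<lambda>n y. \<Sum>r\<le>n. T r (fps_nth f (n - r)) y)"

definition formal_bilinear ::
  "(nat \<Rightarrow> ('x \<Rightarrow> complex) \<Rightarrow> ('x2 \<Rightarrow> complex) \<Rightarrow> 'y \<Rightarrow> complex) \<Rightarrow>
   ('x \<Rightarrow> complex) fps \<Rightarrow> ('x2 \<Rightarrow> complex) fps \<Rightarrow> ('y \<Rightarrow> complex) fps"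
  where "formal_bilinear C f a =
    Abs_fps (\<lambda>n y. \<Sum>r\<le>n. \<Sum>i\<le>n - r. C r (fps_nth f i) (fps_nth a (n - r - i)) y)"

definition formal_pullback :: "'y manifold \<Rightarrow> ('y \<Rightarrow> 'x) \<Rightarrow> ('x \<Rightarrow> complex) fps \<Rightarrow> ('y \<Rightarrow> complex) fps"
  where "formal_pullback Y q f = Abs_fps (\<lambda>n. pullback Y q (fps_nth f n))"

definition formal_one :: "'m manifold \<Rightarrow> ('m \<Rightarrow> complex) fps"
  where "formal_one M = Abs_fps (\<lambda>n. if n = 0 then one_fun M else (\<lambda>x. 0))"


section \<open>Star products and deformation quantization of principal fibre bundles\<close>

text \<open>
  In the following definitions, bilinearity (linearity) over formal power series is part of the
  form \<open>formal_bilinear\<close> (\<open>formal_linear\<close>) of the operations.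
\<close>

definition star_product ::
  "'m manifold \<Rightarrow> (('m \<Rightarrow> complex) fps \<Rightarrow> ('m \<Rightarrow> complex) fps \<Rightarrow> ('m \<Rightarrow> complex) fps) \<Rightarrow> bool"
  where "star_product M star \<longleftrightarrow>
    (\<exists>C. (\<forall>r. bidifferential_operator M M M (\<lambda>x. x) (\<lambda>x. x) (C r)) \<and>
         (\<forall>a\<in>Cinf M. \<forall>b\<in>Cinf M. C 0 a b = (\<lambda>x. a x * b x)) \<and>
         (\<forall>a\<in>formal_Cinf M. \<forall>b\<in>formal_Cinf M. star a b = formal_bilinear C a b)) \<and>
    (\<forall>a\<in>formal_Cinf M. \<forall>b\<in>formal_Cinf M. \<forall>c\<in>formal_Cinf M.
       star (star a b) c = star a (star b c)) \<and>
    (\<forall>a\<in>formal_Cinf M. star (formal_one M) a = a \<and> star a (formal_one M) = a)"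

definition deformation_quantization ::
  "'p manifold \<Rightarrow> 'm manifold \<Rightarrow> 'g monoid \<Rightarrow> ('p \<Rightarrow> 'g \<Rightarrow> 'p) \<Rightarrow> ('p \<Rightarrow> 'm) \<Rightarrow>
   (('m \<Rightarrow> complex) fps \<Rightarrow> ('m \<Rightarrow> complex) fps \<Rightarrow> ('m \<Rightarrow> complex) fps) \<Rightarrow>
   (('p \<Rightarrow> complex) fps \<Rightarrow> ('m \<Rightarrow> complex) fps \<Rightarrow> ('p \<Rightarrow> complex) fps) \<Rightarrow> bool"
  where "deformation_quantization P M G r p star act \<longleftrightarrow>
    (\<exists>\<rho>. (\<forall>f\<in>Cinf P. \<forall>a\<in>Cinf M. \<rho> 0 f a = (\<lambda>u. f u * pullback P p a u)) \<and>
         (\<forall>k\<ge>1. bidifferential_operator P M P (\<lambda>u. u) p (\<rho> k)) \<and>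
         (\<forall>f\<in>formal_Cinf P. \<forall>a\<in>formal_Cinf M. act f a = formal_bilinear \<rho> f a)) \<and>
    (\<forall>f\<in>formal_Cinf P. \<forall>a\<in>formal_Cinf M. \<forall>b\<in>formal_Cinf M.
       act (act f a) b = act f (star a b)) \<and>
    (\<forall>f\<in>formal_Cinf P. act f (formal_one M) = f) \<and>
    (\<forall>f\<in>formal_Cinf P. \<forall>a\<in>formal_Cinf M. \<forall>g\<in>carrier G.
       formal_pullback P (\<lambda>u. r u g) (act f a) = act (formal_pullback P (\<lambda>u. r u g) f) a)"

definition equivalent_deformation_quantizations ::
  "'p manifold \<Rightarrow> 'm manifold \<Rightarrow> 'g monoid \<Rightarrow> ('p \<Rightarrow> 'g \<Rightarrow> 'p) \<Rightarrow>
   (('p \<Rightarrow> complex) fps \<Rightarrow> ('m \<Rightarrow> complex) fps \<Rightarrow> ('p \<Rightarrow> complex) fps) \<Rightarrow>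
   (('p \<Rightarrow> complex) fps \<Rightarrow> ('m \<Rightarrow> complex) fps \<Rightarrow> ('p \<Rightarrow> complex) fps) \<Rightarrow> bool"
  where "equivalent_deformation_quantizations P M G r act act' \<longleftrightarrow>
    (\<exists>T. (\<forall>f\<in>Cinf P. T 0 f = f) \<and>
         (\<forall>k\<ge>1. differential_operator P (T k)) \<and>
         (\<forall>k\<ge>1. \<forall>g\<in>carrier G. \<forall>f\<in>Cinf P.
            pullback P (\<lambda>u. r u g) (T k f) = T k (pullback P (\<lambda>u. r u g) f)) \<and>
         (\<forall>f\<in>formal_Cinf P. \<forall>a\<in>formal_Cinf M.
            formal_linear T (act f a) = act' (formal_linear T f) a))"

definition preserves_fibration ::
  "'p manifold \<Rightarrow> 'm manifold \<Rightarrow> ('p \<Rightarrow> 'm) \<Rightarrow>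
   (('m \<Rightarrow> complex) fps \<Rightarrow> ('m \<Rightarrow> complex) fps \<Rightarrow> ('m \<Rightarrow> complex) fps) \<Rightarrow>
   (('p \<Rightarrow> complex) fps \<Rightarrow> ('m \<Rightarrow> complex) fps \<Rightarrow> ('p \<Rightarrow> complex) fps) \<Rightarrow> bool"
  where "preserves_fibration P M p star act \<longleftrightarrow>
    (\<forall>a\<in>formal_Cinf M. \<forall>b\<in>formal_Cinf M.
       act (formal_pullback P p a) b = formal_pullback P p (star a b))"

end

theory Submission
  imports Defs
begin

text \<open>
  The construction proceeds order by order in \<open>\<lambda>\<close>. The obstruction at each order is a Hochschild
  cocycle of \<open>C\<^sup>\<infinity>(M)\<close> with values in the invariant differential operators on \<open>P\<close>, regarded as
  a multidifferential operator \<open>\<phi>(f; a, b, \<dots>)\<close> in the function \<open>f\<close> on \<open>P\<close> it is applied to and in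
  its arguments on \<open>M\<close>. For a trivial bundle with a function \<open>f = f(x, g)\<close> that is a sum of products
  \<open>\<alpha>(x) \<beta>(g)\<close>, a contracting homotopy is \<open>(h \<phi>)(f; b, \<dots>) = \<Sum> \<phi>(\<beta>; \<alpha>, b, \<dots>)\<close>: the dependence of \<open>f\<close> on
  the base point is moved to the first argument. For general \<open>f\<close> the Taylor formula in the base
  coordinates expresses this by finitely many derivatives of \<open>f\<close> along the invariant lifts of
  the coordinate vector fields, because iterated commutators of a differential operator with
  coordinate functions vanish. The local homotopies are linear over \<open>C\<^sup>\<infinity>(M)\<close> in the output, so they
  are glued by a partition of unity. They satisfy \<open>(h \<phi>)(p\<^sup>* c; b) = \<phi>(1; c, b)\<close>, which makes the
  constructed module structure preserve the fibration.
\<close>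

text \<open>Both cohomological arguments use only three formal properties of the homotopy
  \<open>h\<close>: it is linear over functions on \<open>P\<close> in the output; replacing the
  argument \<open>a\<close> by \<open>a b\<close> amounts to replacing \<open>f\<close> by
  \<open>f b\<close>; and an operator \<open>D (f a)\<close> of the product is sent to
  \<open>D f\<close>. Applying \<open>h\<close> to a cocycle identity in its first argument on
  \<open>M\<close> then yields the coboundary equation. Invariance cannot come from averaging, since
  \<open>G\<close> may be noncompact. It holds because a trivialization turns the action into right
  multiplication on the group component, with which derivatives in the base direction commute, and
  because the partition functions live on the base. Differential operators are given by iterated
  commutators, and no normal form with coefficients is derived: every statement about them is an
  induction on the order, and Hadamard's lemma is what links commutators with coordinates to
  commutators with all functions. The number of Taylor terms is a function of the order bounds of
  the cochain alone, the same on every patch and for all values of the remaining arguments, so that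
  the glued operator has finite order and is visibly linear in these arguments.\<close>

lemma Euclidean_space_top_of_set: "Euclidean_space n = top_of_set {x. \<forall>i\<ge>n. x i = 0}"
  by (simp add: Euclidean_space_def euclidean_product_topology)

lemma openin_Euclidean_zero: "openin (Euclidean_space n) W \<Longrightarrow> x \<in> W \<Longrightarrow> n \<le> i \<Longrightarrow> x i = 0"
  using openin_subset[of "Euclidean_space n" W] by (auto simp: topspace_Euclidean_space)

section \<open>Boxes and coordinate lines in the model space\<close>

definition ebox :: "nat \<Rightarrow> (nat \<Rightarrow> real) \<Rightarrow> real \<Rightarrow> (nat \<Rightarrow> real) set"
  where "ebox n z \<epsilon> = {w. (\<forall>j<n. \<bar>w j - z j\<bar> < \<epsilon>) \<and> (\<forall>j\<ge>n. w j = 0)}"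

lemma openin_ebox: "openin (Euclidean_space n) (ebox n z \<epsilon>)"
proof -
  have "open (\<Inter>j\<in>{..<n}. {w::nat \<Rightarrow> real. \<bar>w j - z j\<bar> < \<epsilon>})"
    by (intro open_INT finite_lessThan ballI open_Collect_less continuous_intros continuous_on_subset[OF continuous_on_product_coordinates subset_UNIV])
  moreover have "ebox n z \<epsilon> = {x. \<forall>i\<ge>n. x i = 0} \<inter> (\<Inter>j\<in>{..<n}. {w. \<bar>w j - z j\<bar> < \<epsilon>})"
    by (auto simp: ebox_def)
  ultimately show ?thesis
    unfolding Euclidean_space_top_of_set by (auto simp: openin_open)
qed

text \<open>Boxes serve as the neighbourhoods throughout: they are stable under moving a single
  coordinate and under segments, as partial derivatives and Hadamard's lemma require.\<close>

lemma openin_Euclidean_imp_ebox: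
  assumes W: "openin (Euclidean_space n) W" and x: "x \<in> W"
  obtains \<delta> where "\<delta> > 0" "ebox n x \<delta> \<subseteq> W"
proof -
  obtain T where T: "open T" "W = {x. \<forall>i\<ge>n. x i = 0} \<inter> T"
    using W unfolding Euclidean_space_top_of_set openin_open by auto
  have "openin (product_topology (\<lambda>i. euclidean) UNIV) T"
    using T by (simp add: euclidean_product_topology)
  moreover have "x \<in> T" using x T by auto
  ultimately obtain X where X: "x \<in> (\<Pi>\<^sub>E i\<in>UNIV. X i)" "\<And>i. openin euclidean (X i)"
     "(\<Pi>\<^sub>E i\<in>UNIV. X i) \<subseteq> T"
    using product_topology_open_contains_basis[of "\<lambda>i. euclidean" UNIV T x] by blast
  have "\<exists>e>0. ball (x i) e \<subseteq> X i" for i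
    using X(1,2) by (metis PiE_iff UNIV_I open_contains_ball open_openin)
  then obtain e where e: "\<And>i. e i > 0" "\<And>i. ball (x i) (e i) \<subseteq> X i" by metis
  \<comment> \<open>The extra 1 keeps the minimum defined for \<open>n = 0\<close>. Coordinates from
    \<open>n\<close> on need no bound, since they vanish both at \<open>x\<close> and in the
    box.\<close>
  define \<delta> where "\<delta> = Min (insert 1 (e ` {..<n}))"
  have "\<delta> > 0" unfolding \<delta>_def using e(1) by (subst Min_gr_iff) auto
  have \<delta>: "\<delta> \<le> e i" if "i < n" for i unfolding \<delta>_def using that by (intro Min_le) auto
  have x0: "x i = 0" if "i \<ge> n" for i using x T that by auto
  have "w \<in> W" if w: "w \<in> ebox n x \<delta>" for w
  proof -
    have "w i \<in> X i" for i
    proof (cases "i < n")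
      case True
      then have "w i \<in> ball (x i) (e i)"
        using w \<delta>[OF True] by (auto simp: ebox_def dist_real_def abs_minus_commute)
      then show ?thesis using e(2) by blast
    next
      case False
      then have "w i = x i" using w x0 by (auto simp: ebox_def)
      then show ?thesis using e[of i] by auto
    qed
    then have "w \<in> T" using X(3) by auto
    then show ?thesis using T w by (auto simp: ebox_def)
  qed
  then show ?thesis using that \<open>\<delta> > 0\<close> by blast
qed

lemma continuous_fun_upd: "continuous_on A (\<lambda>t::real. x(i := t) :: nat \<Rightarrow> real)"
proof (rule continuous_on_coordinatewise_then_product)
  show "continuous_on A (\<lambda>t. (x(i := t)) j)" for j
    by (cases "j = i") (auto intro: continuous_intros)
qed

lemma line_open:
  assumes W: "openin (Euclidean_space n) W" and x: "x \<in> W" and i: "i < n"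
  shows "\<exists>S. open S \<and> x i \<in> S \<and> (\<forall>t\<in>S. x(i := t) \<in> W)"
proof -
  obtain \<delta> where \<delta>: "\<delta> > 0" "ebox n x \<delta> \<subseteq> W"
    using openin_Euclidean_imp_ebox[OF W x] .
  have "x(i := t) \<in> W" if "t \<in> ball (x i) \<delta>" for t
    using that \<delta> openin_Euclidean_zero[OF W x] i
    by (intro subsetD[OF \<delta>(2)]) (auto simp: ebox_def dist_real_def abs_minus_commute)
  then show ?thesis using \<delta> by (intro exI[of _ "ball (x i) \<delta>"]) auto
qed

lemma line_eventually:
  assumes "openin (Euclidean_space n) W" "x \<in> W" "i < n"
  shows "\<forall>\<^sub>F t in nhds (x i). x(i := t) \<in> W"
  using line_open[OF assms] by (auto simp: eventually_nhds)

subsection \<open>Finite differentiability\<close>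

text \<open>Lists of derivative indices give no usable induction hypothesis for products and
  compositions, whose derivatives are sums of terms of the same kind. Counting orders does; smooth
  functions are those that are \<open>Ck k\<close> for every \<open>k\<close>.\<close>

primrec Ck :: "nat \<Rightarrow> nat \<Rightarrow> (nat \<Rightarrow> real) set \<Rightarrow> ((nat \<Rightarrow> real) \<Rightarrow> 'b::real_normed_vector) \<Rightarrow> bool"
  where
    "Ck 0 = (\<lambda>n W f. continuous_on W f)"
  | "Ck (Suc k) = (\<lambda>n W f. continuous_on W f \<and>
       (\<forall>i<n. (\<forall>x\<in>W. has_partial_deriv i f x) \<and> Ck k n W (partial_deriv i f)))"

lemma has_partial_derivD:
  "has_partial_deriv i f x \<Longrightarrow> ((\<lambda>t. f (x(i := t))) has_vector_derivative partial_deriv i f x) (at (x i))"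
  unfolding has_partial_deriv_def partial_deriv_def by (simp add: vector_derivative_works)

lemma has_partial_derivI:
  assumes "((\<lambda>t. f (x(i := t))) has_vector_derivative d) (at (x i))"
  shows "has_partial_deriv i f x" "partial_deriv i f x = d"
  using assms unfolding has_partial_deriv_def partial_deriv_def
  by (auto intro: differentiableI_vector vector_derivative_at)

lemma partial_deriv_transform:
  assumes W: "openin (Euclidean_space n) W" and x: "x \<in> W" and i: "i < n"
    and eq: "\<And>y. y \<in> W \<Longrightarrow> f y = g y" and f: "has_partial_deriv i f x"
  shows "has_partial_deriv i g x" "partial_deriv i g x = partial_deriv i f x"
proof -
  obtain S where S: "open S" "x i \<in> S" "\<forall>t\<in>S. x(i := t) \<in> W"
    using line_open[OF W x i] by blast
  have "((\<lambda>t. g (x(i := t))) has_vector_derivative partial_deriv i f x) (at (x i))"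
    using has_partial_derivD[OF f] S(1,2)
    by (rule has_vector_derivative_transform_within_open) (use S(3) eq in auto)
  then show "has_partial_deriv i g x" "partial_deriv i g x = partial_deriv i f x"
    by (auto intro: has_partial_derivI)
qed

lemma Ck_continuous: "Ck k n W f \<Longrightarrow> continuous_on W f"
  by (cases k) auto

lemma Ck_cong:
  assumes W: "openin (Euclidean_space n) W"
  shows "Ck k n W f \<Longrightarrow> (\<And>y. y \<in> W \<Longrightarrow> f y = g y) \<Longrightarrow> Ck k n W g"
proof (induction k arbitrary: f g)
  case 0
  then show ?case using continuous_on_eq by auto
next
  case (Suc k)
  have "continuous_on W g" using Suc.prems continuous_on_eq by auto
  moreover have "(\<forall>x\<in>W. has_partial_deriv i g x) \<and> Ck k n W (partial_deriv i g)" if i: "i < n" for i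
  proof (intro conjI ballI)
    fix x assume x: "x \<in> W"
    show "has_partial_deriv i g x"
      using partial_deriv_transform(1)[OF W x i Suc.prems(2)] Suc.prems(1) i x by auto
  next
    have eq: "partial_deriv i f x = partial_deriv i g x" if x: "x \<in> W" for x
      using partial_deriv_transform(2)[OF W x i Suc.prems(2)] Suc.prems(1) i x by auto
    have "Ck k n W (partial_deriv i f)" using Suc.prems(1) i by simp
    then show "Ck k n W (partial_deriv i g)" using eq by (rule Suc.IH)
  qed
  ultimately show ?case by simp
qed

text \<open>Lets the closure proofs supply the derivatives as formulas that are correct on
  \<open>W\<close> only, without computing \<open>partial_deriv\<close>.\<close>

lemma Ck_SucI:
  assumes W: "openin (Euclidean_space n) W" and "continuous_on W f"
    and d: "\<And>i x. i < n \<Longrightarrow> x \<in> W \<Longrightarrow> ((\<lambda>t. f (x(i := t))) has_vector_derivative f' i x) (at (x i))"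
    and c: "\<And>i. i < n \<Longrightarrow> Ck k n W (f' i)"
  shows "Ck (Suc k) n W f"
proof -
  have "Ck k n W (partial_deriv i f)" if "i < n" for i
  proof (rule Ck_cong[OF W c[OF that]])
    show "f' i x = partial_deriv i f x" if "x \<in> W" for x
      using has_partial_derivI(2)[OF d[OF \<open>i < n\<close> that]] by simp
  qed
  moreover have "has_partial_deriv i f x" if "i < n" "x \<in> W" for i x
    using has_partial_derivI(1)[OF d[OF that]] .
  ultimately show ?thesis using assms by auto
qed

lemma Ck_SucD:
  assumes "Ck (Suc k) n W f" "i < n"
  shows "\<And>x. x \<in> W \<Longrightarrow> ((\<lambda>t. f (x(i := t))) has_vector_derivative partial_deriv i f x) (at (x i))"
    and "Ck k n W (partial_deriv i f)"
  using assms by (auto intro: has_partial_derivD)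

lemma Ck_Suc_imp: "Ck (Suc k) n W f \<Longrightarrow> Ck k n W f"
proof (induction k arbitrary: f)
  case (Suc k)
  have "Ck k n W (partial_deriv i f)" if "i < n" for i
    using Suc.prems that by (intro Suc.IH) simp
  then show ?case using Suc.prems by simp
qed simp

lemma Ck_subset: "Ck k n W f \<Longrightarrow> W' \<subseteq> W \<Longrightarrow> Ck k n W' f"
  by (induction k arbitrary: f) (auto intro: continuous_on_subset)

text \<open>An open set of the model space is not open in the type
  \<open>nat \<Rightarrow> real\<close>. The filters \<open>at x within W\<close> and
  \<open>at x within V\<close> agree nevertheless, because both sets are cut out of the same
  subspace by open sets around \<open>x\<close>.\<close>

lemma continuous_on_openin_local:
  assumes W: "openin (Euclidean_space n) W"
    and loc: "\<And>x. x \<in> W \<Longrightarrow> \<exists>V. openin (Euclidean_space n) V \<and> x \<in> V \<and> continuous_on V f"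
  shows "continuous_on W f"
proof -
  have "continuous (at x within W) f" if x: "x \<in> W" for x
  proof -
    obtain V where V: "openin (Euclidean_space n) V" "x \<in> V" "continuous_on V f"
      using loc[OF x] by blast
    obtain T where T: "open T" "W = {x. \<forall>i\<ge>n. x i = 0} \<inter> T"
      using W unfolding Euclidean_space_top_of_set openin_open by auto
    obtain S where S: "open S" "V = {x. \<forall>i\<ge>n. x i = 0} \<inter> S"
      using V unfolding Euclidean_space_top_of_set openin_open by auto
    have "at x within W = at x within V"
      by (rule at_within_nhd[of _ "S \<inter> T"]) (use S T V x in auto)
    then show ?thesis using V by (auto simp: continuous_on_eq_continuous_within)
  qed
  then show ?thesis by (auto simp: continuous_on_eq_continuous_within)
qed

lemma Ck_local:
  assumes W: "openin (Euclidean_space n) W"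
  shows "(\<And>x. x \<in> W \<Longrightarrow> \<exists>V. openin (Euclidean_space n) V \<and> x \<in> V \<and> Ck k n V f) \<Longrightarrow> Ck k n W f"
proof (induction k arbitrary: f)
  case 0
  then show ?case using continuous_on_openin_local[OF W, of f] by simp
next
  case (Suc k)
  have "continuous_on W f"
    by (rule continuous_on_openin_local[OF W]) (use Suc.prems in fastforce)
  moreover have "Ck k n W (partial_deriv i f)" if "i < n" for i
    by (rule Suc.IH) (use Suc.prems that in fastforce)
  moreover have "has_partial_deriv i f x" if "i < n" "x \<in> W" for i x
    using Suc.prems[OF that(2)] that by auto
  ultimately show ?case by auto
qed

lemma smooth_on_imp_Ck:
  fixes f :: "(nat \<Rightarrow> real) \<Rightarrow> 'b::real_normed_vector"
  shows "smooth_on n W f \<Longrightarrow> Ck k n W f"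
proof (induction k arbitrary: f)
  case 0
  then show ?case unfolding smooth_on_def by (auto dest: spec[of _ "[]"])
next
  case (Suc k)
  have "smooth_on n W (partial_deriv i f)" if i: "i < n" for i
    unfolding smooth_on_def
  proof (intro allI impI)
    fix "is" :: "nat list" assume s: "set is \<subseteq> {..<n}"
    \<comment> \<open>\<open>foldr\<close> applies the last index of the list first, so the
      derivative taken first is appended at the end.\<close>
    have "set (is @ [i]) \<subseteq> {..<n}" using s i by auto
    then show "continuous_on W (foldr partial_deriv is (partial_deriv i f)) \<and>
      (\<forall>ia<n. \<forall>x\<in>W. has_partial_deriv ia (foldr partial_deriv is (partial_deriv i f)) x)"
      using Suc.prems[unfolded smooth_on_def, rule_format, of "is @ [i]"] by simp
  qed
  moreover have "continuous_on W f" "\<And>i x. i < n \<Longrightarrow> x \<in> W \<Longrightarrow> has_partial_deriv i f x"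
    using Suc.prems[unfolded smooth_on_def, rule_format, of "[]"] by auto
  ultimately show ?case using Suc.IH by auto
qed

lemma smooth_on_iff_Ck:
  fixes f :: "(nat \<Rightarrow> real) \<Rightarrow> 'b::real_normed_vector"
  shows "smooth_on n W f \<longleftrightarrow> (\<forall>k. Ck k n W f)"
proof
  assume *: "\<forall>k. Ck k n W f"
  have "\<forall>k. Ck k n W (foldr partial_deriv is f)" if "set is \<subseteq> {..<n}" for "is"
    using that
  proof (induction "is")
    case (Cons i js)
    then have "i < n" "\<And>k. Ck k n W (foldr partial_deriv js f)" by auto
    then have "Ck k n W (partial_deriv i (foldr partial_deriv js f))" for k
      using Ck_SucD(2) by blast
    then show ?case by simp
  qed (use * in auto)
  then show "smooth_on n W f" unfolding smooth_on_def
    by (metis Ck.simps(2) Ck_continuous)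
qed (auto intro: smooth_on_imp_Ck)

subsection \<open>Closure properties\<close>

lemma Ck_const: "openin (Euclidean_space n) W \<Longrightarrow> Ck k n W (\<lambda>x. c)"
proof (induction k arbitrary: c)
  case (Suc k)
  show ?case by (rule Ck_SucI[where f'="\<lambda>i x. 0"]) (use Suc in \<open>auto\<close>)
qed simp

lemma Ck_coord:
  assumes W: "openin (Euclidean_space n) W" shows "Ck k n W (\<lambda>x. x j)"
proof (cases k)
  case 0
  then show ?thesis by (auto intro: continuous_intros continuous_on_subset[OF continuous_on_product_coordinates subset_UNIV])
next
  case (Suc k')
  have "Ck (Suc k') n W (\<lambda>x. x j)"
  proof (rule Ck_SucI[OF W, where f'="\<lambda>i x. if i = j then 1 else 0"])
    fix i x
    show "((\<lambda>t. (x(i := t)) j) has_vector_derivative (if i = j then 1 else 0)) (at (x i))"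
      by (cases "i = j") (auto intro!: derivative_eq_intros)
  qed (auto intro: continuous_on_subset[OF continuous_on_product_coordinates subset_UNIV] Ck_const[OF W])
  then show ?thesis using Suc by simp
qed

lemma Ck_bounded_linear:
  assumes L: "bounded_linear L" and W: "openin (Euclidean_space n) W"
  shows "Ck k n W f \<Longrightarrow> Ck k n W (\<lambda>x. L (f x))"
proof (induction k arbitrary: f)
  case 0
  then show ?case by (simp add: bounded_linear.continuous_on[OF L])
next
  case (Suc k)
  show ?case
  proof (rule Ck_SucI[OF W, where f'="\<lambda>i x. L (partial_deriv i f x)"])
    show "((\<lambda>t. L (f (x(i := t)))) has_vector_derivative L (partial_deriv i f x)) (at (x i))"
      if "i < n" "x \<in> W" for i x
      by (rule bounded_linear.has_vector_derivative[OF L Ck_SucD(1)[OF Suc.prems that]])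
  qed (use Suc in \<open>auto intro: bounded_linear.continuous_on[OF L]\<close>)
qed

lemma Ck_add:
  assumes W: "openin (Euclidean_space n) W"
  shows "Ck k n W f \<Longrightarrow> Ck k n W g \<Longrightarrow> Ck k n W (\<lambda>x. f x + g x)"
proof (induction k arbitrary: f g)
  case 0
  then show ?case by (simp add: continuous_on_add)
next
  case (Suc k)
  show ?case
  proof (rule Ck_SucI[OF W, where f'="\<lambda>i x. partial_deriv i f x + partial_deriv i g x"])
    show "((\<lambda>t. f (x(i := t)) + g (x(i := t))) has_vector_derivative partial_deriv i f x + partial_deriv i g x) (at (x i))"
      if "i < n" "x \<in> W" for i x
      by (rule has_vector_derivative_add[OF Ck_SucD(1)[OF Suc.prems(1) that] Ck_SucD(1)[OF Suc.prems(2) that]])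
  qed (use Suc in \<open>auto intro: continuous_on_add\<close>)
qed

lemma Ck_sum:
  assumes W: "openin (Euclidean_space n) W"
  shows "(\<And>s. s \<in> S \<Longrightarrow> Ck k n W (f s)) \<Longrightarrow> Ck k n W (\<lambda>x. \<Sum>s\<in>S. f s x)"
  by (induction S rule: infinite_finite_induct) (auto intro: Ck_add[OF W] Ck_const[OF W])

lemma Ck_bilinear:
  assumes B: "bounded_bilinear B" and W: "openin (Euclidean_space n) W"
  shows "Ck k n W f \<Longrightarrow> Ck k n W g \<Longrightarrow> Ck k n W (\<lambda>x. B (f x) (g x))"
proof (induction k arbitrary: f g)
  case 0
  then show ?case by (simp add: bounded_bilinear.continuous_on[OF B])
next
  case (Suc k)
  show ?case
  proof (rule Ck_SucI[OF W, where f'="\<lambda>i x. B (f x) (partial_deriv i g x) + B (partial_deriv i f x) (g x)"])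
    show "continuous_on W (\<lambda>x. B (f x) (g x))"
      using Suc.prems by (auto intro!: bounded_bilinear.continuous_on[OF B])
  next
    fix i x assume ix: "i < n" "x \<in> W"
    show "((\<lambda>t. B (f (x(i := t))) (g (x(i := t)))) has_vector_derivative
       B (f x) (partial_deriv i g x) + B (partial_deriv i f x) (g x)) (at (x i))"
      using bounded_bilinear.has_vector_derivative[OF B Ck_SucD(1)[OF Suc.prems(1) ix] Ck_SucD(1)[OF Suc.prems(2) ix]]
      unfolding fun_upd_triv .
  next
    fix i assume "i < n"
    then show "Ck k n W (\<lambda>x. B (f x) (partial_deriv i g x) + B (partial_deriv i f x) (g x))"
      using Suc.prems by (intro Ck_add[OF W] Suc.IH) (auto intro: Ck_Suc_imp)
  qed
qed

lemmas Ck_mult = Ck_bilinear[OF bounded_bilinear_mult]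
lemmas Ck_scaleR = Ck_bilinear[OF bounded_bilinear_scaleR]

text \<open>The derivative of \<open>1 / f\<close> contains \<open>1 / f\<close> again, but at one
  order less, so an induction on \<open>k\<close> with \<open>f\<close> fixed closes.\<close>

lemma Ck_inverse:
  fixes f :: "(nat \<Rightarrow> real) \<Rightarrow> real"
  assumes W: "openin (Euclidean_space n) W" and nz: "\<And>x. x \<in> W \<Longrightarrow> f x \<noteq> 0"
  shows "Ck k n W f \<Longrightarrow> Ck k n W (\<lambda>x. inverse (f x))"
proof (induction k)
  case 0
  then show ?case using nz by (auto intro!: continuous_on_inverse)
next
  case (Suc k)
  note I = Suc.IH[OF Ck_Suc_imp[OF Suc.prems]]
  show ?case
  proof (rule Ck_SucI[OF W, where f'="\<lambda>i x. - 1 * (inverse (f x) * partial_deriv i f x * inverse (f x))"])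
    show "continuous_on W (\<lambda>x. inverse (f x))"
      using Suc.prems nz by (auto intro!: continuous_on_inverse)
  next
    fix i x assume ix: "i < n" "x \<in> W"
    have "((\<lambda>t. f (x(i := t))) has_real_derivative partial_deriv i f x) (at (x i))"
      unfolding has_real_derivative_iff_has_vector_derivative by (rule Ck_SucD(1)[OF Suc.prems ix])
    from DERIV_inverse'[OF this]
    show "((\<lambda>t. inverse (f (x(i := t)))) has_vector_derivative
       - 1 * (inverse (f x) * partial_deriv i f x * inverse (f x))) (at (x i))"
      using nz[OF ix(2)] by (simp add: has_real_derivative_iff_has_vector_derivative)
  next
    fix i assume "i < n"
    then show "Ck k n W (\<lambda>x. - 1 * (inverse (f x) * partial_deriv i f x * inverse (f x)))"
      using Suc.prems I by (intro Ck_mult[OF W] Ck_const[OF W]) auto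
  qed
qed

lemma Ck_prod:
  fixes f :: "'s \<Rightarrow> (nat \<Rightarrow> real) \<Rightarrow> real"
  assumes W: "openin (Euclidean_space n) W"
  shows "(\<And>s. s \<in> S \<Longrightarrow> Ck k n W (f s)) \<Longrightarrow> Ck k n W (\<lambda>x. \<Prod>s\<in>S. f s x)"
  by (induction S rule: infinite_finite_induct) (auto intro: Ck_mult[OF W] Ck_const[OF W])

lemma Ck_continuous_into:
  assumes W: "openin (Euclidean_space n) W" and V: "openin (Euclidean_space m) V"
    and "\<And>x. x \<in> W \<Longrightarrow> \<tau> x \<in> V" and c: "\<And>j. j < m \<Longrightarrow> continuous_on W (\<lambda>x. \<tau> x j)"
  shows "continuous_on W (\<tau> :: _ \<Rightarrow> nat \<Rightarrow> real)"
proof (rule continuous_on_coordinatewise_then_product)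
  fix j
  show "continuous_on W (\<lambda>x. \<tau> x j)"
  proof (cases "j < m")
    case False
    then have "\<And>x. x \<in> W \<Longrightarrow> 0 = \<tau> x j"
      using openin_Euclidean_zero[OF V] assms(3) by (metis linorder_not_less)
    then show ?thesis by (rule continuous_on_eq[OF continuous_on_const])
  qed (use c in auto)
qed

subsection \<open>Chain rule\<close>

text \<open>The mean value inequality along one coordinate. Continuity of the partial derivative
  makes the bound uniform in the other coordinates \<open>w\<close>, which move as well when a curve
  is followed.\<close>

lemma partial_increment_bound:
  assumes V: "openin (Euclidean_space m) V" and f: "Ck (Suc 0) m V f"
    and y0: "y0 \<in> V" and j: "j < m" and e: "e > 0"
  obtains \<delta> where "\<delta> > 0"
    "\<And>w s. w \<in> ebox m y0 \<delta> \<Longrightarrow> \<bar>s - y0 j\<bar> < \<delta> \<Longrightarrow> w j = y0 j \<Longrightarrow>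
       norm (f (w(j := s)) - f w - (s - y0 j) *\<^sub>R partial_deriv j f y0) \<le> e * \<bar>s - y0 j\<bar>"
proof -
  let ?D = "partial_deriv j f"
  have "continuous_on V ?D" using f j by simp
  then have "openin (top_of_set V) (V \<inter> ?D -` ball (?D y0) e)"
    by (rule continuous_openin_preimage_gen) auto
  then have "openin (Euclidean_space m) (V \<inter> ?D -` ball (?D y0) e)"
    using V unfolding Euclidean_space_top_of_set by (rule openin_trans)
  moreover have "y0 \<in> V \<inter> ?D -` ball (?D y0) e" using y0 e by auto
  ultimately obtain \<delta> where \<delta>: "\<delta> > 0" "ebox m y0 \<delta> \<subseteq> V \<inter> ?D -` ball (?D y0) e"
    using openin_Euclidean_imp_ebox by metis
  show ?thesis
  proof (rule that[OF \<delta>(1)])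
    fix w s assume w: "w \<in> ebox m y0 \<delta>" and s: "\<bar>s - y0 j\<bar> < \<delta>" and wj: "w j = y0 j"
    define S where "S = ball (y0 j) \<delta>"
    have in_box: "w(j := t) \<in> ebox m y0 \<delta>" if "t \<in> S" for t
      using w j that by (auto simp: ebox_def S_def dist_real_def abs_minus_commute)
    have der: "((\<lambda>t. f (w(j := t)) - t *\<^sub>R ?D y0) has_derivative (\<lambda>h. h *\<^sub>R (?D (w(j := t)) - ?D y0))) (at t within S)"
      if "t \<in> S" for t
    proof -
      have "w(j := t) \<in> V" using in_box[OF that] \<delta> by auto
      from Ck_SucD(1)[OF f j this]
      have "((\<lambda>t. f (w(j := t))) has_vector_derivative ?D (w(j := t))) (at t)" by simp
      then have "((\<lambda>t. f (w(j := t)) - t *\<^sub>R ?D y0) has_vector_derivative ?D (w(j := t)) - 1 *\<^sub>R ?D y0) (at t)"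
        by (auto intro!: derivative_eq_intros)
      then show ?thesis
        by (auto simp: has_vector_derivative_def intro: has_derivative_at_withinI)
    qed
    have "norm ((f (w(j := s)) - s *\<^sub>R ?D y0) - (f (w(j := y0 j)) - y0 j *\<^sub>R ?D y0)) \<le> e * norm (s - y0 j)"
    proof (rule differentiable_bound[of S, OF _ der])
      show "convex S" by (simp add: S_def)
      show "s \<in> S" "y0 j \<in> S" using s \<delta> by (auto simp: S_def dist_real_def abs_minus_commute)
      fix t assume "t \<in> S"
      then have "norm (?D (w(j := t)) - ?D y0) < e"
        using in_box \<delta>(2) by (force simp: dist_norm norm_minus_commute)
      then show "onorm (\<lambda>h. h *\<^sub>R (?D (w(j := t)) - ?D y0)) \<le> e"
        by (intro onorm_le) (auto simp: mult.commute[of e] intro!: mult_left_mono)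
    qed
    moreover have "w(j := y0 j) = w" using wj by auto
    ultimately show "norm (f (w(j := s)) - f w - (s - y0 j) *\<^sub>R ?D y0) \<le> e * \<bar>s - y0 j\<bar>"
      by (simp add: algebra_simps)
  qed
qed

text \<open>The point \<open>y t0\<close> is turned into \<open>y t\<close> by changing one
  coordinate after the other; \<open>z k\<close> is the stage where the first \<open>k\<close> are
  changed. Each change is compared with its linear part by the mean value inequality.\<close>

lemma Ck_chain_curve:
  fixes f :: "(nat \<Rightarrow> real) \<Rightarrow> 'b::real_normed_vector"
  assumes V: "openin (Euclidean_space m) V" and f: "Ck (Suc 0) m V f"
    and y0: "y t0 \<in> V" and ev: "\<forall>\<^sub>F t in nhds t0. y t \<in> V"
    and d: "\<And>j. j < m \<Longrightarrow> ((\<lambda>t. y t j) has_real_derivative y' j) (at t0)"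
  shows "((\<lambda>t. f (y t)) has_vector_derivative (\<Sum>j<m. y' j *\<^sub>R partial_deriv j f (y t0))) (at t0)"
proof -
  define z where "z k t = (\<lambda>j. if j < k then y t j else y t0 j)" for k t
  have z0: "z 0 t = y t0" for t by (simp add: z_def)
  have zt0: "z k t0 = y t0" for k by (auto simp: z_def)
  have ev_close: "\<forall>\<^sub>F t in nhds t0. \<forall>j<m. \<bar>y t j - y t0 j\<bar> < \<delta>" if "\<delta> > 0" for \<delta>
  proof -
    have "\<forall>\<^sub>F t in nhds t0. \<bar>y t j - y t0 j\<bar> < \<delta>" if "j < m" for j
    proof -
      have "isCont (\<lambda>t. y t j) t0" using d[OF that] DERIV_isCont by blast
      then have "((\<lambda>t. y t j) \<longlongrightarrow> y t0 j) (nhds t0)" by (simp add: isCont_def tendsto_nhds_iff)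
      from tendstoD[OF this \<open>\<delta> > 0\<close>] show ?thesis by (simp add: dist_real_def)
    qed
    then show ?thesis using eventually_ball_finite[of "{..<m}" "\<lambda>t j. \<bar>y t j - y t0 j\<bar> < \<delta>" "nhds t0"]
      by (auto simp: Ball_def)
  qed
  have "((\<lambda>t. f (z k t)) has_vector_derivative (\<Sum>j<k. y' j *\<^sub>R partial_deriv j f (y t0))) (at t0)"
    if "k \<le> m" for k using that
  proof (induction k)
    case 0
    then show ?case by (simp add: z0)
  next
    case (Suc k)
    then have k: "k < m" by simp
    let ?D = "partial_deriv k f (y t0)"
    define R where "R t = f (z (Suc k) t) - f (z k t) - (y t k - y t0 k) *\<^sub>R ?D" for t
    have zS: "z (Suc k) t = (z k t)(k := y t k)" for t by (auto simp: z_def)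
    have R0: "R t0 = 0" by (simp add: R_def zt0)
    have "(R has_vector_derivative 0) (at t0)"
      unfolding has_vector_derivative_def has_derivative_at
    proof (intro conjI)
      show "bounded_linear (\<lambda>h. h *\<^sub>R (0::'b))" by simp
      have dq: "((\<lambda>h. \<bar>(y (t0 + h) k - y t0 k) / h\<bar>) \<longlongrightarrow> \<bar>y' k\<bar>) (at 0)"
        using d[OF k] unfolding DERIV_def by (rule tendsto_rabs)
      show "(\<lambda>h. norm (R (t0 + h) - R t0 - h *\<^sub>R 0) / norm h) \<midarrow>0\<rightarrow> 0"
      proof (rule tendstoI)
        fix e :: real assume e: "e > 0"
        \<comment> \<open>The difference quotient of the \<open>k\<close>-th component is eventually
          below \<open>\<bar>y' k\<bar> + 1\<close>, so this choice leaves a total error below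
          \<open>e\<close>; the 1 also covers \<open>y' k = 0\<close>.\<close>
        define e' where "e' = e / (\<bar>y' k\<bar> + 1)"
        have e': "e' > 0" using e by (simp add: e'_def)
        obtain \<delta> where \<delta>: "\<delta> > 0"
          "\<And>w s. w \<in> ebox m (y t0) \<delta> \<Longrightarrow> \<bar>s - y t0 k\<bar> < \<delta> \<Longrightarrow> w k = y t0 k \<Longrightarrow>
            norm (f (w(k := s)) - f w - (s - y t0 k) *\<^sub>R ?D) \<le> e' * \<bar>s - y t0 k\<bar>"
          using partial_increment_bound[OF V f y0 k e'] by metis
        have "\<forall>\<^sub>F t in nhds t0. norm (R t) \<le> e' * \<bar>y t k - y t0 k\<bar>"
          using ev_close[OF \<delta>(1)]
        proof eventually_elim
          case (elim t)
          have "z k t \<in> ebox m (y t0) \<delta>"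
            using elim \<delta>(1) openin_Euclidean_zero[OF V y0] k by (auto simp: ebox_def z_def)
          moreover have "z k t k = y t0 k" by (simp add: z_def)
          ultimately show ?case using \<delta>(2)[of "z k t" "y t k"] elim k by (simp add: R_def zS)
        qed
        then have "\<forall>\<^sub>F t in at t0. norm (R t) \<le> e' * \<bar>y t k - y t0 k\<bar>"
          by (simp add: eventually_nhds_conv_at)
        then have "\<forall>\<^sub>F h in at 0. norm (R (t0 + h)) \<le> e' * \<bar>y (t0 + h) k - y t0 k\<bar>"
          by (subst (asm) at_to_0) (simp add: eventually_filtermap add.commute)
        moreover have "\<forall>\<^sub>F h in at 0. \<bar>(y (t0 + h) k - y t0 k) / h\<bar> < \<bar>y' k\<bar> + 1"
          using order_tendstoD(2)[OF dq, of "\<bar>y' k\<bar> + 1"] by simp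
        moreover have "\<forall>\<^sub>F h in at (0::real). h \<noteq> 0" by (simp add: eventually_at_filter)
        ultimately show "\<forall>\<^sub>F h in at 0. dist (norm (R (t0 + h) - R t0 - h *\<^sub>R 0) / norm h) 0 < e"
        proof eventually_elim
          case (elim h)
          have "norm (R (t0 + h)) / \<bar>h\<bar> \<le> e' * \<bar>(y (t0 + h) k - y t0 k) / h\<bar>"
            using elim(1,3) by (simp add: field_simps)
          also have "\<dots> < e' * (\<bar>y' k\<bar> + 1)" using elim(2) e' by (intro mult_strict_left_mono)
          also have "\<dots> = e" by (simp add: e'_def)
          finally show ?case by (simp add: R0)
        qed
      qed
    qed
    moreover have "((\<lambda>t. (y t k - y t0 k) *\<^sub>R ?D) has_vector_derivative y' k *\<^sub>R ?D) (at t0)"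
      using d[OF k] by (auto intro!: derivative_eq_intros)
    moreover have "((\<lambda>t. f (z k t)) has_vector_derivative (\<Sum>j<k. y' j *\<^sub>R partial_deriv j f (y t0))) (at t0)"
      using Suc by simp
    ultimately have "((\<lambda>t. f (z k t) + ((y t k - y t0 k) *\<^sub>R ?D + R t)) has_vector_derivative
       (\<Sum>j<k. y' j *\<^sub>R partial_deriv j f (y t0)) + (y' k *\<^sub>R ?D + 0)) (at t0)"
      by (intro has_vector_derivative_add)
    moreover have "(\<lambda>t. f (z k t) + ((y t k - y t0 k) *\<^sub>R ?D + R t)) = (\<lambda>t. f (z (Suc k) t))"
      by (auto simp: R_def)
    ultimately show ?case by simp
  qed
  from this[of m] have *: "((\<lambda>t. f (z m t)) has_vector_derivative (\<Sum>j<m. y' j *\<^sub>R partial_deriv j f (y t0))) (at t0)"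
    by simp
  have "\<forall>\<^sub>F t in nhds t0. f (z m t) = f (y t)"
    using ev
  proof eventually_elim
    case (elim t)
    have "z m t = y t" using openin_Euclidean_zero[OF V elim] openin_Euclidean_zero[OF V y0]
      by (auto simp: z_def)
    then show ?case by simp
  qed
  then show ?thesis
    using * has_vector_derivative_cong_ev[of UNIV "\<lambda>t. f (z m t)" "\<lambda>t. f (y t)" t0] zt0
    by (auto elim: eventually_mono)
qed

lemma Ck_compose:
  fixes f :: "(nat \<Rightarrow> real) \<Rightarrow> 'b::real_normed_vector"
  assumes W: "openin (Euclidean_space n) W" and V: "openin (Euclidean_space m) V"
    and \<tau>V: "\<And>x. x \<in> W \<Longrightarrow> \<tau> x \<in> V"
  shows "Ck k m V f \<Longrightarrow> (\<And>j. j < m \<Longrightarrow> Ck k n W (\<lambda>x. \<tau> x j)) \<Longrightarrow> Ck k n W (\<lambda>x. f (\<tau> x))"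
proof (induction k arbitrary: f)
  case 0
  have "continuous_on W \<tau>"
    using 0 by (intro Ck_continuous_into[OF W V \<tau>V]) auto
  then show ?case using 0 \<tau>V by (auto intro!: continuous_on_compose2[of V f])
next
  case (Suc k)
  have f1: "Ck (Suc 0) m V f"
    using Suc.prems(1) Ck_continuous by fastforce
  show ?case
  proof (rule Ck_SucI[OF W, where f'="\<lambda>i x. \<Sum>j<m. partial_deriv i (\<lambda>x. \<tau> x j) x *\<^sub>R partial_deriv j f (\<tau> x)"])
    have "continuous_on W \<tau>"
      using Suc.prems(2) by (intro Ck_continuous_into[OF W V \<tau>V]) auto
    then show "continuous_on W (\<lambda>x. f (\<tau> x))"
      using Suc.prems \<tau>V by (auto intro!: continuous_on_compose2[of V f])
  next
    fix i x assume ix: "i < n" "x \<in> W"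
    have "((\<lambda>t. f (\<tau> (x(i := t)))) has_vector_derivative
        (\<Sum>j<m. partial_deriv i (\<lambda>x. \<tau> x j) x *\<^sub>R partial_deriv j f (\<tau> (x(i := x i))))) (at (x i))"
    proof (rule Ck_chain_curve[OF V f1])
      show "\<tau> (x(i := x i)) \<in> V" using \<tau>V ix by simp
      show "\<forall>\<^sub>F t in nhds (x i). \<tau> (x(i := t)) \<in> V"
        using line_eventually[OF W ix(2,1)] \<tau>V by (auto elim: eventually_mono)
      show "((\<lambda>t. \<tau> (x(i := t)) j) has_real_derivative partial_deriv i (\<lambda>x. \<tau> x j) x) (at (x i))" if "j < m" for j
        unfolding has_real_derivative_iff_has_vector_derivative
        by (rule Ck_SucD(1)[OF Suc.prems(2)[OF that] ix])
    qed
    then show "((\<lambda>t. f (\<tau> (x(i := t)))) has_vector_derivative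
        (\<Sum>j<m. partial_deriv i (\<lambda>x. \<tau> x j) x *\<^sub>R partial_deriv j f (\<tau> x))) (at (x i))" by simp
  next
    fix i assume i: "i < n"
    show "Ck k n W (\<lambda>x. \<Sum>j<m. partial_deriv i (\<lambda>x. \<tau> x j) x *\<^sub>R partial_deriv j f (\<tau> x))"
      using Suc.prems i by (intro Ck_sum[OF W] Ck_scaleR[OF W] Suc.IH) (auto intro: Ck_Suc_imp)
  qed
qed

subsection \<open>Bump functions\<close>

text \<open>The factor \<open>1 / t ^ s\<close> makes the family closed under differentiation up to
  linear combinations, so all orders are treated by one induction over all \<open>s\<close> at
  once.\<close>

definition flat :: "nat \<Rightarrow> real \<Rightarrow> real"
  where "flat s t = (if t > 0 then exp (- (1 / t)) / t ^ s else 0)"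

lemma flat_tendsto_0: "(flat s \<longlongrightarrow> 0) (at 0)"
proof (rule filterlim_split_at_real)
  show "(flat s \<longlongrightarrow> 0) (at_left 0)"
    by (rule Lim_transform_eventually[OF tendsto_const])
      (auto simp: flat_def eventually_at_filter)
  have "((\<lambda>t::real. inverse t ^ s / exp (inverse t)) \<longlongrightarrow> 0) (at_right 0)"
    by (rule filterlim_compose[OF tendsto_power_div_exp_0 filterlim_inverse_at_top_right])
  then show "(flat s \<longlongrightarrow> 0) (at_right 0)"
    by (rule Lim_transform_eventually)
      (auto simp: flat_def eventually_at_filter exp_minus field_simps)
qed

lemma has_derivative_flat:
  "(flat s has_real_derivative (flat (s + 2) t - real s * flat (Suc s) t)) (at t)"
proof (cases t "0::real" rule: linorder_cases)
  case less
  have "((\<lambda>t. 0) has_real_derivative 0) (at t)" by simp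
  then have "(flat s has_real_derivative 0) (at t)"
    by (rule has_field_derivative_transform_within_open[of _ _ _ "{..<0}"]) (use less in \<open>auto simp: flat_def\<close>)
  then show ?thesis using less by (simp add: flat_def)
next
  case equal
  \<comment> \<open>The difference quotient of \<open>flat s\<close> at 0 is
    \<open>flat (Suc s)\<close>.\<close>
  have "((\<lambda>h. (flat s (0 + h) - flat s 0) / h) \<longlongrightarrow> 0) (at 0)"
    by (rule Lim_transform_eventually[OF flat_tendsto_0[of "Suc s"]])
      (auto simp: flat_def eventually_at_filter)
  then show ?thesis unfolding equal by (simp add: flat_def DERIV_def)
next
  case greater
  have "((\<lambda>t. exp (- (1 / t)) / t ^ s) has_real_derivative (flat (s + 2) t - real s * flat (Suc s) t)) (at t)"
  proof -
    have s: "real s * t ^ (s - Suc 0) = real s * t ^ s / t" using greater by (cases s) auto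
    have "((\<lambda>t. exp (- (1 / t)) / t ^ s) has_real_derivative
       (exp (- (1 / t)) * (1 / t\<^sup>2) * t ^ s - exp (- (1 / t)) * (real s * t ^ (s - Suc 0))) / (t ^ s * t ^ s)) (at t)"
      using greater by (auto intro!: derivative_eq_intros simp: power2_eq_square)
    moreover have "(exp (- (1 / t)) * (1 / t\<^sup>2) * t ^ s - exp (- (1 / t)) * (real s * t ^ (s - Suc 0))) / (t ^ s * t ^ s)
       = flat (s + 2) t - real s * flat (Suc s) t"
      using greater unfolding s by (simp add: flat_def field_simps power2_eq_square)
    ultimately show ?thesis by simp
  qed
  then show ?thesis
    by (rule has_field_derivative_transform_within_open[of _ _ _ "{0<..}"]) (use greater in \<open>auto simp: flat_def\<close>)
qed

text \<open>Phrased on the one-dimensional model space, so that the chain rule for \<open>Ck\<close>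
  passes it on to compositions with arbitrary functions.\<close>

lemma Ck_flat_coord: "Ck k 1 (topspace (Euclidean_space 1)) (\<lambda>x. flat s (x 0))"
proof (induction k arbitrary: s)
  case 0
  have "continuous_on UNIV (flat s)"
    using has_derivative_flat DERIV_isCont by (blast intro: continuous_at_imp_continuous_on)
  then show ?case
    by (auto intro!: continuous_on_compose2[of UNIV "flat s"] continuous_on_subset[OF continuous_on_product_coordinates subset_UNIV])
next
  case (Suc k)
  have W: "openin (Euclidean_space 1) (topspace (Euclidean_space 1))" by simp
  have "continuous_on UNIV (flat s)"
    using has_derivative_flat DERIV_isCont by (blast intro: continuous_at_imp_continuous_on)
  then have c: "continuous_on (topspace (Euclidean_space 1)) (\<lambda>x. flat s (x 0))"
    by (auto intro!: continuous_on_compose2[of UNIV "flat s"] continuous_on_subset[OF continuous_on_product_coordinates subset_UNIV])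
  show ?case
  proof (rule Ck_SucI[OF W c, where f'="\<lambda>i x. flat (s + 2) (x 0) + (- real s) * flat (Suc s) (x 0)"])
    show "((\<lambda>t. flat s ((x(i := t)) 0)) has_vector_derivative flat (s + 2) (x 0) + (- real s) * flat (Suc s) (x 0)) (at (x i))"
      if "i < 1" for i and x :: "nat \<Rightarrow> real"
    proof -
      have "i = 0" using that by simp
      then show ?thesis
        using has_derivative_flat[of s "x 0"] by (simp add: has_real_derivative_iff_has_vector_derivative)
    qed
    show "Ck k 1 (topspace (Euclidean_space 1)) (\<lambda>x. flat (s + 2) (x 0) + (- real s) * flat (Suc s) (x 0))" for i :: nat
      by (intro Ck_add[OF W] Ck_mult[OF W] Ck_const[OF W] Suc.IH)
  qed
qed

lemma Ck_flat:
  assumes W: "openin (Euclidean_space n) W" and h: "Ck k n W h"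
  shows "Ck k n W (\<lambda>x. flat s (h x))"
  using Ck_compose[OF W openin_topspace _ Ck_flat_coord, of "\<lambda>x j. if j = 0 then h x else 0"] h
  by (simp add: topspace_Euclidean_space)

definition bump1 :: "real \<Rightarrow> real"
  where "bump1 t = flat 0 (4 - t\<^sup>2) * inverse (flat 0 (4 - t\<^sup>2) + flat 0 (t\<^sup>2 - 1))"

lemma flat_nonneg: "flat s t \<ge> 0" and flat_pos: "t > 0 \<Longrightarrow> flat s t > 0" and flat_0: "t \<le> 0 \<Longrightarrow> flat s t = 0"
  by (auto simp: flat_def)

text \<open>The two arguments of \<open>flat 0\<close> add up to 3, so they cannot both be
  nonpositive.\<close>

lemma bump1_denominator: "flat 0 (4 - t\<^sup>2) + flat 0 (t\<^sup>2 - 1) > 0"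
proof (cases "t\<^sup>2 < 4")
  case True
  then show ?thesis using flat_pos[of "4 - t\<^sup>2" 0] flat_nonneg[of 0 "t\<^sup>2 - 1"] by linarith
next
  case False
  then show ?thesis using flat_pos[of "t\<^sup>2 - 1" 0] flat_nonneg[of 0 "4 - t\<^sup>2"] by linarith
qed

lemma bump1_eq_1: "\<bar>t\<bar> \<le> 1 \<Longrightarrow> bump1 t = 1"
proof -
  assume "\<bar>t\<bar> \<le> 1"
  then have "t\<^sup>2 \<le> 1" by (simp add: abs_square_le_1)
  then show ?thesis using bump1_denominator[of t] by (simp add: bump1_def flat_0)
qed

lemma bump1_eq_0: "\<bar>t\<bar> \<ge> 2 \<Longrightarrow> bump1 t = 0"
proof -
  assume "\<bar>t\<bar> \<ge> 2"
  then have "2\<^sup>2 \<le> \<bar>t\<bar>\<^sup>2" by (intro power_mono) auto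
  then show ?thesis by (simp add: bump1_def flat_0)
qed

lemma Ck_bump1:
  assumes W: "openin (Euclidean_space n) W" and h: "Ck k n W h"
  shows "Ck k n W (\<lambda>x. bump1 (h x))"
proof -
  have "Ck k n W (\<lambda>x. 4 + (- 1) * (h x * h x))" "Ck k n W (\<lambda>x. h x * h x + (- 1))"
    by (intro Ck_add[OF W] Ck_mult[OF W] Ck_const[OF W] h)+
  from this[THEN Ck_flat[OF W, where s=0]]
  have f: "Ck k n W (\<lambda>x. flat 0 (4 - (h x)\<^sup>2))" "Ck k n W (\<lambda>x. flat 0 ((h x)\<^sup>2 - 1))"
    by (simp_all add: power2_eq_square)
  show ?thesis unfolding bump1_def
    by (intro Ck_mult[OF W] Ck_inverse[OF W] Ck_add[OF W] f) (use bump1_denominator in \<open>simp add: less_imp_neq[symmetric]\<close>)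
qed

definition bump :: "nat \<Rightarrow> (nat \<Rightarrow> real) \<Rightarrow> real \<Rightarrow> (nat \<Rightarrow> real) \<Rightarrow> real"
  where "bump n z \<epsilon> x = (\<Prod>i<n. bump1 ((x i - z i) / \<epsilon>))"

lemma Ck_bump:
  assumes W: "openin (Euclidean_space n) W" shows "Ck k n W (bump n z \<epsilon>)"
proof -
  have "Ck k n W (\<lambda>x. (x i + - z i) * inverse \<epsilon>)" for i
    by (intro Ck_mult[OF W] Ck_add[OF W] Ck_coord[OF W] Ck_const[OF W])
  then show ?thesis unfolding bump_def
    by (intro Ck_prod[OF W] Ck_bump1[OF W]) (simp add: divide_inverse)
qed

lemma bump_eq_1: "\<epsilon> > 0 \<Longrightarrow> (\<And>i. i < n \<Longrightarrow> \<bar>x i - z i\<bar> \<le> \<epsilon>) \<Longrightarrow> bump n z \<epsilon> x = 1"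
  unfolding bump_def by (intro prod.neutral ballI bump1_eq_1) (auto simp: divide_le_eq_1)

lemma bump_eq_0: "\<epsilon> > 0 \<Longrightarrow> i < n \<Longrightarrow> \<bar>x i - z i\<bar> \<ge> 2 * \<epsilon> \<Longrightarrow> bump n z \<epsilon> x = 0"
  unfolding bump_def
  by (intro prod_zero bexI[of _ i] bump1_eq_0) (auto simp: le_divide_eq)

subsection \<open>Hadamard's lemma\<close>

definition ray :: "(nat \<Rightarrow> real) \<Rightarrow> (nat \<Rightarrow> real) \<Rightarrow> real \<Rightarrow> nat \<Rightarrow> real"
  where "ray u y t = (\<lambda>i. u i + t * (y i - u i))"

lemma ray_in_ebox:
  assumes "u \<in> ebox n z R" "y \<in> ebox n z R" "0 \<le> t" "t \<le> 1"
  shows "ray u y t \<in> ebox n z R"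
proof -
  have "\<bar>u j + t * (y j - u j) - z j\<bar> < R" if "j < n" for j
  proof -
    have "convex {z j - R<..<z j + R}" by simp
    moreover have "u j \<in> {z j - R<..<z j + R}" "y j \<in> {z j - R<..<z j + R}"
      using assms(1,2) that by (auto simp: ebox_def abs_less_iff)
    ultimately have "(1 - t) *\<^sub>R u j + t *\<^sub>R y j \<in> {z j - R<..<z j + R}"
      using assms(3,4) by (intro convexD_alt)
    then show ?thesis by (simp add: abs_less_iff algebra_simps)
  qed
  then show ?thesis using assms by (auto simp: ebox_def ray_def)
qed

lemma continuous_on_ray:
  "continuous_on A (\<lambda>p. ray u (fst p) (snd p))"
  unfolding ray_def
proof (rule continuous_on_coordinatewise_then_product)
  fix i
  have "continuous_on A (\<lambda>p::(nat \<Rightarrow> real) \<times> real. fst p i)"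
    by (rule continuous_on_compose2[OF continuous_on_product_coordinates[of i] continuous_on_fst[OF continuous_on_id]]) auto
  then show "continuous_on A (\<lambda>p. u i + snd p * (fst p i - u i))"
    by (intro continuous_intros)
qed

text \<open>Differentiating under the integral in \<open>y\<close> produces a factor
  \<open>t\<close>; the weight \<open>t ^ s\<close> makes the family closed under this. For
  \<open>s = 0\<close> and \<open>F\<close> a partial derivative of \<open>f\<close> these are the
  quotients in Hadamard's lemma.\<close>

definition ray_integral :: "(nat \<Rightarrow> real) \<Rightarrow> nat \<Rightarrow> ((nat \<Rightarrow> real) \<Rightarrow> 'b::banach) \<Rightarrow> (nat \<Rightarrow> real) \<Rightarrow> 'b"
  where "ray_integral u s F y = integral (cbox 0 1) (\<lambda>t. t ^ s *\<^sub>R F (ray u y t))"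

lemma continuous_on_ray_integrand:
  fixes F :: "(nat \<Rightarrow> real) \<Rightarrow> 'b::real_normed_vector"
  assumes "continuous_on (ebox n z R) F" "u \<in> ebox n z R"
  shows "continuous_on (ebox n z R \<times> cbox 0 1) (\<lambda>(y, t). t ^ s *\<^sub>R F (ray u y t))"
  unfolding case_prod_beta
  by (intro continuous_on_scaleR continuous_on_power continuous_on_snd continuous_on_id
      continuous_on_compose2[OF assms(1) continuous_on_ray])
    (use ray_in_ebox[OF assms(2)] in \<open>auto\<close>)

lemma Ck_ray_integral:
  fixes F :: "(nat \<Rightarrow> real) \<Rightarrow> 'b::banach"
  assumes u: "u \<in> ebox n z R"
  shows "Ck k n (ebox n z R) F \<Longrightarrow> Ck k n (ebox n z R) (ray_integral u s F)"
proof (induction k arbitrary: F s)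
  case 0
  then show ?case
    using integral_continuous_on_param[OF continuous_on_ray_integrand[OF _ u, of F s]]
    by (simp add: ray_integral_def[abs_def])
next
  case (Suc k)
  let ?W = "ebox n z R"
  show ?case
  proof (rule Ck_SucI[OF openin_ebox, where f'="\<lambda>i. ray_integral u (Suc s) (partial_deriv i F)"])
    show "continuous_on ?W (ray_integral u s F)"
      using integral_continuous_on_param[OF continuous_on_ray_integrand[OF _ u, of F s]] Suc.prems
      by (simp add: ray_integral_def[abs_def])
  next
    fix i y assume i: "i < n" and y: "y \<in> ?W"
    define S where "S = {z i - R<..<z i + R}"
    have yS: "y(i := t) \<in> ?W" if "t \<in> S" for t
      using y i that by (auto simp: ebox_def S_def abs_less_iff)
    have yiS: "y i \<in> S" using y i by (auto simp: ebox_def S_def abs_less_iff)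
    have cS: "continuous_on (S \<times> cbox (0::real) 1) (\<lambda>p. (y(i := fst p), snd p))"
      by (intro continuous_on_Pair continuous_on_snd continuous_on_id
          continuous_on_compose2[OF continuous_fun_upd[of UNIV]] continuous_on_fst) auto
    have c: "continuous_on (S \<times> cbox 0 1) (\<lambda>(x, t). t ^ s *\<^sub>R G (ray u (y(i := x)) t))"
      if "continuous_on ?W G" for s and G :: "(nat \<Rightarrow> real) \<Rightarrow> 'b"
    proof -
      have "(\<lambda>p. (y(i := fst p), snd p)) ` (S \<times> cbox (0::real) 1) \<subseteq> ?W \<times> cbox 0 1"
        using yS by auto
      from continuous_on_compose2[OF continuous_on_ray_integrand[OF that u, of s] cS this]
      show ?thesis by (simp only: case_prod_beta' fst_conv snd_conv)
    qed
    have "((\<lambda>x. integral (cbox 0 1) (\<lambda>t. t ^ s *\<^sub>R F (ray u (y(i := x)) t))) has_vector_derivative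
       integral (cbox 0 1) (\<lambda>t. t ^ Suc s *\<^sub>R partial_deriv i F (ray u (y(i := y i)) t))) (at (y i) within S)"
    proof (rule leibniz_rule_vector_derivative[where U=S and fx="\<lambda>x t. t ^ Suc s *\<^sub>R partial_deriv i F (ray u (y(i := x)) t)"])
      fix x t :: real assume x: "x \<in> S" and t: "t \<in> cbox 0 1"
      let ?r = "ray u (y(i := x)) t"
      have r: "ray u (y(i := x')) t = ?r(i := u i + t * (x' - u i))" for x'
        by (auto simp: ray_def)
      have ri: "?r i = u i + t * (x - u i)" by (simp add: ray_def)
      have "?r \<in> ?W" using ray_in_ebox[OF u yS[OF x]] t by auto
      then have "((\<lambda>\<sigma>. F (?r(i := \<sigma>))) has_vector_derivative partial_deriv i F ?r) (at (u i + t * (x - u i)))"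
        using Ck_SucD(1)[OF Suc.prems i, of ?r] unfolding ri by blast
      moreover have "((\<lambda>x'. u i + t * (x' - u i)) has_vector_derivative t) (at x)"
        by (auto intro!: derivative_eq_intros simp: has_real_derivative_iff_has_vector_derivative[symmetric])
      ultimately have "((\<lambda>x'. F (?r(i := u i + t * (x' - u i)))) has_vector_derivative t *\<^sub>R partial_deriv i F ?r) (at x)"
        using vector_diff_chain_at[of "\<lambda>x'. u i + t * (x' - u i)" t x "\<lambda>\<sigma>. F (?r(i := \<sigma>))"]
        by (simp add: o_def)
      then have "((\<lambda>x'. F (ray u (y(i := x')) t)) has_vector_derivative t *\<^sub>R partial_deriv i F ?r) (at x)"
        unfolding r[symmetric] .
      from bounded_linear.has_vector_derivative[OF bounded_linear_scaleR_right[of "t ^ s"] this]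
      show "((\<lambda>x'. t ^ s *\<^sub>R F (ray u (y(i := x')) t)) has_vector_derivative
         t ^ Suc s *\<^sub>R partial_deriv i F ?r) (at x within S)"
        by (simp add: mult.commute has_vector_derivative_at_within)
    next
      fix x assume x: "x \<in> S"
      have "continuous_on (cbox (0::real) 1) (\<lambda>t. (x, t))" by (intro continuous_intros)
      moreover have "(\<lambda>t. (x, t)) ` cbox (0::real) 1 \<subseteq> S \<times> cbox 0 1" using x by auto
      ultimately have "continuous_on (cbox 0 1) (\<lambda>t. t ^ s *\<^sub>R F (ray u (y(i := x)) t))"
        using continuous_on_compose2[OF c[OF Ck_continuous[OF Suc.prems], of s], of "cbox 0 1" "\<lambda>t. (x, t)"]
        by simp
      then show "(\<lambda>t. t ^ s *\<^sub>R F (ray u (y(i := x)) t)) integrable_on cbox 0 1"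
        by (rule integrable_continuous)
    next
      show "continuous_on (S \<times> cbox 0 1) (\<lambda>(x, t). t ^ Suc s *\<^sub>R partial_deriv i F (ray u (y(i := x)) t))"
        using Suc.prems i by (intro c) (auto intro: Ck_continuous)
    qed (use yiS in \<open>auto simp: S_def\<close>)
    moreover have "at (y i) within S = at (y i)"
      using yiS by (intro at_within_open) (auto simp: S_def)
    ultimately show "((\<lambda>t. ray_integral u s F (y(i := t))) has_vector_derivative
        ray_integral u (Suc s) (partial_deriv i F) y) (at (y i))"
      by (simp only: ray_integral_def fun_upd_triv)
  next
    show "Ck k n ?W (ray_integral u (Suc s) (partial_deriv i F))" if "i < n" for i
      using Suc.prems that by (intro Suc.IH) simp
  qed
qed

lemma Hadamard:
  fixes f :: "(nat \<Rightarrow> real) \<Rightarrow> 'b::banach"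
  assumes u: "u \<in> ebox n z R" and y: "y \<in> ebox n z R" and f: "Ck (Suc 0) n (ebox n z R) f"
  shows "f y - f u = (\<Sum>i<n. (y i - u i) *\<^sub>R ray_integral u 0 (partial_deriv i f) y)"
proof -
  let ?W = "ebox n z R"
  have der: "((\<lambda>t. f (ray u y t)) has_vector_derivative
      (\<Sum>i<n. (y i - u i) *\<^sub>R partial_deriv i f (ray u y t))) (at t within {0..1})" if t: "t \<in> {0..1}" for t
  proof (rule has_vector_derivative_at_within, rule Ck_chain_curve[OF openin_ebox f])
    show *: "ray u y t \<in> ?W" using ray_in_ebox[OF u y] t by auto
    \<comment> \<open>The chain rule is two-sided, so the line has to stay in the box for parameters
      slightly outside \<open>{0..1}\<close> as well.\<close>
    have "open (\<Inter>j\<in>{..<n}. {t. \<bar>u j + t * (y j - u j) - z j\<bar> < R})"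
      by (intro open_INT finite_lessThan ballI open_Collect_less continuous_intros)
    moreover have "t \<in> (\<Inter>j\<in>{..<n}. {t. \<bar>u j + t * (y j - u j) - z j\<bar> < R})"
      using * by (auto simp: ebox_def ray_def)
    ultimately show "\<forall>\<^sub>F t in nhds t. ray u y t \<in> ?W"
      unfolding eventually_nhds using u y by (fastforce simp: ebox_def ray_def)
    show "((\<lambda>t. ray u y t j) has_real_derivative y j - u j) (at t)" for j
      unfolding ray_def by (auto intro!: derivative_eq_intros)
  qed
  have I1: "((\<lambda>t. \<Sum>i<n. (y i - u i) *\<^sub>R partial_deriv i f (ray u y t)) has_integral f (ray u y 1) - f (ray u y 0)) {0..1}"
    by (rule fundamental_theorem_of_calculus[OF _ der]) auto
  have I2: "((\<lambda>t. \<Sum>i<n. (y i - u i) *\<^sub>R partial_deriv i f (ray u y t)) has_integral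
     (\<Sum>i<n. (y i - u i) *\<^sub>R ray_integral u 0 (partial_deriv i f) y)) {0..1}"
  proof (intro has_integral_sum finite_lessThan has_integral_cmul)
    fix i assume "i \<in> {..<n}"
    then have "continuous_on ?W (partial_deriv i f)" using f by auto
    moreover have "continuous_on (cbox (0::real) 1) (\<lambda>t. (y, t))" by (intro continuous_intros)
    moreover have "(\<lambda>t. (y, t)) ` cbox (0::real) 1 \<subseteq> ?W \<times> cbox 0 1" using y by auto
    ultimately have "continuous_on (cbox 0 1) (\<lambda>t. partial_deriv i f (ray u y t))"
      using continuous_on_compose2[OF continuous_on_ray_integrand[OF _ u, of "partial_deriv i f" 0], of "cbox 0 1" "\<lambda>t. (y, t)"]
      by simp
    then have "(\<lambda>t. partial_deriv i f (ray u y t)) integrable_on cbox 0 1" by (rule integrable_continuous)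
    then show "((\<lambda>t. partial_deriv i f (ray u y t)) has_integral ray_integral u 0 (partial_deriv i f) y) {0..1}"
      by (simp add: ray_integral_def integrable_integral)
  qed
  have "ray u y 1 = y" "ray u y 0 = u" by (auto simp: ray_def)
  then show ?thesis using has_integral_unique[OF I1 I2] by simp
qed

section \<open>Smooth functions on manifolds\<close>

text \<open>The part of \<open>smooth_manifold\<close> that passes to open submanifolds and products
  by direct arguments and that suffices for testing smoothness chart by chart.\<close>

definition locally_euclidean :: "'m manifold \<Rightarrow> bool"
  where "locally_euclidean M \<longleftrightarrow>
    \<Union> (fst ` charts M) = points M \<and>
    (\<forall>(U, \<phi>)\<in>charts M. openin (mtop M) U \<and> openin (Euclidean_space (mdim M)) (\<phi> ` U) \<and>
       homeomorphic_map (subtopology (mtop M) U) (subtopology (Euclidean_space (mdim M)) (\<phi> ` U)) \<phi>)"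

lemma smooth_manifold_imp_locally_euclidean: "smooth_manifold M \<Longrightarrow> locally_euclidean M"
  by (auto simp: smooth_manifold_def locally_euclidean_def)

lemma chart_cover:
  assumes "locally_euclidean M" "x \<in> points M"
  obtains U \<phi> where "(U, \<phi>) \<in> charts M" "x \<in> U"
proof -
  have "x \<in> \<Union> (fst ` charts M)" using assms by (simp add: locally_euclidean_def)
  then show ?thesis using that by auto
qed

context
  fixes M :: "'m manifold" and U \<phi>
  assumes M: "locally_euclidean M" and c: "(U, \<phi>) \<in> charts M"
begin

lemma chart_open: "openin (mtop M) U" "openin (Euclidean_space (mdim M)) (\<phi> ` U)"
  and chart_homeo: "homeomorphic_map (subtopology (mtop M) U) (subtopology (Euclidean_space (mdim M)) (\<phi> ` U)) \<phi>"
  using M c by (auto simp: locally_euclidean_def)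

lemma chart_subset: "U \<subseteq> points M"
  using chart_open(1) openin_subset by auto

lemma chart_inj: "inj_on \<phi> U"
proof -
  have "topspace (subtopology (mtop M) U) = U" using chart_subset by auto
  then show ?thesis using chart_homeo by (metis homeomorphic_imp_injective_map)
qed

lemma chart_inv [simp]: "x \<in> U \<Longrightarrow> inv_into U \<phi> (\<phi> x) = x"
  using chart_inj by simp

lemma chart_open_image:
  assumes "openin (mtop M) A" shows "openin (Euclidean_space (mdim M)) (\<phi> ` (U \<inter> A))"
proof -
  have "openin (subtopology (mtop M) U) (U \<inter> A)"
    using assms by (simp add: openin_subtopology_Int2)
  moreover have "open_map (subtopology (mtop M) U) (subtopology (Euclidean_space (mdim M)) (\<phi> ` U)) \<phi>"
    using chart_homeo homeomorphic_imp_open_map by blast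
  ultimately have "openin (subtopology (Euclidean_space (mdim M)) (\<phi> ` U)) (\<phi> ` (U \<inter> A))"
    by (simp add: open_map_def)
  then show ?thesis using chart_open(2) openin_trans_full by blast
qed

lemma chart_zero: "x \<in> U \<Longrightarrow> mdim M \<le> i \<Longrightarrow> \<phi> x i = 0"
  using openin_Euclidean_zero[OF chart_open(2)] by blast

lemma chart_continuous: "continuous_map (subtopology (mtop M) U) (Euclidean_space (mdim M)) \<phi>"
  using homeomorphic_imp_continuous_map[OF chart_homeo] by (simp add: continuous_map_in_subtopology)

lemma chart_preimage_open:
  assumes "openin (Euclidean_space (mdim M)) B" shows "openin (mtop M) {x \<in> U. \<phi> x \<in> B}"
proof -
  have "openin (subtopology (mtop M) U) {x \<in> topspace (subtopology (mtop M) U). \<phi> x \<in> B}"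
    by (rule openin_continuous_map_preimage[OF chart_continuous assms])
  moreover have "topspace (subtopology (mtop M) U) = U" using chart_subset by auto
  ultimately show ?thesis using chart_open(1) openin_trans_full by fastforce
qed

lemma chart_inv_continuous:
  "continuous_map (subtopology (Euclidean_space (mdim M)) (\<phi> ` U)) (subtopology (mtop M) U) (inv_into U \<phi>)"
proof -
  have U: "topspace (subtopology (mtop M) U) = U" using chart_subset by auto
  obtain g where g: "homeomorphic_maps (subtopology (mtop M) U) (subtopology (Euclidean_space (mdim M)) (\<phi> ` U)) \<phi> g"
    using chart_homeo homeomorphic_map_maps by blast
  then have "continuous_map (subtopology (Euclidean_space (mdim M)) (\<phi> ` U)) (subtopology (mtop M) U) g"
    by (simp add: homeomorphic_maps_def)
  moreover have "g y = inv_into U \<phi> y" if "y \<in> topspace (subtopology (Euclidean_space (mdim M)) (\<phi> ` U))" for y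
    using that g U by (auto simp: homeomorphic_maps_def)
  ultimately show ?thesis using continuous_map_eq by blast
qed

end

definition smooth_fun :: "'m manifold \<Rightarrow> 'm set \<Rightarrow> ('m \<Rightarrow> 'b::real_normed_vector) \<Rightarrow> bool"
  where "smooth_fun M A f \<longleftrightarrow>
    (\<forall>(U, \<phi>)\<in>charts M. smooth_on (mdim M) (\<phi> ` (U \<inter> A)) (\<lambda>y. f (inv_into U \<phi> y)))"

lemma smooth_funI:
  "(\<And>U \<phi> k. (U, \<phi>) \<in> charts M \<Longrightarrow> Ck k (mdim M) (\<phi> ` (U \<inter> A)) (\<lambda>y. f (inv_into U \<phi> y))) \<Longrightarrow> smooth_fun M A f"
  by (auto simp: smooth_fun_def smooth_on_iff_Ck)

lemma smooth_funD:
  "smooth_fun M A f \<Longrightarrow> (U, \<phi>) \<in> charts M \<Longrightarrow> Ck k (mdim M) (\<phi> ` (U \<inter> A)) (\<lambda>y. f (inv_into U \<phi> y))"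
  by (auto simp: smooth_fun_def smooth_on_iff_Ck)

lemma Cinf_iff:
  assumes "locally_euclidean M"
  shows "f \<in> Cinf M \<longleftrightarrow> (\<forall>x. x \<notin> points M \<longrightarrow> f x = 0) \<and> smooth_fun M (points M) f"
proof -
  have "U \<inter> points M = U" if "(U, \<phi>) \<in> charts M" for U \<phi>
    using chart_subset[OF assms that] by auto
  then show ?thesis
    by (fastforce simp: Cinf_def smooth_fun_def)
qed

lemma smooth_fun_subset: "smooth_fun M A f \<Longrightarrow> B \<subseteq> A \<Longrightarrow> smooth_fun M B f"
  by (intro smooth_funI) (rule Ck_subset[OF smooth_funD], auto)

context
  fixes M :: "'m manifold" and A
  assumes M: "locally_euclidean M" and A: "openin (mtop M) A"
begin

lemma smooth_fun_cong:
  assumes f: "smooth_fun M A f" and eq: "\<And>x. x \<in> A \<Longrightarrow> f x = g x"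
  shows "smooth_fun M A g"
proof (rule smooth_funI)
  fix U \<phi> k assume c: "(U, \<phi>) \<in> charts M"
  show "Ck k (mdim M) (\<phi> ` (U \<inter> A)) (\<lambda>y. g (inv_into U \<phi> y))"
    by (rule Ck_cong[OF chart_open_image[OF M c A] smooth_funD[OF f c]])
      (use eq chart_inv[OF M c] in auto)
qed

lemma smooth_fun_local:
  assumes loc: "\<And>x. x \<in> A \<Longrightarrow> \<exists>B. openin (mtop M) B \<and> x \<in> B \<and> smooth_fun M B f"
  shows "smooth_fun M A f"
proof (rule smooth_funI)
  fix U \<phi> k assume c: "(U, \<phi>) \<in> charts M"
  show "Ck k (mdim M) (\<phi> ` (U \<inter> A)) (\<lambda>y. f (inv_into U \<phi> y))"
  proof (rule Ck_local[OF chart_open_image[OF M c A]])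
    fix y assume "y \<in> \<phi> ` (U \<inter> A)"
    then obtain x where x: "x \<in> U" "x \<in> A" "y = \<phi> x" by auto
    from loc[OF x(2)] obtain B where "openin (mtop M) B" "x \<in> B" "smooth_fun M B f" by blast
    then show "\<exists>V. openin (Euclidean_space (mdim M)) V \<and> y \<in> V \<and> Ck k (mdim M) V (\<lambda>y. f (inv_into U \<phi> y))"
      using x chart_open_image[OF M c] smooth_funD[OF _ c] by (intro exI[of _ "\<phi> ` (U \<inter> B)"]) auto
  qed
qed

lemma smooth_fun_const: "smooth_fun M A (\<lambda>x. a)"
  by (intro smooth_funI Ck_const chart_open_image[OF M _ A])

lemma smooth_fun_add:
  assumes f: "smooth_fun M A f" and g: "smooth_fun M A g"
  shows "smooth_fun M A (\<lambda>x. f x + g x)"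
proof (rule smooth_funI)
  fix U \<phi> k assume c: "(U, \<phi>) \<in> charts M"
  show "Ck k (mdim M) (\<phi> ` (U \<inter> A)) (\<lambda>y. f (inv_into U \<phi> y) + g (inv_into U \<phi> y))"
    by (rule Ck_add[OF chart_open_image[OF M c A] smooth_funD[OF f c] smooth_funD[OF g c]])
qed

lemma smooth_fun_mult:
  fixes f :: "'m \<Rightarrow> 'b::real_normed_algebra"
  assumes f: "smooth_fun M A f" and g: "smooth_fun M A g"
  shows "smooth_fun M A (\<lambda>x. f x * g x)"
proof (rule smooth_funI)
  fix U \<phi> k assume c: "(U, \<phi>) \<in> charts M"
  show "Ck k (mdim M) (\<phi> ` (U \<inter> A)) (\<lambda>y. f (inv_into U \<phi> y) * g (inv_into U \<phi> y))"
    by (rule Ck_mult[OF chart_open_image[OF M c A] smooth_funD[OF f c] smooth_funD[OF g c]])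
qed

end

text \<open>The target charts are restricted to a family \<open>CH\<close> because \<open>f\<close>
  may be controlled in some charts only: in a single one, or in product charts over a fixed base
  chart. The conclusion is confined to the region that \<open>CH\<close> covers.\<close>

lemma smooth_fun_compose:
  assumes M: "locally_euclidean M" and N: "locally_euclidean N"
    and F: "continuous_map (mtop M) (mtop N) F" and B: "openin (mtop N) B"
    and CH: "CH \<subseteq> charts N"
    and sF: "\<And>U \<phi> V \<psi> j. (U, \<phi>) \<in> charts M \<Longrightarrow> (V, \<psi>) \<in> CH \<Longrightarrow> j < mdim N \<Longrightarrow>
       smooth_on (mdim M) (\<phi> ` {x \<in> U. F x \<in> V}) (\<lambda>y. \<psi> (F (inv_into U \<phi> y)) j)"
    and f: "\<And>V \<psi>. (V, \<psi>) \<in> CH \<Longrightarrow> smooth_on (mdim N) (\<psi> ` (V \<inter> B)) (\<lambda>y. f (inv_into V \<psi> y))"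
  shows "smooth_fun M {x \<in> points M. F x \<in> B \<inter> \<Union> (fst ` CH)} (\<lambda>x. f (F x))"
proof -
  define A where "A V = {x \<in> points M. F x \<in> B \<inter> V}" for V
  have A: "openin (mtop M) (A V)" if "(V, \<psi>) \<in> CH" for V \<psi>
  proof -
    have "openin (mtop N) (B \<inter> V)" using B chart_open(1)[OF N] that CH by blast
    then show ?thesis unfolding A_def by (rule openin_continuous_map_preimage[OF F])
  qed
  have *: "smooth_fun M (A V) (\<lambda>x. f (F x))" if ch: "(V, \<psi>) \<in> CH" for V \<psi>
  proof (rule smooth_funI)
    fix U \<phi> k assume c: "(U, \<phi>) \<in> charts M"
    have cN: "(V, \<psi>) \<in> charts N" using ch CH by auto
    have o: "openin (Euclidean_space (mdim M)) (\<phi> ` (U \<inter> A V))"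
      by (rule chart_open_image[OF M c A[OF ch]])
    have "Ck k (mdim M) (\<phi> ` (U \<inter> A V)) (\<lambda>y. f (inv_into V \<psi> (\<psi> (F (inv_into U \<phi> y)))))"
    proof (rule Ck_compose[OF o chart_open_image[OF N cN B], where \<tau>="\<lambda>y. \<psi> (F (inv_into U \<phi> y))"])
      show "\<psi> (F (inv_into U \<phi> y)) \<in> \<psi> ` (V \<inter> B)" if "y \<in> \<phi> ` (U \<inter> A V)" for y
        using that chart_inv[OF M c] by (auto simp: A_def)
      show "Ck k (mdim N) (\<psi> ` (V \<inter> B)) (\<lambda>y. f (inv_into V \<psi> y))"
        using f[OF ch] by (simp add: smooth_on_iff_Ck)
      show "Ck k (mdim M) (\<phi> ` (U \<inter> A V)) (\<lambda>y. \<psi> (F (inv_into U \<phi> y)) j)" if "j < mdim N" for j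
        using sF[OF c ch that] unfolding smooth_on_iff_Ck
        by (rule_tac Ck_subset) (auto simp: A_def)
    qed
    then show "Ck k (mdim M) (\<phi> ` (U \<inter> A V)) (\<lambda>y. f (F (inv_into U \<phi> y)))"
      by (rule Ck_cong[OF o]) (use chart_inv[OF M c] chart_inv[OF N cN] in \<open>auto simp: A_def\<close>)
  qed
  have "{x \<in> points M. F x \<in> B \<inter> \<Union> (fst ` CH)} = (\<Union>c\<in>CH. A (fst c))"
    by (auto simp: A_def)
  moreover have "openin (mtop M) (\<Union>c\<in>CH. A (fst c))" using A by (intro openin_Union) auto
  moreover from this have "smooth_fun M (\<Union>c\<in>CH. A (fst c)) (\<lambda>x. f (F x))"
    by (rule smooth_fun_local[OF M]) (use A * in fastforce)
  ultimately show ?thesis by simp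
qed

lemma smooth_mapD:
  "smooth_map M N F \<Longrightarrow> (U, \<phi>) \<in> charts M \<Longrightarrow> (V, \<psi>) \<in> charts N \<Longrightarrow> j < mdim N \<Longrightarrow>
     smooth_on (mdim M) (\<phi> ` {x \<in> U. F x \<in> V}) (\<lambda>y. \<psi> (F (inv_into U \<phi> y)) j)"
  "smooth_map M N F \<Longrightarrow> continuous_map (mtop M) (mtop N) F"
  unfolding smooth_map_def by blast+

lemma smooth_fun_smooth_map:
  assumes M: "locally_euclidean M" and N: "locally_euclidean N" and F: "smooth_map M N F"
    and B: "openin (mtop N) B" and f: "smooth_fun N B f"
  shows "smooth_fun M {x \<in> points M. F x \<in> B} (\<lambda>x. f (F x))"
proof -
  have "smooth_fun M {x \<in> points M. F x \<in> B \<inter> \<Union> (fst ` charts N)} (\<lambda>x. f (F x))"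
    by (rule smooth_fun_compose[OF M N _ B order_refl])
      (use smooth_mapD[OF F] f in \<open>auto simp: smooth_fun_def\<close>)
  moreover have "B \<subseteq> \<Union> (fst ` charts N)"
    using N openin_subset[OF B] by (auto simp: locally_euclidean_def)
  then have "B \<inter> \<Union> (fst ` charts N) = B" by blast
  ultimately show ?thesis by simp
qed

lemma pullback_Cinf:
  assumes M: "locally_euclidean M" and N: "locally_euclidean N" and F: "smooth_map M N F"
    and f: "f \<in> Cinf N"
  shows "pullback M F f \<in> Cinf M"
proof -
  have F': "F x \<in> points N" if "x \<in> points M" for x
    using F that by (auto simp: smooth_map_def continuous_map_def)
  have "smooth_fun N (points N) f" using f by (simp add: Cinf_iff[OF N])
  from smooth_fun_smooth_map[OF M N F openin_topspace this]
  have "smooth_fun M {x \<in> points M. F x \<in> points N} (\<lambda>x. f (F x))" .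
  moreover have "{x \<in> points M. F x \<in> points N} = points M" using F' by auto
  ultimately have "smooth_fun M (points M) (\<lambda>x. f (F x))" by simp
  then have "smooth_fun M (points M) (pullback M F f)"
    by (rule smooth_fun_cong[OF M openin_topspace]) (simp add: pullback_def)
  then show ?thesis by (simp add: Cinf_iff[OF M] pullback_def)
qed

text \<open>Compatibility of charts enters here: it is the smoothness of the identity map, which is
  composed with \<open>f\<close> known in one chart.\<close>

lemma smooth_fun_chart:
  assumes M: "smooth_manifold M" and c: "(U, \<phi>) \<in> charts M"
    and B: "openin (mtop M) B"
    and f: "smooth_on (mdim M) (\<phi> ` (U \<inter> B)) (\<lambda>y. f (inv_into U \<phi> y))"
  shows "smooth_fun M (U \<inter> B) f"
proof -
  note L = smooth_manifold_imp_locally_euclidean[OF M]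
  have "smooth_fun M {x \<in> points M. (\<lambda>x. x) x \<in> B \<inter> \<Union> (fst ` {(U, \<phi>)})} (\<lambda>x. f ((\<lambda>x. x) x))"
  proof (rule smooth_fun_compose[OF L L _ B])
    fix V \<psi> V' \<psi>' j assume "(V, \<psi>) \<in> charts M" "(V', \<psi>') \<in> {(U, \<phi>)}" "j < mdim M"
    moreover have "\<forall>(U, \<phi>)\<in>charts M. \<forall>(V, \<psi>)\<in>charts M. \<forall>j<mdim M.
       smooth_on (mdim M) (\<phi> ` (U \<inter> V)) (\<lambda>x. \<psi> (inv_into U \<phi> x) j)"
      using M by (simp add: smooth_manifold_def)
    ultimately have "smooth_on (mdim M) (\<psi> ` (V \<inter> V')) (\<lambda>y. \<psi>' (inv_into V \<psi> y) j)"
      using c by blast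
    then show "smooth_on (mdim M) (\<psi> ` {x \<in> V. x \<in> V'}) (\<lambda>y. \<psi>' (inv_into V \<psi> y) j)"
      by (simp add: Int_def)
  qed (use c f in auto)
  moreover have "{x \<in> points M. x \<in> B \<inter> \<Union> (fst ` {(U, \<phi>)})} = U \<inter> B"
    using chart_subset[OF L c] by auto
  ultimately show ?thesis by simp
qed

subsection \<open>The algebra of smooth functions\<close>

lemma Cinf_zero_outside: "f \<in> Cinf M \<Longrightarrow> x \<notin> points M \<Longrightarrow> f x = 0"
  by (auto simp: Cinf_def)

context
  fixes M :: "'m manifold"
  assumes M: "locally_euclidean M"
begin

lemma Cinf_zero: "(\<lambda>x. 0) \<in> Cinf M"
  using smooth_fun_const[OF M openin_topspace] by (simp add: Cinf_iff[OF M])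

lemma Cinf_one: "one_fun M \<in> Cinf M"
  using smooth_fun_cong[OF M openin_topspace smooth_fun_const[OF M openin_topspace], of 1 "one_fun M"]
  by (simp add: Cinf_iff[OF M] one_fun_def)

lemma Cinf_add: "f \<in> Cinf M \<Longrightarrow> g \<in> Cinf M \<Longrightarrow> (\<lambda>x. f x + g x) \<in> Cinf M"
  by (auto simp: Cinf_iff[OF M] intro: smooth_fun_add[OF M openin_topspace])

lemma Cinf_mult: "f \<in> Cinf M \<Longrightarrow> g \<in> Cinf M \<Longrightarrow> (\<lambda>x. f x * g x) \<in> Cinf M"
  by (auto simp: Cinf_iff[OF M] intro: smooth_fun_mult[OF M openin_topspace])

lemma Cinf_scale: "f \<in> Cinf M \<Longrightarrow> (\<lambda>x. c * f x) \<in> Cinf M"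
  by (auto simp: Cinf_iff[OF M]
      intro: smooth_fun_mult[OF M openin_topspace] smooth_fun_const[OF M openin_topspace])

lemma Cinf_minus: "f \<in> Cinf M \<Longrightarrow> g \<in> Cinf M \<Longrightarrow> (\<lambda>x. f x - g x) \<in> Cinf M"
  using Cinf_add[of f "\<lambda>x. (-1) * g x"] Cinf_scale[of g "-1"] by simp

lemma Cinf_sum: "(\<And>s. s \<in> S \<Longrightarrow> f s \<in> Cinf M) \<Longrightarrow> (\<lambda>x. \<Sum>s\<in>S. f s x) \<in> Cinf M"
  by (induction S rule: infinite_finite_induct) (auto intro: Cinf_zero Cinf_add)

lemma Cinf_local:
  assumes "\<And>x. x \<notin> points M \<Longrightarrow> f x = 0"
    and "\<And>x. x \<in> points M \<Longrightarrow> \<exists>B. openin (mtop M) B \<and> x \<in> B \<and> smooth_fun M B f"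
  shows "f \<in> Cinf M"
  using assms smooth_fun_local[OF M openin_topspace, of f] by (auto simp: Cinf_iff[OF M])

lemma Cinf_local_eq:
  assumes "\<And>x. x \<notin> points M \<Longrightarrow> f x = 0"
    and "\<And>x. x \<in> points M \<Longrightarrow> \<exists>B g. openin (mtop M) B \<and> x \<in> B \<and> g \<in> Cinf M \<and> (\<forall>y\<in>B. f y = g y)"
  shows "f \<in> Cinf M"
proof (rule Cinf_local[OF assms(1)])
  fix x assume "x \<in> points M"
  then obtain B g where B: "openin (mtop M) B" "x \<in> B" "g \<in> Cinf M" "\<forall>y\<in>B. f y = g y"
    using assms(2) by blast
  have "smooth_fun M B g"
    using B(3) openin_subset[OF B(1)] by (auto simp: Cinf_iff[OF M] intro: smooth_fun_subset)
  then have "smooth_fun M B f" using smooth_fun_cong[OF M B(1)] B(4) by metis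
  then show "\<exists>B. openin (mtop M) B \<and> x \<in> B \<and> smooth_fun M B f" using B by blast
qed auto

end

subsection \<open>Open submanifolds and products\<close>

lemma open_submanifold_simps [simp]:
  "mtop (open_submanifold M W) = subtopology (mtop M) W"
  "mdim (open_submanifold M W) = mdim M"
  by (auto simp: open_submanifold_def)

lemma charts_open_submanifold: "charts (open_submanifold M W) = {(U \<inter> W, \<phi>) | U \<phi>. (U, \<phi>) \<in> charts M}"
  by (force simp: open_submanifold_def)

lemma locally_euclidean_open_submanifold:
  assumes M: "locally_euclidean M" and W: "openin (mtop M) W"
  shows "locally_euclidean (open_submanifold M W)"
  unfolding locally_euclidean_def
proof (intro conjI ballI, goal_cases)
  case 1
  have "\<Union> (fst ` charts M) = points M" using M by (simp add: locally_euclidean_def)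
  moreover have "\<Union> (fst ` charts (open_submanifold M W)) = \<Union> (fst ` charts M) \<inter> W"
    by (force simp: charts_open_submanifold)
  ultimately show ?case by simp
next
  case (2 c)
  then obtain U \<phi> where c: "c = (U \<inter> W, \<phi>)" "(U, \<phi>) \<in> charts M"
    by (auto simp: charts_open_submanifold)
  note o = chart_open_image[OF M c(2) W]
  have "homeomorphic_map (subtopology (subtopology (mtop M) U) (U \<inter> W))
     (subtopology (subtopology (Euclidean_space (mdim M)) (\<phi> ` U)) (\<phi> ` (U \<inter> W))) \<phi>"
    by (rule homeomorphic_map_subtopologies[OF chart_homeo[OF M c(2)]])
      (use chart_subset[OF M c(2)] openin_subset[OF chart_open(2)[OF M c(2)]] in auto)
  then have "homeomorphic_map (subtopology (mtop M) (U \<inter> W)) (subtopology (Euclidean_space (mdim M)) (\<phi> ` (U \<inter> W))) \<phi>"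
    by (simp add: subtopology_subtopology Int_absorb1 image_Int_subset inf.absorb2 image_mono)
  moreover have "subtopology (subtopology (mtop M) W) (U \<inter> W) = subtopology (mtop M) (U \<inter> W)"
    by (simp add: subtopology_subtopology Int_commute Int_left_commute inf.absorb2)
  moreover have "openin (subtopology (mtop M) W) (U \<inter> W)"
    using chart_open(1)[OF M c(2)] by (auto simp: openin_subtopology)
  ultimately show ?case using o c by simp
qed

lemma smooth_fun_open_submanifold:
  assumes M: "locally_euclidean M" and A: "A \<subseteq> W" and oA: "openin (mtop M) A"
  shows "smooth_fun (open_submanifold M W) A f \<longleftrightarrow> smooth_fun M A f"
proof -
  have "Ck k (mdim M) (\<phi> ` (U \<inter> W \<inter> A)) (\<lambda>y. f (inv_into (U \<inter> W) \<phi> y)) \<longleftrightarrow>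
        Ck k (mdim M) (\<phi> ` (U \<inter> A)) (\<lambda>y. f (inv_into U \<phi> y))" if c: "(U, \<phi>) \<in> charts M" for U \<phi> k
  proof -
    have UA: "U \<inter> W \<inter> A = U \<inter> A" using A by blast
    have eq: "inv_into (U \<inter> W) \<phi> y = inv_into U \<phi> y" if y: "y \<in> \<phi> ` (U \<inter> A)" for y
    proof -
      obtain x where x: "x \<in> U" "x \<in> A" "y = \<phi> x" using y by auto
      have "inj_on \<phi> (U \<inter> W)" using chart_inj[OF M c] by (rule inj_on_subset) auto
      then show ?thesis using x A chart_inv[OF M c] by (auto simp: inv_into_f_f subset_iff)
    qed
    show ?thesis unfolding UA
      using Ck_cong[OF chart_open_image[OF M c oA]] eq by (smt (verit, best))
  qed
  moreover have "smooth_fun (open_submanifold M W) A f \<longleftrightarrow> (\<forall>U \<phi>. (U, \<phi>) \<in> charts M \<longrightarrow>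
     (\<forall>k. Ck k (mdim M) (\<phi> ` (U \<inter> W \<inter> A)) (\<lambda>y. f (inv_into (U \<inter> W) \<phi> y))))"
    unfolding smooth_fun_def charts_open_submanifold smooth_on_iff_Ck open_submanifold_simps by fast
  ultimately show ?thesis
    unfolding smooth_fun_def smooth_on_iff_Ck by auto
qed

definition join :: "nat \<Rightarrow> (nat \<Rightarrow> real) \<Rightarrow> (nat \<Rightarrow> real) \<Rightarrow> nat \<Rightarrow> real"
  where "join m y z = (\<lambda>i. if i < m then y i else z (i - m))"

lemma product_chart_eq_join: "product_chart m \<phi> \<psi> (x, y) = join m (\<phi> x) (\<psi> y)"
  by (auto simp: product_chart_def join_def)

text \<open>Padded with 0, because points of the model space vanish beyond its dimension.\<close>

definition fst_part :: "nat \<Rightarrow> (nat \<Rightarrow> real) \<Rightarrow> nat \<Rightarrow> real"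
  where "fst_part m z = (\<lambda>i. if i < m then z i else 0)"

definition snd_part :: "nat \<Rightarrow> (nat \<Rightarrow> real) \<Rightarrow> nat \<Rightarrow> real"
  where "snd_part m z = (\<lambda>i. z (i + m))"

lemma fst_part_join: "(\<And>i. m \<le> i \<Longrightarrow> y i = 0) \<Longrightarrow> fst_part m (join m y z) = y"
  by (auto simp: fst_part_def join_def)

lemma snd_part_join [simp]: "snd_part m (join m y z) = z"
  by (auto simp: snd_part_def join_def)

lemma join_parts [simp]: "join m (fst_part m z) (snd_part m z) = z"
  by (auto simp: snd_part_def fst_part_def join_def)

lemma continuous_map_into_Euclidean_space:
  "continuous_map X (Euclidean_space n) f \<longleftrightarrow>
     (\<forall>i. continuous_map X euclideanreal (\<lambda>x. f x i)) \<and> (\<forall>x\<in>topspace X. \<forall>i\<ge>n. f x i = 0)"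
  by (auto simp: Euclidean_space_def continuous_map_in_subtopology continuous_map_componentwise_UNIV)

lemma continuous_map_Euclidean_coord: "continuous_map (Euclidean_space n) euclideanreal (\<lambda>x. x i)"
  unfolding Euclidean_space_def
  by (intro continuous_map_from_subtopology continuous_map_product_projection) simp

lemma continuous_map_fst_part: "continuous_map (Euclidean_space (m + d)) (Euclidean_space m) (fst_part m)"
proof -
  have "continuous_map (Euclidean_space (m + d)) euclideanreal (\<lambda>x. fst_part m x i)" for i
    by (cases "i < m") (auto simp: fst_part_def continuous_map_Euclidean_coord)
  then show ?thesis by (auto simp: continuous_map_into_Euclidean_space fst_part_def)
qed

lemma continuous_map_snd_part: "continuous_map (Euclidean_space (m + d)) (Euclidean_space d) (snd_part m)"
  by (auto simp: continuous_map_into_Euclidean_space snd_part_def continuous_map_Euclidean_coord topspace_Euclidean_space)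

lemma product_manifold_simps [simp]:
  "mtop (product_manifold M N) = prod_topology (mtop M) (mtop N)"
  "mdim (product_manifold M N) = mdim M + mdim N"
  by (auto simp: product_manifold_def)

lemma charts_product_manifold:
  "charts (product_manifold M N) =
     {(U \<times> V, product_chart (mdim M) \<phi> \<psi>) | U \<phi> V \<psi>. (U, \<phi>) \<in> charts M \<and> (V, \<psi>) \<in> charts N}"
  by (simp add: product_manifold_def)

context
  fixes M :: "'m manifold" and N :: "'n manifold" and U \<phi> V \<psi>
  assumes M: "locally_euclidean M" and N: "locally_euclidean N"
    and c: "(U, \<phi>) \<in> charts M" and c': "(V, \<psi>) \<in> charts N"
begin

lemma product_chart_inj: "inj_on (product_chart (mdim M) \<phi> \<psi>) (U \<times> V)"
proof (rule inj_onI)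
  fix a b assume ab: "a \<in> U \<times> V" "b \<in> U \<times> V" "product_chart (mdim M) \<phi> \<psi> a = product_chart (mdim M) \<phi> \<psi> b"
  obtain x y x' y' where [simp]: "a = (x, y)" "b = (x', y')" by fastforce
  have j: "join (mdim M) (\<phi> x) (\<psi> y) = join (mdim M) (\<phi> x') (\<psi> y')"
    using ab by (simp add: product_chart_eq_join)
  have "\<phi> x = \<phi> x'"
    using arg_cong[OF j, of "fst_part (mdim M)"] ab chart_zero[OF M c] by (simp add: fst_part_join)
  moreover have "\<psi> y = \<psi> y'" using arg_cong[OF j, of "snd_part (mdim M)"] by simp
  ultimately show "a = b" using chart_inj[OF M c] chart_inj[OF N c'] ab by (auto dest: inj_onD)
qed

lemma product_chart_image:
  "product_chart (mdim M) \<phi> \<psi> ` (U \<times> V) =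
     {z \<in> topspace (Euclidean_space (mdim M + mdim N)). fst_part (mdim M) z \<in> \<phi> ` U \<and> snd_part (mdim M) z \<in> \<psi> ` V}"
  (is "?L = ?R")
proof
  show "?L \<subseteq> ?R"
  proof
    fix z assume "z \<in> ?L"
    then obtain x y where xy: "x \<in> U" "y \<in> V" "z = join (mdim M) (\<phi> x) (\<psi> y)"
      by (auto simp: product_chart_eq_join)
    then show "z \<in> ?R" using chart_zero[OF M c xy(1)] chart_zero[OF N c' xy(2)]
      by (auto simp: fst_part_join topspace_Euclidean_space) (auto simp: join_def)
  qed
next
  show "?R \<subseteq> ?L"
  proof
    fix z assume "z \<in> ?R"
    then obtain x y where xy: "x \<in> U" "y \<in> V" "fst_part (mdim M) z = \<phi> x" "snd_part (mdim M) z = \<psi> y" by auto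
    then have "z = product_chart (mdim M) \<phi> \<psi> (x, y)"
      using join_parts[of "mdim M" z] by (simp add: product_chart_eq_join)
    then show "z \<in> ?L" using xy by blast
  qed
qed

lemma product_chart_image_open:
  "openin (Euclidean_space (mdim M + mdim N)) (product_chart (mdim M) \<phi> \<psi> ` (U \<times> V))"
proof -
  have "?thesis \<longleftrightarrow> openin (Euclidean_space (mdim M + mdim N))
     ({z \<in> topspace (Euclidean_space (mdim M + mdim N)). fst_part (mdim M) z \<in> \<phi> ` U} \<inter>
      {z \<in> topspace (Euclidean_space (mdim M + mdim N)). snd_part (mdim M) z \<in> \<psi> ` V})"
    unfolding product_chart_image by (rule arg_cong[where f="openin _"]) blast
  then show ?thesis
    using openin_continuous_map_preimage[OF continuous_map_fst_part chart_open(2)[OF M c]]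
      openin_continuous_map_preimage[OF continuous_map_snd_part chart_open(2)[OF N c']]
    by blast
qed

lemma product_chart_homeo:
  "homeomorphic_map (subtopology (prod_topology (mtop M) (mtop N)) (U \<times> V))
     (subtopology (Euclidean_space (mdim M + mdim N)) (product_chart (mdim M) \<phi> \<psi> ` (U \<times> V)))
     (product_chart (mdim M) \<phi> \<psi>)"
proof -
  let ?pc = "product_chart (mdim M) \<phi> \<psi>"
  let ?X = "subtopology (prod_topology (mtop M) (mtop N)) (U \<times> V)"
  let ?Y = "subtopology (Euclidean_space (mdim M + mdim N)) (?pc ` (U \<times> V))"
  have X: "?X = prod_topology (subtopology (mtop M) U) (subtopology (mtop N) V)"
    by (rule subtopology_Times)
  have tX: "topspace ?X = U \<times> V"
    using chart_subset[OF M c] chart_subset[OF N c'] by auto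
  have cm\<phi>: "continuous_map (subtopology (mtop M) U) euclideanreal (\<lambda>x. \<phi> x i)" for i
    using chart_continuous[OF M c] by (simp add: continuous_map_into_Euclidean_space)
  have cm\<psi>: "continuous_map (subtopology (mtop N) V) euclideanreal (\<lambda>x. \<psi> x i)" for i
    using chart_continuous[OF N c'] by (simp add: continuous_map_into_Euclidean_space)
  have "continuous_map ?X euclideanreal (\<lambda>p. ?pc p i)" for i
    unfolding X product_chart_def case_prod_beta
    using continuous_map_compose[OF continuous_map_fst cm\<phi>[of i], of "subtopology (mtop N) V", unfolded o_def]
      continuous_map_compose[OF continuous_map_snd cm\<psi>[of "i - mdim M"], of "subtopology (mtop M) U", unfolded o_def]
    by (cases "i < mdim M") (simp_all only: if_True if_False)
  moreover have "?pc p i = 0" if "p \<in> topspace ?X" "mdim M + mdim N \<le> i" for p i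
  proof -
    have "snd p \<in> V" using that(1) tX by (metis mem_Times_iff)
    then have "\<psi> (snd p) (i - mdim M) = 0" using that(2) by (intro chart_zero[OF N c']) auto
    then show ?thesis using that(2) by (simp add: product_chart_def case_prod_beta)
  qed
  ultimately have "continuous_map ?X (Euclidean_space (mdim M + mdim N)) ?pc"
    by (auto simp: continuous_map_into_Euclidean_space)
  then have c1: "continuous_map ?X ?Y ?pc"
    using tX by (auto simp: continuous_map_in_subtopology)
  define g where "g z = (inv_into U \<phi> (fst_part (mdim M) z), inv_into V \<psi> (snd_part (mdim M) z))" for z
  have "continuous_map ?Y (subtopology (Euclidean_space (mdim M)) (\<phi> ` U)) (fst_part (mdim M))"
    using product_chart_image
    by (auto simp: continuous_map_in_subtopology intro: continuous_map_from_subtopology continuous_map_fst_part)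
  from continuous_map_compose[OF this chart_inv_continuous[OF M c]]
  have g1: "continuous_map ?Y (subtopology (mtop M) U) (\<lambda>z. inv_into U \<phi> (fst_part (mdim M) z))"
    by (simp add: o_def)
  have "continuous_map ?Y (subtopology (Euclidean_space (mdim N)) (\<psi> ` V)) (snd_part (mdim M))"
    using product_chart_image
    by (auto simp: continuous_map_in_subtopology intro: continuous_map_from_subtopology continuous_map_snd_part)
  from continuous_map_compose[OF this chart_inv_continuous[OF N c']]
  have g2: "continuous_map ?Y (subtopology (mtop N) V) (\<lambda>z. inv_into V \<psi> (snd_part (mdim M) z))"
    by (simp add: o_def)
  have c2: "continuous_map ?Y ?X g"
    unfolding X g_def using g1 g2 by (simp add: continuous_map_paired)
  have gp: "g (?pc p) = p" if "p \<in> U \<times> V" for p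
    using that chart_zero[OF M c] chart_inv[OF M c] chart_inv[OF N c']
    by (auto simp: g_def product_chart_eq_join fst_part_join)
  have "homeomorphic_maps ?X ?Y ?pc g"
    unfolding homeomorphic_maps_def
  proof (intro conjI c1 c2 ballI)
    show "g (?pc p) = p" if "p \<in> topspace ?X" for p using that tX gp by blast
    show "?pc (g y) = y" if "y \<in> topspace ?Y" for y
    proof -
      obtain p where "p \<in> U \<times> V" "y = ?pc p" using \<open>y \<in> topspace ?Y\<close> by auto
      then show ?thesis using gp by simp
    qed
  qed
  then show ?thesis by (rule homeomorphic_maps_imp_map)
qed

end

lemma locally_euclidean_product:
  assumes M: "locally_euclidean M" and N: "locally_euclidean N"
  shows "locally_euclidean (product_manifold M N)"
  unfolding locally_euclidean_def
proof (intro conjI ballI, goal_cases)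
  case 1
  show ?case
  proof (intro equalityI subsetI)
    fix z assume "z \<in> \<Union> (fst ` charts (product_manifold M N))"
    then obtain U \<phi> V \<psi> where "(U, \<phi>) \<in> charts M" "(V, \<psi>) \<in> charts N" "z \<in> U \<times> V"
      unfolding charts_product_manifold by fastforce
    then show "z \<in> points (product_manifold M N)"
      using chart_subset[OF M, of U \<phi>] chart_subset[OF N, of V \<psi>] by auto
  next
    fix z assume "z \<in> points (product_manifold M N)"
    then have z: "fst z \<in> points M" "snd z \<in> points N" by auto
    obtain U \<phi> where c: "(U, \<phi>) \<in> charts M" "fst z \<in> U" using chart_cover[OF M z(1)] .
    obtain V \<psi> where c': "(V, \<psi>) \<in> charts N" "snd z \<in> V" using chart_cover[OF N z(2)] .
    have "(U \<times> V, product_chart (mdim M) \<phi> \<psi>) \<in> charts (product_manifold M N)"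
      unfolding charts_product_manifold using c c' by blast
    moreover have "z \<in> U \<times> V" using c c' by (simp add: mem_Times_iff)
    ultimately show "z \<in> \<Union> (fst ` charts (product_manifold M N))" by force
  qed
next
  case (2 c)
  then obtain U \<phi> V \<psi> where c: "c = (U \<times> V, product_chart (mdim M) \<phi> \<psi>)" "(U, \<phi>) \<in> charts M" "(V, \<psi>) \<in> charts N"
    by (auto simp: charts_product_manifold)
  have "openin (prod_topology (mtop M) (mtop N)) (U \<times> V)"
    using chart_open(1)[OF M c(2)] chart_open(1)[OF N c(3)] by (simp add: openin_prod_Times_iff)
  then show ?case
    using c product_chart_image_open[OF M N c(2,3)] product_chart_homeo[OF M N c(2,3)] by simp
qed

lemma inv_into_product_chart:
  assumes M: "locally_euclidean M" and N: "locally_euclidean N"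
    and c: "(U, \<phi>) \<in> charts M" "(V, \<psi>) \<in> charts N" and "y \<in> \<phi> ` U" "z \<in> \<psi> ` V"
  shows "inv_into (U \<times> V) (product_chart (mdim M) \<phi> \<psi>) (join (mdim M) y z) = (inv_into U \<phi> y, inv_into V \<psi> z)"
proof -
  have "join (mdim M) y z = product_chart (mdim M) \<phi> \<psi> (inv_into U \<phi> y, inv_into V \<psi> z)"
    using assms by (simp add: product_chart_eq_join f_inv_into_f)
  then show ?thesis
    using assms by (simp add: inv_into_f_f[OF product_chart_inj[OF M N c]] inv_into_into)
qed

lemma Ck_join_coord:
  assumes "openin (Euclidean_space n) W" shows "Ck k n W (\<lambda>y. join m y z j)"
  unfolding join_def by (cases "j < m") (auto intro: Ck_coord[OF assms] Ck_const[OF assms])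

text \<open>In a product chart, fixing the second point means freezing the last coordinates, which
  is a composition with the smooth map
  \<open>y \<mapsto> join (mdim M) y (\<psi> b)\<close>.\<close>

lemma smooth_fun_slice:
  assumes M: "locally_euclidean M" and N: "locally_euclidean N" and b: "b \<in> points N"
    and f: "smooth_fun (product_manifold M N) (points M \<times> points N) f"
  shows "smooth_fun M (points M) (\<lambda>x. f (x, b))"
proof (rule smooth_funI)
  fix U \<phi> k assume c: "(U, \<phi>) \<in> charts M"
  obtain V \<psi> where c': "(V, \<psi>) \<in> charts N" "b \<in> V" using chart_cover[OF N b] .
  let ?pc = "product_chart (mdim M) \<phi> \<psi>"
  have [simp]: "U \<inter> points M = U" "(U \<times> V) \<inter> (points M \<times> points N) = U \<times> V"
    using chart_subset[OF M c] chart_subset[OF N c'(1)] by auto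
  have "(U \<times> V, ?pc) \<in> charts (product_manifold M N)"
    using c c' by (auto simp: charts_product_manifold)
  from smooth_funD[OF f this] have *: "Ck k (mdim M + mdim N) (?pc ` (U \<times> V)) (\<lambda>z. f (inv_into (U \<times> V) ?pc z))"
    by simp
  have "Ck k (mdim M) (\<phi> ` U) (\<lambda>y. f (inv_into (U \<times> V) ?pc (join (mdim M) y (\<psi> b))))"
  proof (rule Ck_compose[OF chart_open(2)[OF M c] product_chart_image_open[OF M N c c'(1)] _ *])
    show "join (mdim M) y (\<psi> b) \<in> ?pc ` (U \<times> V)" if "y \<in> \<phi> ` U" for y
      using that c'(2) by (force simp: product_chart_eq_join[symmetric])
  qed (rule Ck_join_coord[OF chart_open(2)[OF M c]])
  then show "Ck k (mdim M) (\<phi> ` (U \<inter> points M)) (\<lambda>y. f (inv_into U \<phi> y, b))"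
    unfolding \<open>U \<inter> points M = U\<close>
    by (rule Ck_cong[OF chart_open(2)[OF M c]])
      (use inv_into_product_chart[OF M N c c'(1)] c'(2) chart_inv[OF N c'(1)] in auto)
qed

lemma pullback_action_Cinf:
  assumes P: "locally_euclidean P" and GM: "locally_euclidean GM"
    and r: "smooth_map (product_manifold P GM) P (\<lambda>(u, g). r u g)" and g: "g \<in> points GM"
    and f: "f \<in> Cinf P"
  shows "pullback P (\<lambda>u. r u g) f \<in> Cinf P"
proof -
  have "pullback (product_manifold P GM) (\<lambda>(u, g). r u g) f \<in> Cinf (product_manifold P GM)"
    by (rule pullback_Cinf[OF locally_euclidean_product[OF P GM] P r f])
  then have "smooth_fun (product_manifold P GM) (points P \<times> points GM) (pullback (product_manifold P GM) (\<lambda>(u, g). r u g) f)"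
    by (simp add: Cinf_iff[OF locally_euclidean_product[OF P GM]])
  from smooth_fun_slice[OF P GM g this]
  have "smooth_fun P (points P) (pullback P (\<lambda>u. r u g) f)"
    by (rule smooth_fun_cong[OF P openin_topspace]) (use g in \<open>auto simp: pullback_def\<close>)
  then show ?thesis by (simp add: Cinf_iff[OF P] pullback_def)
qed

subsection \<open>Local frames\<close>

definition closed_box :: "nat \<Rightarrow> (nat \<Rightarrow> real) \<Rightarrow> real \<Rightarrow> (nat \<Rightarrow> real) set"
  where "closed_box n z r = {y. (\<forall>i<n. \<bar>y i - z i\<bar> \<le> r) \<and> (\<forall>i\<ge>n. y i = 0)}"

lemma compactin_closed_box: "compactin (Euclidean_space n) (closed_box n z r)"
proof -
  have "closed_box n z r = (\<Pi>\<^sub>E i\<in>UNIV. if i < n then {z i - r..z i + r} else {0})"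
    by (auto simp: closed_box_def PiE_iff abs_le_iff split: if_splits; smt (verit) atLeastAtMost_iff)
  moreover have "compactin (powertop_real UNIV) (\<Pi>\<^sub>E i\<in>UNIV. if i < n then {z i - r..z i + r} else {0})"
    by (simp add: compactin_PiE)
  ultimately show ?thesis
    by (auto simp: Euclidean_space_def compactin_subtopology closed_box_def)
qed

text \<open>As \<open>M\<close> is Hausdorff, a compact subset of a chart is closed in all of
  \<open>M\<close>. This is what makes extension by 0 smooth.\<close>

lemma chart_compact_closed:
  assumes M: "smooth_manifold M" and c: "(U, \<phi>) \<in> charts M"
    and K: "compactin (Euclidean_space (mdim M)) K" "K \<subseteq> \<phi> ` U"
  shows "closedin (mtop M) {x \<in> U. \<phi> x \<in> K}"
proof -
  note L = smooth_manifold_imp_locally_euclidean[OF M]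
  have "compactin (subtopology (Euclidean_space (mdim M)) (\<phi> ` U)) K"
    using K by (simp add: compactin_subtopology)
  from image_compactin[OF this chart_inv_continuous[OF L c]]
  have "compactin (mtop M) (inv_into U \<phi> ` K)" by (simp add: compactin_subtopology)
  moreover have "inv_into U \<phi> ` K = {x \<in> U. \<phi> x \<in> K}"
    using K(2) chart_inv[OF L c] by (force simp: image_iff inv_into_into f_inv_into_f)
  ultimately show ?thesis
    using M by (simp add: smooth_manifold_def compactin_imp_closedin)
qed

text \<open>Two open sets cover \<open>M\<close>: the part of the chart over \<open>W\<close>, where
  the formula is smooth, and the complement of the compact support, where the function is 0.\<close>

lemma chart_extension_Cinf:
  assumes M: "smooth_manifold M" and c: "(U, \<phi>) \<in> charts M"
    and K: "compactin (Euclidean_space (mdim M)) K" "K \<subseteq> W" and W: "openin (Euclidean_space (mdim M)) W" "W \<subseteq> \<phi> ` U"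
    and \<theta>: "\<And>k. Ck k (mdim M) W \<theta>" and \<theta>0: "\<And>y. y \<notin> K \<Longrightarrow> \<theta> y = 0"
  shows "(\<lambda>x. if x \<in> U then \<theta> (\<phi> x) else 0) \<in> Cinf M"
proof (rule Cinf_local[OF smooth_manifold_imp_locally_euclidean[OF M]])
  note L = smooth_manifold_imp_locally_euclidean[OF M]
  let ?f = "\<lambda>x. if x \<in> U then \<theta> (\<phi> x) else 0"
  show "?f x = 0" if "x \<notin> points M" for x using that chart_subset[OF L c] by auto
  fix x assume x: "x \<in> points M"
  show "\<exists>B. openin (mtop M) B \<and> x \<in> B \<and> smooth_fun M B ?f"
  proof (cases "x \<in> U \<and> \<phi> x \<in> W")
    case True
    define B where "B = {x \<in> U. \<phi> x \<in> W}"
    have B: "openin (mtop M) B" unfolding B_def by (rule chart_preimage_open[OF L c W(1)])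
    have UB: "U \<inter> B = B" "\<phi> ` B = W" using W(2) by (auto simp: B_def)
    have "smooth_on (mdim M) (\<phi> ` (U \<inter> B)) (\<lambda>y. ?f (inv_into U \<phi> y))"
      unfolding smooth_on_iff_Ck UB
      by (intro allI Ck_cong[OF W(1) \<theta>]) (use W(2) in \<open>auto simp: inv_into_into f_inv_into_f subset_iff\<close>)
    from smooth_fun_chart[OF M c B this] show ?thesis using B True UB by (auto simp: B_def)
  next
    case False
    define B where "B = points M - {x \<in> U. \<phi> x \<in> K}"
    have B: "openin (mtop M) B" unfolding B_def
      using chart_compact_closed[OF M c K(1)] K W by (intro openin_diff) auto
    have "smooth_fun M B ?f"
      by (rule smooth_fun_cong[OF L B smooth_fun_const[OF L B]]) (use \<theta>0 in \<open>auto simp: B_def\<close>)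
    then show ?thesis using B False x K(2) by (auto simp: B_def)
  qed
qed

section \<open>Cut-off coordinates and lifted coordinate fields in a local trivialization\<close>

definition derivation :: "'m manifold \<Rightarrow> (('m \<Rightarrow> complex) \<Rightarrow> 'm \<Rightarrow> complex) \<Rightarrow> bool"
  where "derivation M X \<longleftrightarrow> linear_op M M X \<and>
    (\<forall>f\<in>Cinf M. \<forall>g\<in>Cinf M. X (\<lambda>x. f x * g x) = (\<lambda>x. X f x * g x + f x * X g x))"

locale local_trivialization =
  fixes P :: "'p manifold" and M :: "'m manifold" and GM :: "'g manifold" and G :: "'g monoid"
    and r :: "'p \<Rightarrow> 'g \<Rightarrow> 'p" and p :: "'p \<Rightarrow> 'm"
    and U' \<tau> h U \<phi> z \<epsilon>
  assumes P: "smooth_manifold P" and M: "smooth_manifold M" and G: "lie_group GM G"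
    and p: "smooth_map P M p"
    and r: "smooth_map (product_manifold P GM) P (\<lambda>(u, g). r u g)"
    and pr: "\<And>u g. u \<in> points P \<Longrightarrow> g \<in> carrier G \<Longrightarrow> p (r u g) = p u"
    and U': "openin (mtop M) U'"
    and \<tau>: "smooth_map (open_submanifold P {u \<in> points P. p u \<in> U'}) (product_manifold (open_submanifold M U') GM) \<tau>"
    and h: "smooth_map (product_manifold (open_submanifold M U') GM) (open_submanifold P {u \<in> points P. p u \<in> U'}) h"
    and h\<tau>: "\<And>u. u \<in> points P \<Longrightarrow> p u \<in> U' \<Longrightarrow> h (\<tau> u) = u"
    and \<tau>h: "\<And>x g. x \<in> U' \<Longrightarrow> g \<in> points GM \<Longrightarrow> \<tau> (h (x, g)) = (x, g)"
    and \<tau>p: "\<And>u. u \<in> points P \<Longrightarrow> p u \<in> U' \<Longrightarrow> fst (\<tau> u) = p u"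
    and \<tau>r: "\<And>u g. u \<in> points P \<Longrightarrow> p u \<in> U' \<Longrightarrow> g \<in> carrier G \<Longrightarrow> \<tau> (r u g) = (fst (\<tau> u), snd (\<tau> u) \<otimes>\<^bsub>G\<^esub> g)"
    and c: "(U, \<phi>) \<in> charts M" and \<epsilon>: "\<epsilon> > 0"
    and box: "ebox (mdim M) z (5 * \<epsilon>) \<subseteq> \<phi> ` (U \<inter> U')"
begin

abbreviation "n \<equiv> mdim M"
abbreviation "W \<equiv> ebox n z (5 * \<epsilon>)"
text \<open>The radii are nested. \<open>cutoff \<epsilon>\<close> is nonzero only inside radius
  \<open>2 * \<epsilon>\<close>, where the larger bump in \<open>coord\<close> and
  \<open>lift\<close> is 1, so these are the true coordinates and fields there. That larger bump
  lives in \<open>K\<close>, of radius \<open>4 * \<epsilon>\<close>, which is compact in the open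
  box \<open>W\<close> of radius \<open>5 * \<epsilon>\<close>.\<close>

definition "K = closed_box n z (4 * \<epsilon>)"
definition "Om = {x \<in> U. \<phi> x \<in> W}"
definition "pre A = {u \<in> points P. p u \<in> A}"
definition "cutoff d = (\<lambda>x. if x \<in> U then complex_of_real (bump n z d (\<phi> x)) else 0)"
definition "coord i = (\<lambda>x. if x \<in> U then complex_of_real (\<phi> x i * bump n z (2 * \<epsilon>) (\<phi> x)) else 0)"

lemma LP: "locally_euclidean P" and LM: "locally_euclidean M" and LG: "locally_euclidean GM"
  and carrier_G: "carrier G = points GM"
  using P M G by (auto simp: lie_group_def intro: smooth_manifold_imp_locally_euclidean)

lemma Om_open: "openin (mtop M) Om"
  unfolding Om_def by (rule chart_preimage_open[OF LM c openin_ebox])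

lemma Om_subset: "Om \<subseteq> U" "Om \<subseteq> U'"
  using box chart_inj[OF LM c] by (auto simp: Om_def dest!: subsetD inj_onD)

lemma p_closed: "u \<in> points P \<Longrightarrow> p u \<in> points M"
  using p by (auto simp: smooth_map_def continuous_map_def)

lemma r_closed: "u \<in> points P \<Longrightarrow> g \<in> points GM \<Longrightarrow> r u g \<in> points P"
  using smooth_mapD(2)[OF r] by (force simp: continuous_map_def Pi_iff)

lemma K_compact: "compactin (Euclidean_space n) K" and K_subset: "K \<subseteq> W"
  using \<epsilon> by (auto simp: K_def compactin_closed_box) (auto simp: closed_box_def ebox_def)

lemma not_K: "y \<in> topspace (Euclidean_space n) \<Longrightarrow> y \<notin> K \<Longrightarrow> d \<le> 2 * \<epsilon> \<Longrightarrow> d > 0 \<Longrightarrow> bump n z d y = 0"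
  by (auto simp: K_def closed_box_def topspace_Euclidean_space intro!: bump_eq_0)

lemma W_subset: "W \<subseteq> \<phi> ` U" using box by auto

lemma extension_Cinf:
  assumes "\<And>k. Ck k n W \<theta>" "0 < d" "d \<le> 2 * \<epsilon>"
  shows "(\<lambda>x. if x \<in> U then \<theta> (\<phi> x) * of_real (bump n z d (\<phi> x)) else 0) \<in> Cinf M"
proof -
  \<comment> \<open>\<open>K\<close> consists of points of the model space, while
    \<open>bump\<close> ignores the coordinates from \<open>n\<close> on; the case distinction makes
    the function vanish at every point outside \<open>K\<close>.\<close>
  let ?\<theta> = "\<lambda>y. if y \<in> topspace (Euclidean_space n) then \<theta> y * complex_of_real (bump n z d y) else 0"
  have "(\<lambda>x. if x \<in> U then ?\<theta> (\<phi> x) else 0) \<in> Cinf M"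
  proof (rule chart_extension_Cinf[OF M c K_compact K_subset openin_ebox W_subset])
    show "?\<theta> y = 0" if "y \<notin> K" for y using not_K that assms by auto
    have W_top: "W \<subseteq> topspace (Euclidean_space n)" using openin_ebox openin_subset by blast
    show "Ck k n W ?\<theta>" for k
    proof (rule Ck_cong[OF openin_ebox])
      show "Ck k n W (\<lambda>y. \<theta> y * complex_of_real (bump n z d y))"
        by (intro Ck_mult openin_ebox assms Ck_bounded_linear[OF bounded_linear_of_real] Ck_bump)
    qed (use W_top in auto)
  qed
  moreover have "\<phi> x \<in> topspace (Euclidean_space n)" if "x \<in> U" for x
    using chart_zero[OF LM c that] by (simp add: topspace_Euclidean_space)
  then have "(\<lambda>x. if x \<in> U then ?\<theta> (\<phi> x) else 0) =
     (\<lambda>x. if x \<in> U then \<theta> (\<phi> x) * of_real (bump n z d (\<phi> x)) else 0)" by auto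
  ultimately show ?thesis by simp
qed

lemma cutoff_Cinf: "0 < d \<Longrightarrow> d \<le> 2 * \<epsilon> \<Longrightarrow> cutoff d \<in> Cinf M"
  using extension_Cinf[of "\<lambda>y. 1" d] by (simp add: cutoff_def Ck_const[OF openin_ebox] cong: if_cong)

lemma coord_Cinf: "coord i \<in> Cinf M"
  using extension_Cinf[of "\<lambda>y. of_real (y i)" "2 * \<epsilon>"] \<epsilon>
  by (simp add: coord_def Ck_bounded_linear[OF bounded_linear_of_real] openin_ebox Ck_coord cong: if_cong)

lemma cutoff_nonzero:
  assumes "cutoff \<epsilon> x \<noteq> 0" shows "x \<in> U" "\<phi> x \<in> ebox n z (2 * \<epsilon>)"
proof -
  show x: "x \<in> U" using assms by (auto simp: cutoff_def split: if_splits)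
  have "\<bar>\<phi> x i - z i\<bar> < 2 * \<epsilon>" if "i < n" for i
    using bump_eq_0[OF \<epsilon> that, of "\<phi> x" z] assms x by (force simp: cutoff_def)
  then show "\<phi> x \<in> ebox n z (2 * \<epsilon>)" using chart_zero[OF LM c x] by (auto simp: ebox_def)
qed

lemma ebox_mono: "d \<le> d' \<Longrightarrow> ebox n z d \<subseteq> ebox n z d'"
  by (auto simp: ebox_def)

lemma bump_box: "y \<in> ebox n z (2 * \<epsilon>) \<Longrightarrow> bump n z (2 * \<epsilon>) y = 1"
  using \<epsilon> by (intro bump_eq_1) (auto simp: ebox_def less_imp_le)

lemma cutoff_nonzero_Om: "cutoff \<epsilon> x \<noteq> 0 \<Longrightarrow> x \<in> Om"
  using cutoff_nonzero ebox_mono[of "2 * \<epsilon>" "5 * \<epsilon>"] \<epsilon> by (auto simp: Om_def)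

lemma coord_eq: "cutoff \<epsilon> x \<noteq> 0 \<Longrightarrow> coord i x = of_real (\<phi> x i)"
  using cutoff_nonzero[of x] bump_box by (simp add: coord_def)

text \<open>Hadamard's quotients exist only in the chart. Multiplying the equation by
  \<open>cutoff \<epsilon>\<close> turns them into global functions, and wherever this factor is
  nonzero \<open>coord\<close> agrees with the coordinates.\<close>

lemma Hadamard_on_manifold:
  assumes a: "a \<in> Cinf M" and x: "cutoff \<epsilon> x \<noteq> 0"
  shows "\<exists>b. (\<forall>i<n. b i \<in> Cinf M) \<and>
     (\<forall>y. cutoff \<epsilon> y * (a y - a x) = (\<Sum>i<n. (coord i y - coord i x) * b i y))"
proof -
  let ?A = "\<lambda>y. a (inv_into U \<phi> y)"
  have A: "Ck k n W ?A" for k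
  proof (rule Ck_subset[OF _ W_subset])
    have "smooth_fun M (points M) a" using a by (simp add: Cinf_iff[OF LM])
    from smooth_funD[OF this c] show "Ck k n (\<phi> ` U) ?A"
      using chart_subset[OF LM c] by (simp add: inf.absorb1)
  qed
  have xW: "\<phi> x \<in> W" using cutoff_nonzero_Om[OF x] by (simp add: Om_def)
  define b where "b i = (\<lambda>y. if y \<in> U then ray_integral (\<phi> x) 0 (partial_deriv i ?A) (\<phi> y) * of_real (bump n z \<epsilon> (\<phi> y)) else 0)" for i
  have "b i \<in> Cinf M" if "i < n" for i unfolding b_def
  proof (rule extension_Cinf)
    show "Ck k n W (ray_integral (\<phi> x) 0 (partial_deriv i ?A))" for k
      using Ck_SucD(2)[OF A that] by (rule Ck_ray_integral[OF xW])
  qed (use \<epsilon> in auto)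
  moreover have "cutoff \<epsilon> y * (a y - a x) = (\<Sum>i<n. (coord i y - coord i x) * b i y)" for y
  proof (cases "cutoff \<epsilon> y = 0")
    case True
    then have "b i y = 0" for i by (auto simp: b_def cutoff_def)
    then show ?thesis using True by simp
  next
    case False
    have y: "y \<in> U" "\<phi> y \<in> W" using cutoff_nonzero_Om[OF False] by (auto simp: Om_def)
    have xU: "x \<in> U" using cutoff_nonzero[OF x] by simp
    have "a y - a x = (\<Sum>i<n. (\<phi> y i - \<phi> x i) *\<^sub>R ray_integral (\<phi> x) 0 (partial_deriv i ?A) (\<phi> y))"
      using Hadamard[OF xW y(2) A] y xU chart_inv[OF LM c] by simp
    then show ?thesis
      using y(1) by (simp add: sum_distrib_left coord_eq[OF False] coord_eq[OF x] b_def scaleR_conv_of_real cutoff_def mult_ac)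
  qed
  ultimately show ?thesis by blast
qed

text \<open>The coordinate vector field in the base direction of the trivialization, cut off.\<close>

definition lift :: "nat \<Rightarrow> ('p \<Rightarrow> complex) \<Rightarrow> 'p \<Rightarrow> complex"
  where "lift i f = (\<lambda>u. if u \<in> pre Om
     then cutoff (2 * \<epsilon>) (p u) * partial_deriv i (\<lambda>y. f (h (inv_into U \<phi> y, snd (\<tau> u)))) (\<phi> (p u)) else 0)"

abbreviation "Q \<equiv> product_manifold (open_submanifold M U') GM"
abbreviation "PU \<equiv> open_submanifold P {u \<in> points P. p u \<in> U'}"

lemma pre_open: "openin (mtop M) A \<Longrightarrow> openin (mtop P) (pre A)"
  unfolding pre_def by (rule openin_continuous_map_preimage[OF smooth_mapD(2)[OF p]])

lemma LMU: "locally_euclidean (open_submanifold M U')"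
  by (rule locally_euclidean_open_submanifold[OF LM U'])

lemma LQ: "locally_euclidean Q" and LPU: "locally_euclidean PU"
  using pre_open[OF U']
  by (auto intro: locally_euclidean_product LMU LG locally_euclidean_open_submanifold LP simp: pre_def)

lemma U'_subset: "U' \<subseteq> points M" using U' openin_subset by blast

lemma points_Q: "points Q = U' \<times> points GM" using U'_subset by auto

lemma points_PU: "points PU = pre U'" by (auto simp: pre_def)

lemma h_closed: "x \<in> U' \<Longrightarrow> g \<in> points GM \<Longrightarrow> h (x, g) \<in> points P \<and> p (h (x, g)) \<in> U'"
  using smooth_mapD(2)[OF h] U'_subset by (auto simp: continuous_map_def Pi_iff)

lemma \<tau>_closed: "u \<in> pre U' \<Longrightarrow> snd (\<tau> u) \<in> points GM \<and> fst (\<tau> u) \<in> U'"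
  using smooth_mapD(2)[OF \<tau>] unfolding pre_def
  by (auto simp: continuous_map_def Pi_iff mem_Times_iff)

lemma chart_inter_in: "(U \<inter> U', \<phi>) \<in> charts (open_submanifold M U')"
  using c by (auto simp: charts_open_submanifold)

lemma inv_into_inter: "y \<in> \<phi> ` (U \<inter> U') \<Longrightarrow> inv_into (U \<inter> U') \<phi> y = inv_into U \<phi> y"
proof -
  assume "y \<in> \<phi> ` (U \<inter> U')"
  then obtain x where x: "x \<in> U" "x \<in> U'" "y = \<phi> x" by auto
  then show ?thesis using chart_inv[OF LM c x(1)] chart_inv[OF LMU chart_inter_in, of x] by simp
qed

lemma smooth_trivialized:
  assumes f: "f \<in> Cinf P" and V: "(V, \<gamma>) \<in> charts GM"
  shows "Ck k (n + mdim GM) (product_chart n \<phi> \<gamma> ` ((U \<inter> U') \<times> V))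
     (\<lambda>w. f (h (inv_into ((U \<inter> U') \<times> V) (product_chart n \<phi> \<gamma>) w)))"
proof -
  have o: "openin (mtop P) (pre U')" by (rule pre_open[OF U'])
  have "smooth_fun P (points P) f" using f by (simp add: Cinf_iff[OF LP])
  then have "smooth_fun P (pre U') f" by (rule smooth_fun_subset) (auto simp: pre_def)
  then have "smooth_fun PU (points PU) f"
    using smooth_fun_open_submanifold[OF LP _ o, of "{u \<in> points P. p u \<in> U'}" f] points_PU
    by (simp add: pre_def)
  from smooth_fun_smooth_map[OF LQ LPU h openin_topspace this]
  have "smooth_fun Q {x \<in> points Q. h x \<in> points PU} (\<lambda>x. f (h x))" .
  moreover have "{x \<in> points Q. h x \<in> points PU} = points Q"
    using h_closed unfolding points_Q points_PU pre_def by auto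
  ultimately have "smooth_fun Q (points Q) (\<lambda>x. f (h x))" by simp
  moreover have "((U \<inter> U') \<times> V, product_chart n \<phi> \<gamma>) \<in> charts Q"
    using chart_inter_in V by (auto simp: charts_product_manifold)
  moreover have "((U \<inter> U') \<times> V) \<inter> points Q = (U \<inter> U') \<times> V"
    unfolding points_Q using chart_subset[OF LG V] by auto
  ultimately show ?thesis using smooth_funD[of Q "points Q" "\<lambda>x. f (h x)"] by fastforce
qed

text \<open>Moving along a base coordinate with the group component fixed is moving along one of the
  first \<open>n\<close> coordinates of a product chart, where the partial derivative is jointly
  smooth.\<close>

lemma trivialized_partial:
  assumes f: "f \<in> Cinf P" and V: "(V, \<gamma>) \<in> charts GM" and x: "x \<in> U \<inter> U'" and g: "g \<in> V" and i: "i < n"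
  shows "((\<lambda>t. f (h (inv_into U \<phi> ((\<phi> x)(i := t)), g))) has_vector_derivative
    partial_deriv i (\<lambda>w. f (h (inv_into ((U \<inter> U') \<times> V) (product_chart n \<phi> \<gamma>) w))) (product_chart n \<phi> \<gamma> (x, g))) (at (\<phi> x i))"
proof -
  let ?pc = "product_chart n \<phi> \<gamma>"
  let ?k = "\<lambda>w. f (h (inv_into ((U \<inter> U') \<times> V) ?pc w))"
  let ?w = "?pc (x, g)"
  have w: "?w \<in> ?pc ` ((U \<inter> U') \<times> V)" using x g by auto
  have wi: "?w i = \<phi> x i" using i by (simp add: product_chart_def)
  have "((\<lambda>t. ?k (?w(i := t))) has_vector_derivative partial_deriv i ?k ?w) (at (?w i))"
    using i by (intro Ck_SucD(1)[OF smooth_trivialized[OF f V, where k="Suc 0"] _ w]) simp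
  then have d: "((\<lambda>t. ?k (?w(i := t))) has_vector_derivative partial_deriv i ?k ?w) (at (\<phi> x i))"
    unfolding wi .
  obtain S where S: "open S" "\<phi> x i \<in> S" "\<forall>t\<in>S. (\<phi> x)(i := t) \<in> \<phi> ` (U \<inter> U')"
    using line_open[OF chart_open_image[OF LM c U'] _ i, of "\<phi> x"] x by blast
  show ?thesis
  proof (rule has_vector_derivative_transform_within_open[OF d S(1,2)])
    fix t assume "t \<in> S"
    then have y: "(\<phi> x)(i := t) \<in> \<phi> ` (U \<inter> U')" using S by blast
    have "?w(i := t) = join n ((\<phi> x)(i := t)) (\<gamma> g)"
      using i by (auto simp: product_chart_def join_def)
    then have "inv_into ((U \<inter> U') \<times> V) ?pc (?w(i := t)) = (inv_into U \<phi> ((\<phi> x)(i := t)), g)"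
      using inv_into_product_chart[OF LMU LG chart_inter_in V _ , of "(\<phi> x)(i := t)" "\<gamma> g"] y g
        inv_into_inter[OF y] chart_inv[OF LG V g] by simp
    then show "?k (?w(i := t)) = f (h (inv_into U \<phi> ((\<phi> x)(i := t)), g))" by simp
  qed
qed

lemma trivialized_has_partial:
  assumes f: "f \<in> Cinf P" and x: "x \<in> U \<inter> U'" and g: "g \<in> points GM" and i: "i < n"
  shows "((\<lambda>t. f (h (inv_into U \<phi> ((\<phi> x)(i := t)), g))) has_vector_derivative
    partial_deriv i (\<lambda>y. f (h (inv_into U \<phi> y, g))) (\<phi> x)) (at (\<phi> x i))"
proof -
  obtain V \<gamma> where V: "(V, \<gamma>) \<in> charts GM" "g \<in> V" using chart_cover[OF LG g] .
  have "has_partial_deriv i (\<lambda>y. f (h (inv_into U \<phi> y, g))) (\<phi> x)"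
    using trivialized_partial[OF f V(1) x V(2) i] by (intro has_partial_derivI(1)[of "\<lambda>y. f (h (inv_into U \<phi> y, g))"])
  from has_partial_derivD[OF this] show ?thesis .
qed

text \<open>The formula refers to one base chart \<open>\<phi>\<close>, so smoothness is tested only
  in product charts formed with it. Letting the chart of the group vary, these cover everything over
  \<open>Om\<close>.\<close>

lemma smooth_lift_local:
  assumes f: "f \<in> Cinf P" and i: "i < n"
  shows "smooth_fun P (pre Om) (\<lambda>u. partial_deriv i (\<lambda>y. f (h (inv_into U \<phi> y, snd (\<tau> u)))) (\<phi> (p u)))"
proof -
  define dk where "dk = (\<lambda>q. partial_deriv i (\<lambda>y. f (h (inv_into U \<phi> y, snd q))) (\<phi> (fst q)))"
  define CH where "CH = {((U \<inter> U') \<times> V, product_chart n \<phi> \<gamma>) | V \<gamma>. (V, \<gamma>) \<in> charts GM}"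
  define B where "B = Om \<times> points GM"
  have CH: "CH \<subseteq> charts Q" using chart_inter_in unfolding CH_def charts_product_manifold by auto
  have "openin (mtop M) (Om \<inter> U')" using Om_open U' by blast
  moreover have "Om \<inter> U' = Om" using Om_subset by blast
  ultimately have "openin (subtopology (mtop M) U') Om" by (auto simp: openin_subtopology)
  then have B: "openin (mtop Q) B" by (simp add: B_def openin_prod_Times_iff)
  have "smooth_fun PU {u \<in> points PU. \<tau> u \<in> B \<inter> \<Union> (fst ` CH)} (\<lambda>u. dk (\<tau> u))"
  proof (rule smooth_fun_compose[OF LPU LQ smooth_mapD(2)[OF \<tau>] B CH])
    fix V' \<psi> j U1 \<phi>1 assume "(U1, \<phi>1) \<in> charts PU" "(V', \<psi>) \<in> CH" "j < mdim Q"
    then show "smooth_on (mdim PU) (\<phi>1 ` {x \<in> U1. \<tau> x \<in> V'}) (\<lambda>y. \<psi> (\<tau> (inv_into U1 \<phi>1 y)) j)"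
      using CH by (intro smooth_mapD(1)[OF \<tau>]) auto
  next
    fix V' \<psi> assume "(V', \<psi>) \<in> CH"
    then obtain V \<gamma> where V: "(V, \<gamma>) \<in> charts GM" "V' = (U \<inter> U') \<times> V" "\<psi> = product_chart n \<phi> \<gamma>"
      by (auto simp: CH_def)
    let ?k = "\<lambda>w. f (h (inv_into ((U \<inter> U') \<times> V) (product_chart n \<phi> \<gamma>) w))"
    have inV: "((U \<inter> U') \<times> V, \<psi>) \<in> charts Q" using \<open>(V', \<psi>) \<in> CH\<close> V CH by auto
    note o = chart_open_image[OF LQ inV B]
    have o': "openin (Euclidean_space (n + mdim GM)) (\<psi> ` (((U \<inter> U') \<times> V) \<inter> B))" using o by simp
    have "Ck k (n + mdim GM) (\<psi> ` (((U \<inter> U') \<times> V) \<inter> B)) (\<lambda>w. dk (inv_into ((U \<inter> U') \<times> V) \<psi> w))" for k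
    proof (rule Ck_cong[OF o'])
      have "Ck k (n + mdim GM) (\<psi> ` ((U \<inter> U') \<times> V)) (partial_deriv i ?k)"
        using Ck_SucD(2)[OF smooth_trivialized[OF f V(1), where k="Suc k"]] i V by simp
      then show "Ck k (n + mdim GM) (\<psi> ` (((U \<inter> U') \<times> V) \<inter> B)) (partial_deriv i ?k)"
        by (rule Ck_subset) auto
      fix w assume "w \<in> \<psi> ` (((U \<inter> U') \<times> V) \<inter> B)"
      then obtain x g where xg: "x \<in> U \<inter> U'" "g \<in> V" "w = \<psi> (x, g)" by auto
      have gP: "g \<in> points GM" using xg chart_subset[OF LG V(1)] by auto
      have "partial_deriv i ?k w = dk (x, g)"
        unfolding dk_def fst_conv snd_conv xg V(3)
        by (rule vector_derivative_unique_at[OF trivialized_partial[OF f V(1) xg(1,2) i] trivialized_has_partial[OF f xg(1) gP i]])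
      moreover have "inv_into ((U \<inter> U') \<times> V) \<psi> w = (x, g)"
        using chart_inv[OF LQ inV, of "(x, g)"] xg by simp
      ultimately show "partial_deriv i ?k w = dk (inv_into ((U \<inter> U') \<times> V) \<psi> w)" by simp
    qed
    then show "smooth_on (mdim Q) (\<psi> ` (V' \<inter> B)) (\<lambda>y. dk (inv_into V' \<psi> y))"
      unfolding V(2) smooth_on_iff_Ck by simp
  qed
  moreover have "{u \<in> points PU. \<tau> u \<in> B \<inter> \<Union> (fst ` CH)} = pre Om"
  proof -
    have "\<tau> u \<in> B \<inter> \<Union> (fst ` CH) \<longleftrightarrow> p u \<in> Om" if u: "u \<in> pre U'" for u
    proof -
      have t: "fst (\<tau> u) = p u" using u \<tau>p by (simp add: pre_def)
      obtain V \<gamma> where V: "(V, \<gamma>) \<in> charts GM" "snd (\<tau> u) \<in> V"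
        using chart_cover[OF LG] \<tau>_closed[OF u] by blast
      have "((U \<inter> U') \<times> V, product_chart n \<phi> \<gamma>) \<in> CH" using V unfolding CH_def by blast
      then show ?thesis using t V \<tau>_closed[OF u] Om_subset
        by (force simp: B_def mem_Times_iff)
    qed
    then show ?thesis unfolding points_PU using Om_subset by (auto simp: pre_def)
  qed
  ultimately have "smooth_fun PU (pre Om) (\<lambda>u. dk (\<tau> u))" by simp
  then have "smooth_fun P (pre Om) (\<lambda>u. dk (\<tau> u))"
    using smooth_fun_open_submanifold[OF LP _ pre_open[OF Om_open], of "{u \<in> points P. p u \<in> U'}"] Om_subset
    by (auto simp: pre_def)
  then show ?thesis
    by (rule smooth_fun_cong[OF LP pre_open[OF Om_open]]) (use \<tau>p Om_subset in \<open>auto simp: dk_def pre_def\<close>)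
qed

lemma lift_Cinf:
  assumes f: "f \<in> Cinf P" and i: "i < n"
  shows "lift i f \<in> Cinf P"
proof (rule Cinf_local[OF LP])
  show "lift i f u = 0" if "u \<notin> points P" for u using that by (auto simp: lift_def pre_def)
  fix u assume u: "u \<in> points P"
  show "\<exists>B. openin (mtop P) B \<and> u \<in> B \<and> smooth_fun P B (lift i f)"
  proof (cases "p u \<in> Om")
    case True
    have "pullback P p (cutoff (2 * \<epsilon>)) \<in> Cinf P"
      using \<epsilon> by (intro pullback_Cinf[OF LP LM p] cutoff_Cinf) auto
    then have "smooth_fun P (points P) (pullback P p (cutoff (2 * \<epsilon>)))" by (simp add: Cinf_iff[OF LP])
    then have "smooth_fun P (pre Om) (pullback P p (cutoff (2 * \<epsilon>)))"
      by (rule smooth_fun_subset) (auto simp: pre_def)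
    from smooth_fun_mult[OF LP pre_open[OF Om_open] this smooth_lift_local[OF f i]]
    have "smooth_fun P (pre Om) (lift i f)"
      by (rule smooth_fun_cong[OF LP pre_open[OF Om_open]]) (auto simp: lift_def pullback_def pre_def)
    then show ?thesis using True u pre_open[OF Om_open] by (auto simp: pre_def)
  next
    case False
    \<comment> \<open>Off \<open>Om\<close> the cutoff vanishes not only at the point but on this
      neighbourhood, the complement of a compact set.\<close>
    define B where "B = points M - {x \<in> U. \<phi> x \<in> K}"
    have B: "openin (mtop M) B" unfolding B_def
      using chart_compact_closed[OF M c K_compact] K_subset W_subset by (intro openin_diff) auto
    have "cutoff (2 * \<epsilon>) x = 0" if "x \<in> B" for x
      using that not_K[of "\<phi> x" "2 * \<epsilon>"] chart_zero[OF LM c] \<epsilon>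
      by (auto simp: B_def cutoff_def topspace_Euclidean_space)
    then have "smooth_fun P (pre B) (lift i f)"
      by (intro smooth_fun_cong[OF LP pre_open[OF B] smooth_fun_const[OF LP pre_open[OF B], of 0]])
        (auto simp: lift_def pre_def)
    moreover have "u \<in> pre B" using u False K_subset p_closed by (auto simp: pre_def B_def Om_def)
    ultimately show ?thesis using pre_open[OF B] by blast
  qed
qed

abbreviation "lp i f u \<equiv> partial_deriv i (\<lambda>y. f (h (inv_into U \<phi> y, snd (\<tau> u)))) (\<phi> (p u))"

lemma lp_derivative:
  assumes "f \<in> Cinf P" "u \<in> pre Om" "i < n"
  shows "((\<lambda>t. f (h (inv_into U \<phi> ((\<phi> (p u))(i := t)), snd (\<tau> u)))) has_vector_derivative lp i f u) (at (\<phi> (p u) i))"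
  using assms Om_subset \<tau>_closed[of u]
  by (intro trivialized_has_partial) (auto simp: pre_def)

lemma lift_derivation:
  assumes i: "i < n" shows "derivation P (lift i)"
proof -
  have add: "lp i (\<lambda>x. f x + g x) u = lp i f u + lp i g u"
    if "f \<in> Cinf P" "g \<in> Cinf P" "u \<in> pre Om" for f g u
    by (rule has_partial_derivI(2)[OF has_vector_derivative_add[OF lp_derivative[OF that(1,3) i] lp_derivative[OF that(2,3) i]]])
  have mult: "lp i (\<lambda>x. f x * g x) u = f u * lp i g u + lp i f u * g u"
    if "f \<in> Cinf P" "g \<in> Cinf P" "u \<in> pre Om" for f g u
  proof -
    \<comment> \<open>The product rule involves the values on the curve at its base parameter; the
      curve passes through \<open>u\<close> there.\<close>
    have u: "p u \<in> U" "h (p u, snd (\<tau> u)) = u"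
      using that(3) h\<tau>[of u] \<tau>p[of u] Om_subset by (auto simp: pre_def prod_eq_iff dest: subsetD) (metis prod.collapse subsetD)
    show ?thesis
      using has_partial_derivI(2)[OF has_vector_derivative_mult[OF lp_derivative[OF that(1,3) i] lp_derivative[OF that(2,3) i]]]
      by (simp add: u chart_inv[OF LM c])
  qed
  have scale: "lp i (\<lambda>x. a * f x) u = a * lp i f u" if "f \<in> Cinf P" "u \<in> pre Om" for f u a
    by (rule has_partial_derivI(2)[OF bounded_linear.has_vector_derivative[OF bounded_linear_mult_right lp_derivative[OF that i]]])
  show ?thesis
    unfolding derivation_def linear_op_def
    by (auto simp: lift_Cinf[OF _ i]) (auto simp: lift_def fun_eq_iff add mult scale algebra_simps)
qed

lemma p_h: "x \<in> U' \<Longrightarrow> g \<in> points GM \<Longrightarrow> p (h (x, g)) = x"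
  using \<tau>p[of "h (x, g)"] h_closed[of x g] \<tau>h[of x g] by simp

text \<open>Along the curve defining \<open>lift i\<close>, the base point moves in the
  \<open>i\<close>-th coordinate alone. Over the region where \<open>cutoff \<epsilon>\<close> is
  nonzero all larger bumps are 1, also for nearby parameters.\<close>

lemma lift_coord:
  assumes i: "i < n" and j: "j < n" and u: "u \<in> points P" and nz: "cutoff \<epsilon> (p u) \<noteq> 0"
  shows "lift i (pullback P p (coord j)) u = (if i = j then 1 else 0)"
proof -
  note b = cutoff_nonzero[OF nz]
  have uO: "u \<in> pre Om" using cutoff_nonzero_Om[OF nz] u by (simp add: pre_def)
  then have uU': "u \<in> pre U'" using Om_subset by (auto simp: pre_def)
  have g: "snd (\<tau> u) \<in> points GM" using \<tau>_closed[OF uU'] by simp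
  obtain S where S: "open S" "\<phi> (p u) i \<in> S" "\<forall>t\<in>S. (\<phi> (p u))(i := t) \<in> ebox n z (2 * \<epsilon>)"
    using line_open[OF openin_ebox b(2) i] by blast
  have "((\<lambda>t. complex_of_real (((\<phi> (p u))(i := t)) j)) has_vector_derivative (if i = j then 1 else 0)) (at (\<phi> (p u) i))"
    by (cases "i = j") (auto intro!: derivative_eq_intros has_vector_derivative_of_real)
  then have "((\<lambda>t. pullback P p (coord j) (h (inv_into U \<phi> ((\<phi> (p u))(i := t)), snd (\<tau> u)))) has_vector_derivative (if i = j then 1 else 0)) (at (\<phi> (p u) i))"
  proof (rule has_vector_derivative_transform_within_open[OF _ S(1,2)])
    fix t assume "t \<in> S"
    then have y: "(\<phi> (p u))(i := t) \<in> ebox n z (2 * \<epsilon>)" using S by blast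
    then have "(\<phi> (p u))(i := t) \<in> W" using ebox_mono[of "2 * \<epsilon>" "5 * \<epsilon>"] \<epsilon> by auto
    then obtain x where x: "x \<in> U" "x \<in> U'" "(\<phi> (p u))(i := t) = \<phi> x" using box by blast
    then have "inv_into U \<phi> ((\<phi> (p u))(i := t)) = x" using chart_inv[OF LM c] by simp
    then show "complex_of_real (((\<phi> (p u))(i := t)) j) =
      pullback P p (coord j) (h (inv_into U \<phi> ((\<phi> (p u))(i := t)), snd (\<tau> u)))"
      using x y h_closed[OF x(2) g] p_h[OF x(2) g] bump_box by (simp add: pullback_def coord_def)
  qed
  then have "lp i (pullback P p (coord j)) u = (if i = j then 1 else 0)"
    by (rule has_partial_derivI(2))
  moreover have "cutoff (2 * \<epsilon>) (p u) = 1" using b bump_box by (simp add: cutoff_def)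
  ultimately show ?thesis using uO by (simp add: lift_def)
qed

text \<open>In the trivialization \<open>g\<close> acts on the group component only, so it carries
  the curve through \<open>u\<close> in a base direction to the corresponding curve through
  \<open>r u g\<close>; the cutoff depends on the base point alone.\<close>

lemma lift_invariant:
  assumes i: "i < n" and g: "g \<in> carrier G" and f: "f \<in> Cinf P"
  shows "pullback P (\<lambda>u. r u g) (lift i f) = lift i (pullback P (\<lambda>u. r u g) f)"
proof
  fix u
  let ?rf = "pullback P (\<lambda>u. r u g) f"
  have g': "g \<in> points GM" using g carrier_G by simp
  have rg: "r u g \<in> points P" "p (r u g) = p u" if "u \<in> points P" for u
    using r_closed[OF that g'] pr[OF that g] by auto
  show "pullback P (\<lambda>u. r u g) (lift i f) u = lift i ?rf u"
  proof (cases "u \<in> pre Om")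
    case False
    then show ?thesis using rg by (auto simp: pullback_def lift_def pre_def)
  next
    case True
    then have u: "u \<in> points P" "p u \<in> Om" "p u \<in> U" "p u \<in> U'" using Om_subset by (auto simp: pre_def)
    have gu: "snd (\<tau> u) \<in> points GM" using \<tau>_closed[of u] u by (simp add: pre_def)
    have ru: "r u g \<in> pre Om" using rg u by (simp add: pre_def)
    have snd: "snd (\<tau> (r u g)) = snd (\<tau> u) \<otimes>\<^bsub>G\<^esub> g" using \<tau>r[OF u(1,4) g] by simp
    have hr: "?rf (h (x, snd (\<tau> u))) = f (h (x, snd (\<tau> (r u g))))" if x: "x \<in> U'" for x
    proof -
      let ?v = "h (x, snd (\<tau> u))"
      have v: "?v \<in> points P" "p ?v = x" using h_closed[OF x gu] p_h[OF x gu] by auto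
      have "\<tau> (r ?v g) = (x, snd (\<tau> (r u g)))"
        using \<tau>r[of ?v g] \<tau>h[OF x gu] v x g snd by simp
      then have "h (x, snd (\<tau> (r u g))) = r ?v g"
        using h\<tau>[of "r ?v g"] rg[OF v(1)] v x by simp
      then show ?thesis using v by (simp add: pullback_def)
    qed
    have "has_partial_deriv i (\<lambda>y. f (h (inv_into U \<phi> y, snd (\<tau> (r u g))))) (\<phi> (p u))"
      using has_partial_derivI(1)[OF lp_derivative[OF f ru i]] rg(2)[OF u(1)] by simp
    moreover have "f (h (inv_into U \<phi> y, snd (\<tau> (r u g)))) = ?rf (h (inv_into U \<phi> y, snd (\<tau> u)))"
      if "y \<in> \<phi> ` (U \<inter> U')" for y
      using that hr chart_inv[OF LM c] by auto
    moreover have "\<phi> (p u) \<in> \<phi> ` (U \<inter> U')" using u by blast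
    ultimately have "lp i ?rf u = lp i f (r u g)"
      using partial_deriv_transform(2)[OF chart_open_image[OF LM c U'] _ i, of "\<phi> (p u)"
        "\<lambda>y. f (h (inv_into U \<phi> y, snd (\<tau> (r u g))))" "\<lambda>y. ?rf (h (inv_into U \<phi> y, snd (\<tau> u)))"]
        rg(2)[OF u(1)] by simp
    then show ?thesis using True ru u rg by (simp add: lift_def pullback_def)
  qed
qed

end

text \<open>A patch is a coordinate system \<open>\<xi>\<close> on the open set where \<open>\<eta>\<close> does not vanish,
  together with an invariant horizontal lift \<open>X\<close> of its coordinate vector fields.\<close>

definition patch :: "'p manifold \<Rightarrow> 'm manifold \<Rightarrow> 'g monoid \<Rightarrow> ('p \<Rightarrow> 'g \<Rightarrow> 'p) \<Rightarrow> ('p \<Rightarrow> 'm) \<Rightarrow>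
    ('m \<Rightarrow> complex) \<Rightarrow> (nat \<Rightarrow> 'm \<Rightarrow> complex) \<Rightarrow> (nat \<Rightarrow> ('p \<Rightarrow> complex) \<Rightarrow> 'p \<Rightarrow> complex) \<Rightarrow> bool"
  where "patch P M G r p \<eta> \<xi> X \<longleftrightarrow> \<eta> \<in> Cinf M \<and>
    (\<forall>i<mdim M. \<xi> i \<in> Cinf M \<and> derivation P (X i) \<and>
       (\<forall>g\<in>carrier G. \<forall>f\<in>Cinf P. pullback P (\<lambda>u. r u g) (X i f) = X i (pullback P (\<lambda>u. r u g) f)) \<and>
       (\<forall>j<mdim M. \<forall>u\<in>points P. \<eta> (p u) \<noteq> 0 \<longrightarrow> X i (pullback P p (\<xi> j)) u = (if i = j then 1 else 0))) \<and>
    (\<forall>a\<in>Cinf M. \<forall>x. \<eta> x \<noteq> 0 \<longrightarrow> (\<exists>b. (\<forall>i<mdim M. b i \<in> Cinf M) \<and>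
       (\<forall>y. \<eta> y * (a y - a x) = (\<Sum>i<mdim M. (\<xi> i y - \<xi> i x) * b i y))))"

lemma principal_bundle_patch:
  assumes pb: "principal_bundle P M GM G r p" and x0: "x0 \<in> points M"
  obtains V \<eta> \<xi> X where "openin (mtop M) V" "x0 \<in> V" "\<And>x. x \<in> V \<Longrightarrow> \<eta> x = 1" "patch P M G r p \<eta> \<xi> X"
proof -
  have M: "smooth_manifold M" using pb by (simp add: principal_bundle_def)
  note LM = smooth_manifold_imp_locally_euclidean[OF M]
  obtain U' \<tau> where U': "openin (mtop M) U'" "x0 \<in> U'"
    and d: "diffeomorphism (open_submanifold P {u \<in> points P. p u \<in> U'}) (product_manifold (open_submanifold M U') GM) \<tau>"
    and \<tau>: "\<forall>u\<in>points P. p u \<in> U' \<longrightarrow> fst (\<tau> u) = p u \<and> (\<forall>g\<in>carrier G. \<tau> (r u g) = (fst (\<tau> u), snd (\<tau> u) \<otimes>\<^bsub>G\<^esub> g))"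
    using pb x0 unfolding principal_bundle_def by blast
  obtain h where h: "smooth_map (product_manifold (open_submanifold M U') GM) (open_submanifold P {u \<in> points P. p u \<in> U'}) h"
    "\<forall>x\<in>points (open_submanifold P {u \<in> points P. p u \<in> U'}). h (\<tau> x) = x"
    "\<forall>y\<in>points (product_manifold (open_submanifold M U') GM). \<tau> (h y) = y"
    using d unfolding diffeomorphism_def by blast
  obtain U \<phi> where ch: "(U, \<phi>) \<in> charts M" "x0 \<in> U" using chart_cover[OF LM x0] .
  obtain \<delta> where \<delta>: "\<delta> > 0" "ebox (mdim M) (\<phi> x0) \<delta> \<subseteq> \<phi> ` (U \<inter> U')"
    using openin_Euclidean_imp_ebox[OF chart_open_image[OF LM ch(1) U'(1)], of "\<phi> x0"] ch U' by blast
  have U'M: "U' \<subseteq> points M" using openin_subset[OF U'(1)] .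
  \<comment> \<open>The construction needs a box of five radii inside the one found in the
    chart.\<close>
  interpret local_trivialization P M GM G r p U' \<tau> h U \<phi> "\<phi> x0" "\<delta> / 5"
  proof unfold_locales
    show "\<And>u. u \<in> points P \<Longrightarrow> p u \<in> U' \<Longrightarrow> h (\<tau> u) = u" using h(2) by auto
    show "\<And>x g. x \<in> U' \<Longrightarrow> g \<in> points GM \<Longrightarrow> \<tau> (h (x, g)) = (x, g)" using h(3) U'M by auto
    show "\<And>u. u \<in> points P \<Longrightarrow> p u \<in> U' \<Longrightarrow> fst (\<tau> u) = p u"
      "\<And>u g. u \<in> points P \<Longrightarrow> p u \<in> U' \<Longrightarrow> g \<in> carrier G \<Longrightarrow> \<tau> (r u g) = (fst (\<tau> u), snd (\<tau> u) \<otimes>\<^bsub>G\<^esub> g)"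
      using \<tau> by blast+
    show "ebox (mdim M) (\<phi> x0) (5 * (\<delta> / 5)) \<subseteq> \<phi> ` (U \<inter> U')" using \<delta> by simp
  qed (use pb d h(1) U' ch \<delta> in \<open>auto simp: principal_bundle_def diffeomorphism_def\<close>)
  show ?thesis
  proof (rule that)
    let ?V = "{x \<in> U. \<phi> x \<in> ebox (mdim M) (\<phi> x0) (\<delta> / 5)}"
    show "openin (mtop M) ?V" by (rule chart_preimage_open[OF LM ch(1) openin_ebox])
    show "x0 \<in> ?V" using ch(2) \<delta>(1) chart_zero[OF LM ch(1) ch(2)] by (auto simp: ebox_def)
    show "cutoff (\<delta> / 5) x = 1" if "x \<in> ?V" for x
      using that \<delta>(1) by (auto simp: cutoff_def ebox_def less_imp_le intro!: bump_eq_1)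
    show "patch P M G r p (cutoff (\<delta> / 5)) coord lift"
      unfolding patch_def
      using cutoff_Cinf[of "\<delta> / 5"] \<delta>(1) coord_Cinf lift_derivation lift_invariant lift_coord Hadamard_on_manifold
      by simp
  qed
qed

section \<open>Differential operators\<close>

lemma linear_opD:
  assumes "linear_op X Y D"
  shows "f \<in> Cinf X \<Longrightarrow> D f \<in> Cinf Y"
    and "f \<in> Cinf X \<Longrightarrow> h \<in> Cinf X \<Longrightarrow> D (\<lambda>x. f x + h x) = (\<lambda>y. D f y + D h y)"
    and "f \<in> Cinf X \<Longrightarrow> D (\<lambda>x. c * f x) = (\<lambda>y. c * D f y)"
  using assms by (auto simp: linear_op_def)

lemma linear_op_zero:
  assumes "linear_op X Y D" "f \<in> Cinf X" shows "D (\<lambda>x. 0) = (\<lambda>y. 0)"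
  using linear_opD(3)[OF assms, of 0] by simp

lemma linear_op_diff:
  assumes D: "linear_op X Y D" and X: "locally_euclidean X" and f: "f \<in> Cinf X" "h \<in> Cinf X"
  shows "D (\<lambda>x. f x - h x) = (\<lambda>y. D f y - D h y)"
  using linear_opD(2)[OF D f(1) Cinf_scale[OF X f(2)], of "-1"] linear_opD(3)[OF D f(2), of "-1"] by simp

lemma linear_op_sum:
  assumes D: "linear_op X Y D" and X: "locally_euclidean X"
  shows "finite S \<Longrightarrow> (\<And>s. s \<in> S \<Longrightarrow> f s \<in> Cinf X) \<Longrightarrow> D (\<lambda>x. \<Sum>s\<in>S. f s x) = (\<lambda>y. \<Sum>s\<in>S. D (f s) y)"
proof (induction S rule: finite_induct)
  case empty
  then show ?case using linear_op_zero[OF D Cinf_zero[OF X]] by simp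
next
  case (insert s S)
  then show ?case using linear_opD(2)[OF D, of "f s" "\<lambda>x. \<Sum>s\<in>S. f s x"] Cinf_sum[OF X, of S f] by simp
qed

text \<open>Differential operators along \<open>q\<close> see \<open>q\<close> only through
  pullbacks of smooth functions, so smoothness of \<open>q\<close> is recorded in this form.\<close>

locale smooth_pullback =
  fixes X :: "'x manifold" and Y :: "'y manifold" and q :: "'y \<Rightarrow> 'x"
  assumes X: "locally_euclidean X" and Y: "locally_euclidean Y"
    and q: "h \<in> Cinf X \<Longrightarrow> pullback Y q h \<in> Cinf Y"
begin

lemma linear_op_cong:
  assumes "linear_op X Y D" "\<And>f. f \<in> Cinf X \<Longrightarrow> D f = D' f" shows "linear_op X Y D'"
  using assms Cinf_add[OF X] Cinf_scale[OF X] unfolding linear_op_def by auto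

lemma linear_op_zero_op: "linear_op X Y (\<lambda>f y. 0)"
  using Cinf_zero[OF Y] by (simp add: linear_op_def)

lemma diffop_lt_linear:
  assumes "diffop_lt X Y q k D" shows "linear_op X Y D"
proof (cases k)
  case 0
  then show ?thesis using assms linear_op_cong[OF linear_op_zero_op] by auto
qed (use assms in auto)

definition comm :: "('x \<Rightarrow> complex) \<Rightarrow> (('x \<Rightarrow> complex) \<Rightarrow> 'y \<Rightarrow> complex) \<Rightarrow> ('x \<Rightarrow> complex) \<Rightarrow> 'y \<Rightarrow> complex"
  where "comm h D = (\<lambda>f y. pullback Y q h y * D f y - D (\<lambda>x. h x * f x) y)"

lemma diffop_lt_Suc: "diffop_lt X Y q (Suc k) D \<longleftrightarrow> linear_op X Y D \<and> (\<forall>h\<in>Cinf X. diffop_lt X Y q k (comm h D))"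
  by (simp add: comm_def)

declare diffop_lt.simps(2) [simp del]

lemma diffop_lt_cong:
  "diffop_lt X Y q k D \<Longrightarrow> (\<And>f. f \<in> Cinf X \<Longrightarrow> D f = D' f) \<Longrightarrow> diffop_lt X Y q k D'"
proof (induction k arbitrary: D D')
  case (Suc k)
  have "diffop_lt X Y q k (comm h D')" if h: "h \<in> Cinf X" for h
  proof (rule Suc.IH)
    show "diffop_lt X Y q k (comm h D)" using Suc.prems(1) h by (simp add: diffop_lt_Suc)
    show "comm h D f = comm h D' f" if "f \<in> Cinf X" for f
      using Suc.prems(2) that Cinf_mult[OF X h that] by (simp add: comm_def)
  qed
  moreover have "linear_op X Y D'"
    using Suc.prems(1) by (intro linear_op_cong[OF _ Suc.prems(2)]) (auto simp: diffop_lt_Suc)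
  ultimately show ?case by (simp add: diffop_lt_Suc)
qed simp

lemma linear_op_add:
  assumes "linear_op X Y D" "linear_op X Y D'" shows "linear_op X Y (\<lambda>f y. D f y + D' f y)"
  using assms Cinf_add[OF Y] by (auto simp: linear_op_def algebra_simps)

lemma linear_op_mult_left:
  assumes "linear_op X Y D" "\<And>f. f \<in> Cinf Y \<Longrightarrow> (\<lambda>y. e y * f y) \<in> Cinf Y"
  shows "linear_op X Y (\<lambda>f y. e y * D f y)"
  using assms unfolding linear_op_def by (simp add: distrib_left mult.left_commute)

lemma diffop_lt_add:
  "diffop_lt X Y q k D \<Longrightarrow> diffop_lt X Y q k D' \<Longrightarrow> diffop_lt X Y q k (\<lambda>f y. D f y + D' f y)"
proof (induction k arbitrary: D D')
  case (Suc k)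
  have "comm h (\<lambda>f y. D f y + D' f y) = (\<lambda>f y. comm h D f y + comm h D' f y)" for h
    by (simp add: comm_def algebra_simps)
  then show ?case using Suc by (auto simp: diffop_lt_Suc linear_op_add)
qed simp

lemma diffop_lt_mult_left:
  assumes e: "\<And>f. f \<in> Cinf Y \<Longrightarrow> (\<lambda>y. e y * f y) \<in> Cinf Y"
  shows "diffop_lt X Y q k D \<Longrightarrow> diffop_lt X Y q k (\<lambda>f y. e y * D f y)"
proof (induction k arbitrary: D)
  case (Suc k)
  have "comm h (\<lambda>f y. e y * D f y) = (\<lambda>f y. e y * comm h D f y)" for h
    by (simp add: comm_def algebra_simps)
  then show ?case using Suc by (auto simp: diffop_lt_Suc linear_op_mult_left[OF _ e])
qed simp

lemma diffop_lt_scale: "diffop_lt X Y q k D \<Longrightarrow> diffop_lt X Y q k (\<lambda>f y. c * D f y)"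
  by (rule diffop_lt_mult_left) (rule Cinf_scale[OF Y])

lemma diffop_lt_diff:
  "diffop_lt X Y q k D \<Longrightarrow> diffop_lt X Y q k D' \<Longrightarrow> diffop_lt X Y q k (\<lambda>f y. D f y - D' f y)"
  using diffop_lt_add[of k D "\<lambda>f y. (-1) * D' f y"] diffop_lt_scale[of k D' "-1"] by simp

lemma diffop_lt_zero: "diffop_lt X Y q k (\<lambda>f y. 0)"
  by (induction k) (auto simp: diffop_lt_Suc linear_op_zero_op comm_def)

lemma diffop_lt_sum:
  "(\<And>s. s \<in> S \<Longrightarrow> diffop_lt X Y q k (D s)) \<Longrightarrow> diffop_lt X Y q k (\<lambda>f y. \<Sum>s\<in>S. D s f y)"
  by (induction S rule: infinite_finite_induct) (auto intro: diffop_lt_zero diffop_lt_add)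

lemma diffop_lt_Suc_mono: "diffop_lt X Y q k D \<Longrightarrow> diffop_lt X Y q (Suc k) D"
proof (induction k arbitrary: D)
  case 0
  then show ?case using diffop_lt_cong[OF diffop_lt_zero, of D "Suc 0"] by simp
next
  case (Suc k)
  then show ?case unfolding diffop_lt_Suc[of "Suc k"] using diffop_lt_linear
    by (auto simp: diffop_lt_Suc[of k])
qed

lemma diffop_lt_mono: "diffop_lt X Y q k D \<Longrightarrow> k \<le> l \<Longrightarrow> diffop_lt X Y q l D"
  by (induction l) (auto simp: le_Suc_eq intro: diffop_lt_Suc_mono)

lemma diffop_lt_pullback:
  assumes "\<And>y. y \<in> points Y \<Longrightarrow> q y \<in> points X"
  shows "diffop_lt X Y q 1 (pullback Y q)"
proof -
  have "linear_op X Y (pullback Y q)" using q by (auto simp: linear_op_def pullback_def)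
  moreover have "comm h (pullback Y q) f = (\<lambda>y. 0)" for h f
    by (auto simp: comm_def pullback_def)
  ultimately show ?thesis by (simp add: diffop_lt_Suc)
qed

text \<open>As \<open>e\<close> is 1 at \<open>q y\<close>, the commutator with \<open>e\<close> has
  the value \<open>D g y - D (e g) y = D g y\<close>. It has lower order and inherits the
  hypothesis, so the claim descends to order bound 0. This replaces any description of
  \<open>D\<close> in coordinates.\<close>

lemma diffop_lt_cutoff_vanish:
  assumes y: "y \<in> points Y" and e: "e \<in> Cinf X" "e (q y) = 1"
    and S: "S \<subseteq> Cinf X" "\<And>g. g \<in> S \<Longrightarrow> (\<lambda>x. e x * g x) \<in> S"
  shows "diffop_lt X Y q k D \<Longrightarrow> (\<And>g. g \<in> S \<Longrightarrow> D (\<lambda>x. e x * g x) y = 0) \<Longrightarrow> g \<in> S \<Longrightarrow> D g y = 0"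
proof (induction k arbitrary: D g)
  case 0
  then show ?case using S by auto
next
  case (Suc k)
  have "comm e D g y = 0"
  proof (rule Suc.IH[of "comm e D" g])
    show "diffop_lt X Y q k (comm e D)" using Suc.prems e by (simp add: diffop_lt_Suc)
    show "\<And>g. g \<in> S \<Longrightarrow> comm e D (\<lambda>x. e x * g x) y = 0"
      using Suc.prems(2) S(2) by (simp add: comm_def)
  qed (rule Suc.prems(3))
  then show ?case using Suc.prems y e by (simp add: comm_def pullback_def)
qed

text \<open>The difference \<open>f - g\<close> is killed by \<open>e\<close>. The functions killed
  by \<open>e\<close> are stable under multiplication by \<open>e\<close>, so the preceding descent
  applies to them, with \<open>e\<close> scaled to be 1 at \<open>q y\<close>.\<close>

lemma diffop_lt_local:
  assumes D: "diffop_lt X Y q k D" and y: "y \<in> points Y" and e: "e \<in> Cinf X" "e (q y) \<noteq> 0"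
    and fg: "f \<in> Cinf X" "g \<in> Cinf X" "\<And>x. e x \<noteq> 0 \<Longrightarrow> f x = g x"
  shows "D f y = D g y"
proof -
  let ?e = "\<lambda>x. (1 / e (q y)) * e x"
  let ?S = "{f \<in> Cinf X. (\<lambda>x. ?e x * f x) = (\<lambda>x. 0)}"
  have eC: "?e \<in> Cinf X" by (rule Cinf_scale[OF X e(1)])
  note L = diffop_lt_linear[OF D]
  have "D (\<lambda>x. f x - g x) y = 0"
  proof (rule diffop_lt_cutoff_vanish[OF y eC _ _ _ D, of ?S])
    show "(\<lambda>x. f x - g x) \<in> ?S" using fg Cinf_minus[OF X fg(1,2)] by (auto simp: fun_eq_iff)
    show "(\<lambda>x. ?e x * f x) \<in> ?S" if "f \<in> ?S" for f
    proof -
      have "(\<lambda>x. ?e x * f x) = (\<lambda>x. 0)" using that by blast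
      then show ?thesis using Cinf_zero[OF X] by simp
    qed
    show "D (\<lambda>x. ?e x * f x) y = 0" if "f \<in> ?S" for f
    proof -
      have "(\<lambda>x. ?e x * f x) = (\<lambda>x. 0)" using that by blast
      then show ?thesis using linear_op_zero[OF L fg(1)] by simp
    qed
  qed (use e in auto)
  then show ?thesis using linear_op_diff[OF L X fg(1,2)] by simp
qed

end

text \<open>The commutator of a composition is a sum of two compositions in which one factor is
  replaced by its commutator, so the induction is on the sum of the bounds. A function on
  \<open>X\<close> acts on the intermediate space through its pullback along
  \<open>q1\<close>.\<close>

lemma diffop_lt_compose:
  assumes "smooth_pullback X Y q1" "smooth_pullback Y Z q2" "smooth_pullback X Z (\<lambda>z. q1 (q2 z))"
    and q2: "\<And>z. z \<in> points Z \<Longrightarrow> q2 z \<in> points Y"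
  shows "diffop_lt X Y q1 k D \<Longrightarrow> diffop_lt Y Z q2 l D' \<Longrightarrow> diffop_lt X Z (\<lambda>z. q1 (q2 z)) (k + l) (\<lambda>f. D' (D f))"
proof (induction "k + l" arbitrary: k l D D')
  case 0
  interpret XY: smooth_pullback X Y q1 by fact
  show ?case using 0 XY.diffop_lt_linear[OF 0(2)] linear_opD(1)[OF XY.diffop_lt_linear[OF 0(2)]] by simp
next
  case (Suc s)
  interpret XY: smooth_pullback X Y q1 by fact
  interpret YZ: smooth_pullback Y Z q2 by fact
  interpret XZ: smooth_pullback X Z "\<lambda>z. q1 (q2 z)" by fact
  note L = XY.diffop_lt_linear[OF Suc.prems(1)] and L' = YZ.diffop_lt_linear[OF Suc.prems(2)]
  note DC = linear_opD(1)[OF L]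
  show ?case
  proof (cases "k = 0 \<or> l = 0")
    case True
    have "D' (D f) = (\<lambda>z. 0)" if "f \<in> Cinf X" for f
      using True
    proof
      assume "k = 0"
      then have "D f = (\<lambda>y. 0)" using Suc.prems(1) that by simp
      then show ?thesis using linear_op_zero[OF L' DC[OF that]] by simp
    next
      assume "l = 0"
      then show ?thesis using Suc.prems(2) DC[OF that] by simp
    qed
    then show ?thesis using XZ.diffop_lt_cong[OF XZ.diffop_lt_zero] by simp
  next
    case False
    then obtain k' l' where kl: "k = Suc k'" "l = Suc l'" by (meson not0_implies_Suc)
    have "diffop_lt X Z (\<lambda>z. q1 (q2 z)) (k' + l) (XZ.comm h (\<lambda>f. D' (D f)))" if h: "h \<in> Cinf X" for h
    proof (rule XZ.diffop_lt_cong)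
      have "diffop_lt X Z (\<lambda>z. q1 (q2 z)) (k' + l) (\<lambda>f. D' (XY.comm h D f))"
        using Suc.prems h kl Suc.hyps(2) by (intro Suc.hyps(1)) (auto simp: XY.diffop_lt_Suc)
      moreover have "diffop_lt X Z (\<lambda>z. q1 (q2 z)) (k' + l) (\<lambda>f. YZ.comm (pullback Y q1 h) D' (D f))"
      proof -
        have "diffop_lt X Z (\<lambda>z. q1 (q2 z)) (k + l') (\<lambda>f. YZ.comm (pullback Y q1 h) D' (D f))"
          using Suc.prems XY.q[OF h] kl Suc.hyps(2) by (intro Suc.hyps(1)) (auto simp: YZ.diffop_lt_Suc)
        then show ?thesis using kl by simp
      qed
      ultimately show "diffop_lt X Z (\<lambda>z. q1 (q2 z)) (k' + l)
          (\<lambda>f z. D' (XY.comm h D f) z + YZ.comm (pullback Y q1 h) D' (D f) z)"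
        by (rule XZ.diffop_lt_add)
      fix f assume f: "f \<in> Cinf X"
      have hD: "(\<lambda>y. pullback Y q1 h y * D f y) \<in> Cinf Y" by (rule Cinf_mult[OF XY.Y XY.q[OF h] DC[OF f]])
      have "D' (XY.comm h D f) = (\<lambda>z. D' (\<lambda>y. pullback Y q1 h y * D f y) z - D' (D (\<lambda>x. h x * f x)) z)"
        unfolding XY.comm_def by (rule linear_op_diff[OF L' XY.Y hD DC[OF Cinf_mult[OF XY.X h f]]])
      moreover have "pullback Z q2 (pullback Y q1 h) z = pullback Z (\<lambda>z. q1 (q2 z)) h z" for z
        using q2 by (simp add: pullback_def)
      ultimately show "(\<lambda>z. D' (XY.comm h D f) z + YZ.comm (pullback Y q1 h) D' (D f) z) = XZ.comm h (\<lambda>f. D' (D f)) f"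
        by (simp add: XZ.comm_def YZ.comm_def)
    qed
    moreover have "linear_op X Z (\<lambda>f. D' (D f))"
      using L L' unfolding linear_op_def by auto
    ultimately show ?thesis using kl by (simp add: XZ.diffop_lt_Suc)
  qed
qed

lemma smooth_pullback_id: "locally_euclidean X \<Longrightarrow> smooth_pullback X X (\<lambda>x. x)"
proof
  fix h :: "'a \<Rightarrow> complex" assume "locally_euclidean X" and h: "h \<in> Cinf X"
  have "pullback X (\<lambda>x. x) h = h" using Cinf_zero_outside[OF h] by (auto simp: pullback_def)
  then show "pullback X (\<lambda>x. x) h \<in> Cinf X" using h by simp
qed

lemma pullback_id: "h \<in> Cinf X \<Longrightarrow> pullback X (\<lambda>x. x) h = h"
  using Cinf_zero_outside[of h X] by (auto simp: pullback_def)

lemma diffop_lt_identity: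
  assumes X: "locally_euclidean X" shows "diffop_lt X X (\<lambda>x. x) 1 (\<lambda>f. f)"
proof -
  interpret smooth_pullback X X "\<lambda>x. x" by (rule smooth_pullback_id[OF X])
  show ?thesis by (simp add: diffop_lt_Suc comm_def linear_op_def pullback_id)
qed

lemma diffop_lt_multiplication:
  assumes X: "locally_euclidean X" and h: "h \<in> Cinf X" shows "diffop_lt X X (\<lambda>x. x) 1 (\<lambda>f x. h x * f x)"
proof -
  interpret smooth_pullback X X "\<lambda>x. x" by (rule smooth_pullback_id[OF X])
  show ?thesis by (rule diffop_lt_mult_left[OF Cinf_mult[OF X h] diffop_lt_identity[OF X]])
qed

lemma diffop_lt_derivation:
  assumes X: "locally_euclidean X" and D: "derivation X D" shows "diffop_lt X X (\<lambda>x. x) 2 D"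
proof -
  interpret smooth_pullback X X "\<lambda>x. x" by (rule smooth_pullback_id[OF X])
  have L: "linear_op X X D" using D by (simp add: derivation_def)
  have "diffop_lt X X (\<lambda>x. x) 1 (comm h D)" if h: "h \<in> Cinf X" for h
  proof (rule diffop_lt_cong)
    have "(\<lambda>x. (-1) * D h x) \<in> Cinf X" by (intro Cinf_scale[OF X] linear_opD(1)[OF L h])
    then show "diffop_lt X X (\<lambda>x. x) 1 (\<lambda>f x. ((-1) * D h x) * f x)"
      by (rule diffop_lt_multiplication[OF X])
    show "(\<lambda>x. ((-1) * D h x) * f x) = comm h D f" if "f \<in> Cinf X" for f
      using D h that by (simp add: derivation_def comm_def pullback_id)
  qed
  then show ?thesis using L by (simp add: diffop_lt_Suc numeral_2_eq_2)
qed

lemma diffop_lt_compose_right: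
  assumes "smooth_pullback X Y q" and "\<And>y. y \<in> points Y \<Longrightarrow> q y \<in> points X"
    and "diffop_lt X X (\<lambda>x. x) k D" "diffop_lt X Y q l D'"
  shows "diffop_lt X Y q (k + l) (\<lambda>f. D' (D f))"
  using diffop_lt_compose[OF smooth_pullback_id assms(1), of k D l D'] assms
  by (auto simp: smooth_pullback_def)

lemma diffop_lt_compose_left:
  assumes "smooth_pullback X Y q" and "diffop_lt X Y q k D" "diffop_lt Y Y (\<lambda>x. x) l D'"
  shows "diffop_lt X Y q (k + l) (\<lambda>f. D' (D f))"
  using diffop_lt_compose[OF assms(1) smooth_pullback_id, of k D l D'] assms
  by (auto simp: smooth_pullback_def)

section \<open>The homotopy operator\<close>

lemma factorial_telescope:
  "1 / fact N * c + 1 / fact (Suc N) * (a - (b + of_nat (Suc N) * c)) = 1 / fact (Suc N) * (a - b :: complex)"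
  using of_nat_neq_0[of N, where 'a=complex] by (simp add: field_simps del: of_nat_Suc)

locale principal =
  fixes P :: "'p manifold" and M :: "'m manifold" and GM :: "'g manifold" and G :: "'g monoid"
    and r :: "'p \<Rightarrow> 'g \<Rightarrow> 'p" and p :: "'p \<Rightarrow> 'm"
  assumes pb: "principal_bundle P M GM G r p"
begin

lemma P: "locally_euclidean P" and M: "locally_euclidean M" and GM: "locally_euclidean GM"
  and p: "smooth_map P M p" and carrier_G: "carrier G = points GM"
  and r: "smooth_map (product_manifold P GM) P (\<lambda>(u, g). r u g)"
  using pb by (auto simp: principal_bundle_def lie_group_def intro: smooth_manifold_imp_locally_euclidean)

lemma p_closed: "u \<in> points P \<Longrightarrow> p u \<in> points M"
  using p by (auto simp: smooth_map_def continuous_map_def)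

lemma r_closed: "u \<in> points P \<Longrightarrow> g \<in> carrier G \<Longrightarrow> r u g \<in> points P"
  using smooth_mapD(2)[OF r] carrier_G by (force simp: continuous_map_def Pi_iff)

lemma p_r: "u \<in> points P \<Longrightarrow> g \<in> carrier G \<Longrightarrow> p (r u g) = p u"
  using pb unfolding principal_bundle_def by blast

abbreviation "pb_p \<equiv> pullback P p"

abbreviation "tr g \<equiv> pullback P (\<lambda>u. r u g)"

lemma tr_Cinf: "g \<in> carrier G \<Longrightarrow> f \<in> Cinf P \<Longrightarrow> tr g f \<in> Cinf P"
  using pullback_action_Cinf[OF P GM r] carrier_G by simp

lemma pb_p_Cinf: "a \<in> Cinf M \<Longrightarrow> pb_p a \<in> Cinf P"
  by (rule pullback_Cinf[OF P M p])

sublocale pm: smooth_pullback M P p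
  by unfold_locales (auto intro: P M pb_p_Cinf)

sublocale pp: smooth_pullback P P "\<lambda>u. u"
  by (rule smooth_pullback_id[OF P])

sublocale mm: smooth_pullback M M "\<lambda>x. x"
  by (rule smooth_pullback_id[OF M])

definition rmul :: "('p \<Rightarrow> complex) \<Rightarrow> ('m \<Rightarrow> complex) \<Rightarrow> 'p \<Rightarrow> complex"
  where "rmul f a = (\<lambda>u. f u * pb_p a u)"

lemma pb_p_one: "pb_p (one_fun M) = one_fun P"
  using p_closed by (auto simp: pullback_def one_fun_def)

lemma rmul_one: "f \<in> Cinf P \<Longrightarrow> rmul f (one_fun M) = f"
  unfolding rmul_def pb_p_one using Cinf_zero_outside[of f P] by (auto simp: one_fun_def)

lemma one_mult: "a \<in> Cinf M \<Longrightarrow> (\<lambda>x. one_fun M x * a x) = a" "a \<in> Cinf M \<Longrightarrow> (\<lambda>x. a x * one_fun M x) = a"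
  using Cinf_zero_outside[of a M] by (auto simp: one_fun_def)

lemma one_rmul: "a \<in> Cinf M \<Longrightarrow> rmul (one_fun P) a = pb_p a"
  by (auto simp: rmul_def one_fun_def pullback_def)

lemma pb_p_mult: "pb_p (\<lambda>x. a x * b x) = (\<lambda>u. pb_p a u * pb_p b u)"
  by (auto simp: pullback_def)

lemma rmul_rmul: "rmul (rmul f a) b = rmul f (\<lambda>x. a x * b x)"
  by (auto simp: rmul_def pb_p_mult)

section \<open>Bidifferential operators and their commutators\<close>

type_synonym ('x, 'y) bop = "('x \<Rightarrow> complex) \<Rightarrow> ('y \<Rightarrow> complex) \<Rightarrow> 'x \<Rightarrow> complex"

definition bidiff :: "nat \<Rightarrow> nat \<Rightarrow> ('p, 'm) bop \<Rightarrow> bool"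
  where "bidiff k l B \<longleftrightarrow> (\<forall>a\<in>Cinf M. diffop_lt P P (\<lambda>u. u) k (\<lambda>f. B f a)) \<and>
    (\<forall>f\<in>Cinf P. diffop_lt M P p l (\<lambda>a. B f a))"

lemma bidiffD:
  "bidiff k l B \<Longrightarrow> a \<in> Cinf M \<Longrightarrow> diffop_lt P P (\<lambda>u. u) k (\<lambda>f. B f a)"
  "bidiff k l B \<Longrightarrow> f \<in> Cinf P \<Longrightarrow> diffop_lt M P p l (\<lambda>a. B f a)"
  by (auto simp: bidiff_def)

lemma bidiff_linear:
  assumes "bidiff k l B"
  shows "a \<in> Cinf M \<Longrightarrow> linear_op P P (\<lambda>f. B f a)" "f \<in> Cinf P \<Longrightarrow> linear_op M P (\<lambda>a. B f a)"
  using assms pp.diffop_lt_linear pm.diffop_lt_linear by (auto simp: bidiff_def)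

lemma bidiff_Cinf: "bidiff k l B \<Longrightarrow> f \<in> Cinf P \<Longrightarrow> a \<in> Cinf M \<Longrightarrow> B f a \<in> Cinf P"
  using linear_opD(1)[OF bidiff_linear(1)] by blast

lemma bidiff_mono: "bidiff k l B \<Longrightarrow> k \<le> k' \<Longrightarrow> l \<le> l' \<Longrightarrow> bidiff k' l' B"
  by (auto simp: bidiff_def intro: pp.diffop_lt_mono pm.diffop_lt_mono)

lemma bidiff_diff: "bidiff k l B \<Longrightarrow> bidiff k l B' \<Longrightarrow> bidiff k l (\<lambda>f a u. B f a u - B' f a u)"
  by (auto simp: bidiff_def intro: pp.diffop_lt_diff pm.diffop_lt_diff)

lemma bidiff_scale: "bidiff k l B \<Longrightarrow> bidiff k l (\<lambda>f a u. c * B f a u)"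
  by (auto simp: bidiff_def intro: pp.diffop_lt_scale pm.diffop_lt_scale)

lemma bidiff_sum: "(\<And>s. s \<in> S \<Longrightarrow> bidiff k l (B s)) \<Longrightarrow> bidiff k l (\<lambda>f a u. \<Sum>s\<in>S. B s f a u)"
  by (auto simp: bidiff_def intro: pp.diffop_lt_sum pm.diffop_lt_sum)

definition commL :: "('p \<Rightarrow> complex) \<Rightarrow> ('p, 'm) bop \<Rightarrow> ('p, 'm) bop"
  where "commL h B = (\<lambda>f a u. h u * B f a u - B (\<lambda>u. h u * f u) a u)"

definition commR :: "('m \<Rightarrow> complex) \<Rightarrow> ('p, 'm) bop \<Rightarrow> ('p, 'm) bop"
  where "commR h B = (\<lambda>f a u. pb_p h u * B f a u - B f (\<lambda>x. h x * a x) u)"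

lemma bidiff_commL:
  assumes "bidiff (Suc k) l B" "h \<in> Cinf P" shows "bidiff k l (commL h B)"
  unfolding bidiff_def
proof (intro conjI ballI)
  fix a assume "a \<in> Cinf M"
  then have "diffop_lt P P (\<lambda>u. u) k (pp.comm h (\<lambda>f. B f a))"
    using bidiffD(1)[OF assms(1)] assms(2) by (simp add: pp.diffop_lt_Suc)
  then show "diffop_lt P P (\<lambda>u. u) k (\<lambda>f. commL h B f a)"
    by (simp add: pp.comm_def commL_def pullback_id assms(2))
next
  fix f assume f: "f \<in> Cinf P"
  show "diffop_lt M P p l (commL h B f)"
    unfolding commL_def
    by (intro pm.diffop_lt_diff pm.diffop_lt_mult_left[OF Cinf_mult[OF P assms(2)]] bidiffD(2)[OF assms(1)] f Cinf_mult[OF P] assms)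
qed

lemma bidiff_commR:
  assumes "bidiff k (Suc l) B" "h \<in> Cinf M" shows "bidiff k l (commR h B)"
  unfolding bidiff_def
proof (intro conjI ballI)
  fix f assume "f \<in> Cinf P"
  then have "diffop_lt M P p l (pm.comm h (\<lambda>a. B f a))"
    using bidiffD(2)[OF assms(1)] assms(2) by (simp add: pm.diffop_lt_Suc)
  then show "diffop_lt M P p l (commR h B f)"
    by (simp add: pm.comm_def commR_def)
next
  fix a assume a: "a \<in> Cinf M"
  show "diffop_lt P P (\<lambda>u. u) k (\<lambda>f. commR h B f a)"
    unfolding commR_def
    by (intro pp.diffop_lt_diff pp.diffop_lt_mult_left[OF Cinf_mult[OF P pb_p_Cinf[OF assms(2)]]] bidiffD(1)[OF assms(1)] a Cinf_mult[OF M] assms)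
qed

text \<open>In coordinates, \<open>\<Delta> \<xi>\<^sub>i\<close> is multiplication of the symbol by the difference \<open>z\<^sub>i - y\<^sub>i\<close> of the
  variables of the two arguments; it is nilpotent on bidifferential operators.\<close>

definition \<Delta> :: "('m \<Rightarrow> complex) \<Rightarrow> ('p, 'm) bop \<Rightarrow> ('p, 'm) bop"
  where "\<Delta> \<xi> B = (\<lambda>f a u. B f (\<lambda>x. \<xi> x * a x) u - B (\<lambda>u. pb_p \<xi> u * f u) a u)"

lemma \<Delta>_eq_comm: "\<Delta> \<xi> B = (\<lambda>f a u. commL (pb_p \<xi>) B f a u - commR \<xi> B f a u)"
  by (auto simp: \<Delta>_def commL_def commR_def)

lemma bidiff_\<Delta>:
  assumes B: "bidiff k l B" and \<xi>: "\<xi> \<in> Cinf M" shows "bidiff k l (\<Delta> \<xi> B)"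
  unfolding \<Delta>_eq_comm
  by (intro bidiff_diff bidiff_commL bidiff_commR bidiff_mono[OF B] pb_p_Cinf \<xi>) auto

lemma \<Delta>_diff: "\<Delta> \<xi> (\<lambda>f a u. B f a u - B' f a u) = (\<lambda>f a u. \<Delta> \<xi> B f a u - \<Delta> \<xi> B' f a u)"
  by (auto simp: \<Delta>_def algebra_simps)

lemma \<Delta>_commute: "\<Delta> \<xi> (\<Delta> \<xi>' B) = \<Delta> \<xi>' (\<Delta> \<xi> B)"
  by (auto simp: \<Delta>_def algebra_simps)

lemma bidiff_\<Delta>_pow: "bidiff k l B \<Longrightarrow> \<xi> \<in> Cinf M \<Longrightarrow> bidiff k l ((\<Delta> \<xi> ^^ j) B)"
  by (induction j) (auto intro: bidiff_\<Delta>)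

lemma \<Delta>_pow_diff: "(\<Delta> \<xi> ^^ j) (\<lambda>f a u. B f a u - B' f a u) = (\<lambda>f a u. (\<Delta> \<xi> ^^ j) B f a u - (\<Delta> \<xi> ^^ j) B' f a u)"
  by (induction j) (auto simp: \<Delta>_diff)

lemma \<Delta>_pow_zero:
  assumes "\<xi> \<in> Cinf M" "\<And>f a. f \<in> Cinf P \<Longrightarrow> a \<in> Cinf M \<Longrightarrow> B f a = (\<lambda>u. 0)"
  shows "f \<in> Cinf P \<Longrightarrow> a \<in> Cinf M \<Longrightarrow> (\<Delta> \<xi> ^^ j) B f a = (\<lambda>u. 0)"
  using assms(1)
  by (induction j arbitrary: f a) (auto simp: assms(2) \<Delta>_def Cinf_mult[OF M] Cinf_mult[OF P] pb_p_Cinf)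

text \<open>\<open>\<Delta>\<close> is the difference of two commutators, each of which lowers one
  of the two order bounds by 1. After \<open>k + l\<close> applications every term of the expansion
  has run through a bound 0.\<close>

lemma \<Delta>_nilpotent:
  assumes \<xi>: "\<xi> \<in> Cinf M"
  shows "bidiff k l B \<Longrightarrow> k + l \<le> N \<Longrightarrow> f \<in> Cinf P \<Longrightarrow> a \<in> Cinf M \<Longrightarrow> (\<Delta> \<xi> ^^ N) B f a = (\<lambda>u. 0)"
proof (induction N arbitrary: k l B f a)
  case 0
  then show ?case by (simp add: bidiff_def)
next
  case (Suc N)
  show ?case
  proof (cases "k = 0 \<or> l = 0")
    case True
    then have "B f a = (\<lambda>u. 0)" if "f \<in> Cinf P" "a \<in> Cinf M" for f a
      using bidiffD[OF Suc.prems(1)] that by auto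
    then show ?thesis using \<Delta>_pow_zero[OF \<xi>] Suc.prems by blast
  next
    case False
    then obtain k' l' where kl: "k = Suc k'" "l = Suc l'" by (meson not0_implies_Suc)
    have "bidiff k' l (commL (pb_p \<xi>) B)" "bidiff k l' (commR \<xi> B)"
      using bidiff_commL bidiff_commR Suc.prems(1) \<xi> pb_p_Cinf kl by auto
    then have "(\<Delta> \<xi> ^^ N) (commL (pb_p \<xi>) B) f a = (\<lambda>u. 0)" "(\<Delta> \<xi> ^^ N) (commR \<xi> B) f a = (\<lambda>u. 0)"
      using Suc.IH[OF _ _ Suc.prems(3,4)] Suc.prems(2) kl by auto
    then show ?thesis
      unfolding funpow_Suc_right o_apply by (simp add: \<Delta>_eq_comm[of \<xi> B] \<Delta>_pow_diff)
  qed
qed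

text \<open>For a derivation \<open>X\<close> with \<open>X \<xi> = 1\<close>, this moves the dependence of \<open>f\<close> on the coordinate
  \<open>\<xi>\<close> to the second argument, by Taylor's formula.\<close>

definition transfer :: "nat \<Rightarrow> ('m \<Rightarrow> complex) \<Rightarrow> (('p \<Rightarrow> complex) \<Rightarrow> 'p \<Rightarrow> complex) \<Rightarrow> ('p, 'm) bop \<Rightarrow> ('p, 'm) bop"
  where "transfer N \<xi> X B = (\<lambda>f a u. \<Sum>k<N. 1 / fact k * (\<Delta> \<xi> ^^ k) B ((X ^^ k) f) a u)"

lemma derivation_pow_Cinf: "derivation P X \<Longrightarrow> f \<in> Cinf P \<Longrightarrow> (X ^^ k) f \<in> Cinf P"
  by (induction k) (auto simp: derivation_def linear_op_def)

lemma diffop_lt_derivation_pow: "derivation P X \<Longrightarrow> diffop_lt P P (\<lambda>u. u) (1 + 2 * k) (X ^^ k)"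
proof (induction k)
  case 0
  then show ?case using diffop_lt_identity[OF P] by (simp add: id_def)
next
  case (Suc k)
  have "diffop_lt P P (\<lambda>u. u) ((1 + 2 * k) + 2) (\<lambda>f. X ((X ^^ k) f))"
    by (rule diffop_lt_compose_left[OF pp.smooth_pullback_axioms]) (use Suc diffop_lt_derivation[OF P] in auto)
  then show ?case by (simp add: o_def)
qed

lemma bidiff_transfer:
  assumes B: "bidiff k l B" and X: "derivation P X" and \<xi>: "\<xi> \<in> Cinf M"
  shows "bidiff (k + 2 * N + 1) l (transfer N \<xi> X B)"
  unfolding transfer_def
proof (intro bidiff_sum bidiff_scale)
  fix j assume j: "j \<in> {..<N}"
  note B' = bidiff_\<Delta>_pow[OF B \<xi>, of j]
  show "bidiff (k + 2 * N + 1) l (\<lambda>f. (\<Delta> \<xi> ^^ j) B ((X ^^ j) f))"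
    unfolding bidiff_def
  proof (intro conjI ballI)
    fix a assume a: "a \<in> Cinf M"
    have "diffop_lt P P (\<lambda>u. u) ((1 + 2 * j) + k) (\<lambda>f. (\<Delta> \<xi> ^^ j) B ((X ^^ j) f) a)"
      by (rule diffop_lt_compose_right[OF pp.smooth_pullback_axioms _ diffop_lt_derivation_pow[OF X] bidiffD(1)[OF B' a]]) auto
    then show "diffop_lt P P (\<lambda>u. u) (k + 2 * N + 1) (\<lambda>f. (\<Delta> \<xi> ^^ j) B ((X ^^ j) f) a)"
      by (rule pp.diffop_lt_mono) (use j in auto)
  next
    fix f assume "f \<in> Cinf P"
    then show "diffop_lt M P p l (\<lambda>a. (\<Delta> \<xi> ^^ j) B ((X ^^ j) f) a)"
      by (intro bidiffD(2)[OF B'] derivation_pow_Cinf[OF X])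
  qed
qed

end

section \<open>Taylor's formula in one coordinate of a patch\<close>

locale principal_patch = principal P M GM G r p
  for P :: "'p manifold" and M :: "'m manifold" and GM :: "'g manifold" and G :: "'g monoid"
    and r :: "'p \<Rightarrow> 'g \<Rightarrow> 'p" and p :: "'p \<Rightarrow> 'm" +
  fixes \<eta> :: "'m \<Rightarrow> complex" and \<xi> :: "nat \<Rightarrow> 'm \<Rightarrow> complex" and X :: "nat \<Rightarrow> ('p \<Rightarrow> complex) \<Rightarrow> 'p \<Rightarrow> complex"
  assumes patch: "patch P M G r p \<eta> \<xi> X"
begin

definition "nz u \<longleftrightarrow> u \<in> points P \<and> \<eta> (p u) \<noteq> 0"

lemma \<eta>: "\<eta> \<in> Cinf M" and \<xi>: "i < mdim M \<Longrightarrow> \<xi> i \<in> Cinf M" and X: "i < mdim M \<Longrightarrow> derivation P (X i)"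
  using patch by (auto simp: patch_def)

lemma X_\<xi>: "i < mdim M \<Longrightarrow> j < mdim M \<Longrightarrow> nz u \<Longrightarrow> X i (pb_p (\<xi> j)) u = (if i = j then 1 else 0)"
  using patch by (auto simp: patch_def nz_def)

text \<open>The relations between \<open>X\<close> and \<open>\<xi>\<close> hold only where
  \<open>\<eta> (p u) \<noteq> 0\<close>; locality lets them be substituted underneath a
  differential operator there.\<close>

lemma nz_local:
  assumes D: "diffop_lt P P (\<lambda>u. u) k D" and u: "nz u"
    and fg: "f \<in> Cinf P" "g \<in> Cinf P" "\<And>v. nz v \<Longrightarrow> f v = g v"
  shows "D f u = D g u"
proof (rule pp.diffop_lt_local[OF D _ pb_p_Cinf[OF \<eta>] _ fg(1,2)])
  show "u \<in> points P" "pb_p \<eta> u \<noteq> 0" using u by (auto simp: nz_def pullback_def)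
  show "f v = g v" if "pb_p \<eta> v \<noteq> 0" for v
    using that by (intro fg(3)) (auto simp: nz_def pullback_def split: if_splits)
qed

text \<open>Leibniz' rule with \<open>X i\<close> applied to \<open>\<xi> j\<close> being 0 or 1.
  For \<open>k = 0\<close> the truncated exponent \<open>k - 1\<close> is harmless, as its term
  carries the factor \<open>k\<close>.\<close>

lemma X_pow_mult:
  assumes i: "i < mdim M" and j: "j < mdim M" and f: "f \<in> Cinf P"
  shows "nz u \<Longrightarrow> (X i ^^ k) (\<lambda>u. pb_p (\<xi> j) u * f u) u =
    pb_p (\<xi> j) u * (X i ^^ k) f u + (if i = j then of_nat k * (X i ^^ (k - 1)) f u else 0)"
proof (induction k arbitrary: u)
  case (Suc k)
  note D = X[OF i] and L = linear_opD[OF conjunct1[OF X[OF i, unfolded derivation_def]]]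
  note xi = pb_p_Cinf[OF \<xi>[OF j]]
  note C = derivation_pow_Cinf[OF D f]
  let ?c = "if i = j then of_nat k else (0::complex)"
  have m: "(\<lambda>u. pb_p (\<xi> j) u * (X i ^^ k) f u) \<in> Cinf P" "(\<lambda>u. ?c * (X i ^^ (k - 1)) f u) \<in> Cinf P"
    using C Cinf_mult[OF P xi] Cinf_scale[OF P] by auto
  have "(X i ^^ Suc k) (\<lambda>u. pb_p (\<xi> j) u * f u) u = X i ((X i ^^ k) (\<lambda>u. pb_p (\<xi> j) u * f u)) u" by simp
  also have "\<dots> = X i (\<lambda>u. pb_p (\<xi> j) u * (X i ^^ k) f u + ?c * (X i ^^ (k - 1)) f u) u"
  proof (rule nz_local[OF diffop_lt_derivation[OF P D] Suc.prems])
    show "(X i ^^ k) (\<lambda>u. pb_p (\<xi> j) u * f u) \<in> Cinf P"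
      by (intro derivation_pow_Cinf[OF D] Cinf_mult[OF P xi f])
  qed (use m Suc.IH in \<open>auto intro: Cinf_add[OF P]\<close>)
  also have "\<dots> = X i (\<lambda>u. pb_p (\<xi> j) u * (X i ^^ k) f u) u + ?c * X i ((X i ^^ (k - 1)) f) u"
    using L(2)[OF m] L(3)[OF C[of "k - 1"], of ?c] by simp
  also have "X i (\<lambda>u. pb_p (\<xi> j) u * (X i ^^ k) f u) u =
     X i (pb_p (\<xi> j)) u * (X i ^^ k) f u + pb_p (\<xi> j) u * X i ((X i ^^ k) f) u"
    using D xi C[of k] by (simp add: derivation_def)
  also have "?c * X i ((X i ^^ (k - 1)) f) u = ?c * (X i ^^ k) f u"
    by (cases k) auto
  finally show ?case using X_\<xi>[OF i j Suc.prems] by (auto simp: algebra_simps)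
qed simp

text \<open>By Leibniz' rule consecutive Taylor terms cancel under \<open>\<Delta>\<close>, leaving
  only the remainder. Its power of \<open>\<Delta>\<close> makes it vanish once \<open>N\<close>
  reaches the nilpotency bound.\<close>

lemma transfer_\<Delta>_self:
  assumes i: "i < mdim M" and B: "bidiff k l B" and f: "f \<in> Cinf P" and a: "a \<in> Cinf M" and u: "nz u"
  shows "\<Delta> (\<xi> i) (transfer (Suc N) (\<xi> i) (X i) B) f a u =
    1 / fact N * (\<Delta> (\<xi> i) ^^ Suc N) B ((X i ^^ N) f) a u"
proof -
  note D = X[OF i] and xi = pb_p_Cinf[OF \<xi>[OF i]]
  note C = derivation_pow_Cinf[OF D f]
  let ?D = "\<lambda>j. (\<Delta> (\<xi> i) ^^ j) B"
  have step: "?D j ((X i ^^ j) (\<lambda>u. pb_p (\<xi> i) u * f u)) a u =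
     ?D j (\<lambda>u. pb_p (\<xi> i) u * (X i ^^ j) f u) a u + of_nat j * ?D j ((X i ^^ (j - 1)) f) a u" for j
  proof -
    note B' = bidiff_\<Delta>_pow[OF B \<xi>[OF i], of j]
    note L = linear_opD[OF bidiff_linear(1)[OF B' a]]
    have m: "(\<lambda>u. pb_p (\<xi> i) u * (X i ^^ j) f u) \<in> Cinf P" "(\<lambda>u. of_nat j * (X i ^^ (j - 1)) f u) \<in> Cinf P"
      using C Cinf_mult[OF P xi] Cinf_scale[OF P] by auto
    have "?D j ((X i ^^ j) (\<lambda>u. pb_p (\<xi> i) u * f u)) a u =
       ?D j (\<lambda>u. pb_p (\<xi> i) u * (X i ^^ j) f u + of_nat j * (X i ^^ (j - 1)) f u) a u"
    proof (rule nz_local[OF bidiffD(1)[OF B' a] u])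
      show "(X i ^^ j) (\<lambda>u. pb_p (\<xi> i) u * f u) \<in> Cinf P"
        by (intro derivation_pow_Cinf[OF D] Cinf_mult[OF P xi f])
    qed (use m X_pow_mult[OF i i f] in \<open>auto intro: Cinf_add[OF P]\<close>)
    then show ?thesis using L(2)[OF m] L(3)[OF C[of "j - 1"], of "of_nat j"] by simp
  qed
  show ?thesis
  proof (induction N)
    case 0
    then show ?case by (simp add: transfer_def \<Delta>_def)
  next
    case (Suc N)
    have "\<Delta> (\<xi> i) (transfer (Suc (Suc N)) (\<xi> i) (X i) B) f a u =
       \<Delta> (\<xi> i) (transfer (Suc N) (\<xi> i) (X i) B) f a u +
       1 / fact (Suc N) * (?D (Suc N) ((X i ^^ Suc N) f) (\<lambda>x. \<xi> i x * a x) u -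
          ?D (Suc N) ((X i ^^ Suc N) (\<lambda>u. pb_p (\<xi> i) u * f u)) a u)"
      unfolding transfer_def \<Delta>_def[of "\<xi> i" "\<lambda>f a u. \<Sum>k<_. _ f a u k"] by (simp add: \<Delta>_def algebra_simps del: funpow.simps)
    also have "\<dots> = 1 / fact (Suc N) * (?D (Suc N) ((X i ^^ Suc N) f) (\<lambda>x. \<xi> i x * a x) u -
        ?D (Suc N) (\<lambda>u. pb_p (\<xi> i) u * (X i ^^ Suc N) f u) a u)"
      unfolding Suc.IH step diff_Suc_1 by (rule factorial_telescope)
    also have "\<dots> = 1 / fact (Suc N) * ?D (Suc (Suc N)) ((X i ^^ Suc N) f) a u"
      unfolding funpow.simps(2)[of "Suc N" "\<Delta> (\<xi> i)"] o_apply \<Delta>_def[of "\<xi> i" "?D (Suc N)"] ..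
    finally show ?case .
  qed
qed

end

section \<open>Taylor's formula in all coordinates, one after the other\<close>

context principal
begin

lemma \<Delta>_pow_commute: "\<Delta> \<xi>' ((\<Delta> \<xi> ^^ k) B) = (\<Delta> \<xi> ^^ k) (\<Delta> \<xi>' B)"
  by (induction k arbitrary: B) (auto simp: \<Delta>_commute[of \<xi>' \<xi>])

text \<open>With \<open>Suc (fuse_order k l j + l)\<close> Taylor terms the remainder contains a
  power of \<open>\<Delta>\<close> beyond the nilpotency bound for the orders reached so far; the
  recursion is the resulting order bound of \<open>transfer\<close>. The patch does not
  enter.\<close>

primrec fuse_order :: "nat \<Rightarrow> nat \<Rightarrow> nat \<Rightarrow> nat"
  where "fuse_order k l 0 = k"
  | "fuse_order k l (Suc j) = fuse_order k l j + 2 * Suc (fuse_order k l j + l) + 1"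

text \<open>Clearing the coordinates in turn produces an operator that no longer distinguishes a
  base function multiplied to \<open>f\<close> from one multiplied to \<open>a\<close>.\<close>

primrec fuse :: "nat \<Rightarrow> nat \<Rightarrow> (nat \<Rightarrow> 'm \<Rightarrow> complex) \<Rightarrow> (nat \<Rightarrow> ('p \<Rightarrow> complex) \<Rightarrow> 'p \<Rightarrow> complex) \<Rightarrow> nat \<Rightarrow> ('p, 'm) bop \<Rightarrow> ('p, 'm) bop"
  where "fuse k l \<xi> X 0 B = B"
  | "fuse k l \<xi> X (Suc j) B = transfer (Suc (fuse_order k l j + l)) (\<xi> j) (X j) (fuse k l \<xi> X j B)"

subsection \<open>Finite sums of evaluations\<close>

text \<open>The value of the operations above at \<open>f\<close> is a finite combination of values \<open>B g (b a)\<close>, where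
  \<open>g\<close> and \<open>b\<close> do not depend on \<open>B\<close> and \<open>a\<close>. This gives all the naturality in \<open>B\<close> that is needed.\<close>

definition tensorial :: "(('p, 'm) bop \<Rightarrow> ('m \<Rightarrow> complex) \<Rightarrow> 'p \<Rightarrow> complex) \<Rightarrow> bool"
  where "tensorial \<Phi> \<longleftrightarrow> (\<exists>L. (\<forall>(c, g, b)\<in>set L. g \<in> Cinf P \<and> b \<in> Cinf M) \<and>
    (\<forall>B. \<forall>a\<in>Cinf M. \<forall>u. \<Phi> B a u = (\<Sum>(c, g, b)\<leftarrow>L. c * B g (\<lambda>x. b x * a x) u)))"

lemma tensorialI:
  "(\<And>c g b. (c, g, b) \<in> set L \<Longrightarrow> g \<in> Cinf P \<and> b \<in> Cinf M) \<Longrightarrow>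
   (\<And>B a u. a \<in> Cinf M \<Longrightarrow> \<Phi> B a u = (\<Sum>(c, g, b)\<leftarrow>L. c * B g (\<lambda>x. b x * a x) u)) \<Longrightarrow> tensorial \<Phi>"
  unfolding tensorial_def by (intro exI[of _ L]) auto

lemma tensorial_eq:
  assumes "tensorial \<Psi>" and "\<And>B a u. a \<in> Cinf M \<Longrightarrow> \<Phi> B a u = \<Psi> B a u" shows "tensorial \<Phi>"
proof -
  obtain L where "\<forall>(c, g, b)\<in>set L. g \<in> Cinf P \<and> b \<in> Cinf M"
    "\<forall>B. \<forall>a\<in>Cinf M. \<forall>u. \<Psi> B a u = (\<Sum>(c, g, b)\<leftarrow>L. c * B g (\<lambda>x. b x * a x) u)"
    using assms(1) unfolding tensorial_def by blast
  then show ?thesis by (intro tensorialI[of L]) (use assms(2) in auto)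
qed

lemma tensorial_eval: "g \<in> Cinf P \<Longrightarrow> tensorial (\<lambda>B a. B g a)"
  by (rule tensorialI[of "[(1, g, one_fun M)]"]) (auto simp: Cinf_one[OF M] one_mult)

lemma tensorial_zero: "tensorial (\<lambda>B a u. 0)"
  by (rule tensorialI[of "[]"]) auto

lemma tensorial_add:
  assumes "tensorial \<Phi>" "tensorial \<Psi>" shows "tensorial (\<lambda>B a u. \<Phi> B a u + \<Psi> B a u)"
proof -
  obtain L where "\<forall>(c, g, b)\<in>set L. g \<in> Cinf P \<and> b \<in> Cinf M"
    "\<forall>B. \<forall>a\<in>Cinf M. \<forall>u. \<Phi> B a u = (\<Sum>(c, g, b)\<leftarrow>L. c * B g (\<lambda>x. b x * a x) u)"
    using assms(1) unfolding tensorial_def by blast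
  moreover obtain L' where "\<forall>(c, g, b)\<in>set L'. g \<in> Cinf P \<and> b \<in> Cinf M"
    "\<forall>B. \<forall>a\<in>Cinf M. \<forall>u. \<Psi> B a u = (\<Sum>(c, g, b)\<leftarrow>L'. c * B g (\<lambda>x. b x * a x) u)"
    using assms(2) unfolding tensorial_def by blast
  ultimately show ?thesis by (intro tensorialI[of "L @ L'"]) auto
qed

lemma tensorial_scale:
  assumes "tensorial \<Phi>" shows "tensorial (\<lambda>B a u. c * \<Phi> B a u)"
proof -
  obtain L where L: "\<forall>(c, g, b)\<in>set L. g \<in> Cinf P \<and> b \<in> Cinf M"
    "\<forall>B. \<forall>a\<in>Cinf M. \<forall>u. \<Phi> B a u = (\<Sum>(c, g, b)\<leftarrow>L. c * B g (\<lambda>x. b x * a x) u)"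
    using assms(1) unfolding tensorial_def by blast
  show ?thesis
  proof (rule tensorialI[of "map (\<lambda>(d, g, b). (c * d, g, b)) L"])
    show "g \<in> Cinf P \<and> b \<in> Cinf M" if "(d, g, b) \<in> set (map (\<lambda>(d, g, b). (c * d, g, b)) L)" for d g b
      using that L(1) by auto
    show "c * \<Phi> B a u = (\<Sum>(c, g, b)\<leftarrow>map (\<lambda>(d, g, b). (c * d, g, b)) L. c * B g (\<lambda>x. b x * a x) u)"
      if "a \<in> Cinf M" for B a u
      using L(2) that by (simp add: sum_list_const_mult[symmetric] o_def case_prod_beta mult.assoc)
  qed
qed

lemma tensorial_diff: "tensorial \<Phi> \<Longrightarrow> tensorial \<Psi> \<Longrightarrow> tensorial (\<lambda>B a u. \<Phi> B a u - \<Psi> B a u)"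
  using tensorial_add[of \<Phi> "\<lambda>B a u. (-1) * \<Psi> B a u"] tensorial_scale[of \<Psi> "-1"] by simp

lemma tensorial_sum: "(\<And>s. s \<in> S \<Longrightarrow> tensorial (\<Phi> s)) \<Longrightarrow> tensorial (\<lambda>B a u. \<Sum>s\<in>S. \<Phi> s B a u)"
  by (induction S rule: infinite_finite_induct) (auto intro: tensorial_zero tensorial_add)

lemma tensorial_mult_right:
  assumes "tensorial \<Phi>" and h: "h \<in> Cinf M" shows "tensorial (\<lambda>B a. \<Phi> B (\<lambda>x. h x * a x))"
proof -
  obtain L where L: "\<forall>(c, g, b)\<in>set L. g \<in> Cinf P \<and> b \<in> Cinf M"
    "\<forall>B. \<forall>a\<in>Cinf M. \<forall>u. \<Phi> B a u = (\<Sum>(c, g, b)\<leftarrow>L. c * B g (\<lambda>x. b x * a x) u)"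
    using assms(1) unfolding tensorial_def by blast
  show ?thesis
  proof (rule tensorialI[of "map (\<lambda>(d, g, b). (d, g, \<lambda>x. b x * h x)) L"])
    show "g \<in> Cinf P \<and> b \<in> Cinf M" if "(d, g, b) \<in> set (map (\<lambda>(d, g, b). (d, g, \<lambda>x. b x * h x)) L)" for d g b
      using that L(1) by (auto intro: Cinf_mult[OF M _ h])
    show "\<Phi> B (\<lambda>x. h x * a x) u = (\<Sum>(c, g, b)\<leftarrow>map (\<lambda>(d, g, b). (d, g, \<lambda>x. b x * h x)) L. c * B g (\<lambda>x. b x * a x) u)"
      if "a \<in> Cinf M" for B a u
      using L(2) Cinf_mult[OF M h that] by (simp add: o_def split_def mult.assoc)
  qed
qed

lemma tensorial_subst:
  assumes "tensorial \<Phi>" and \<Psi>: "\<And>g. g \<in> Cinf P \<Longrightarrow> tensorial (\<lambda>B. \<Psi> B g)" shows "tensorial (\<lambda>B. \<Phi> (\<Psi> B))"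
proof -
  obtain L where L: "\<forall>(c, g, b)\<in>set L. g \<in> Cinf P \<and> b \<in> Cinf M"
    "\<forall>B. \<forall>a\<in>Cinf M. \<forall>u. \<Phi> B a u = (\<Sum>(c, g, b)\<leftarrow>L. c * B g (\<lambda>x. b x * a x) u)"
    using assms(1) unfolding tensorial_def by blast
  have "tensorial (\<lambda>B a u. \<Sum>(c, g, b)\<leftarrow>L. c * \<Psi> B g (\<lambda>x. b x * a x) u)"
    using L(1)
  proof (induction L)
    case (Cons s L)
    obtain c g b where s: "s = (c, g, b)" by (cases s)
    have "tensorial (\<lambda>B a u. c * \<Psi> B g (\<lambda>x. b x * a x) u)"
      using Cons.prems s by (intro tensorial_scale tensorial_mult_right[OF \<Psi>]) auto
    then show ?case using Cons s by (auto intro: tensorial_add)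
  qed (simp add: tensorial_zero)
  then show ?thesis
    by (rule tensorial_eq) (use L(2) in auto)
qed

lemma tensorial_\<Delta>_pow:
  assumes \<xi>: "\<xi> \<in> Cinf M" shows "f \<in> Cinf P \<Longrightarrow> tensorial (\<lambda>B. (\<Delta> \<xi> ^^ j) B f)"
proof (induction j arbitrary: f)
  case (Suc j)
  have "tensorial (\<lambda>B a u. (\<Delta> \<xi> ^^ j) B f (\<lambda>x. \<xi> x * a x) u - (\<Delta> \<xi> ^^ j) B (\<lambda>u. pb_p \<xi> u * f u) a u)"
    by (intro tensorial_diff tensorial_mult_right[OF Suc.IH[OF Suc.prems] \<xi>] Suc.IH Cinf_mult[OF P] pb_p_Cinf \<xi> Suc.prems)
  then show ?case
    by (rule tensorial_eq) (simp add: \<Delta>_def[of \<xi> "(\<Delta> \<xi> ^^ j) _"])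
qed (simp add: tensorial_eval)

lemma tensorial_transfer:
  assumes "\<xi> \<in> Cinf M" "derivation P X" "f \<in> Cinf P" shows "tensorial (\<lambda>B. transfer N \<xi> X B f)"
  unfolding transfer_def by (intro tensorial_sum tensorial_scale tensorial_\<Delta>_pow derivation_pow_Cinf assms)

lemma tensorial_fuse:
  assumes "\<And>i. i < j \<Longrightarrow> \<xi> i \<in> Cinf M \<and> derivation P (X i)"
  shows "f \<in> Cinf P \<Longrightarrow> tensorial (\<lambda>B. fuse k l \<xi> X j B f)"
  using assms
proof (induction j arbitrary: f)
  case (Suc j)
  have "tensorial (\<lambda>B. transfer (Suc (fuse_order k l j + l)) (\<xi> j) (X j) B f)"
    using Suc.prems by (intro tensorial_transfer) auto
  then show ?case
    using tensorial_subst[of "\<lambda>B. transfer (Suc (fuse_order k l j + l)) (\<xi> j) (X j) B f" "fuse k l \<xi> X j"] Suc by simp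
qed (simp add: tensorial_eval)

context
  fixes \<Phi> :: "('p, 'm) bop \<Rightarrow> ('m \<Rightarrow> complex) \<Rightarrow> 'p \<Rightarrow> complex"
  assumes \<Phi>: "tensorial \<Phi>"
begin

lemma tensorialE:
  obtains L where "\<And>c g b. (c, g, b) \<in> set L \<Longrightarrow> g \<in> Cinf P" "\<And>c g b. (c, g, b) \<in> set L \<Longrightarrow> b \<in> Cinf M"
    "\<And>B a u. a \<in> Cinf M \<Longrightarrow> \<Phi> B a u = (\<Sum>(c, g, b)\<leftarrow>L. c * B g (\<lambda>x. b x * a x) u)"
  using \<Phi> unfolding tensorial_def by (fastforce simp: case_prod_beta)

lemma tensorial_linear:
  assumes "a \<in> Cinf M"
  shows "\<Phi> (\<lambda>f a u. B f a u + B' f a u) a u = \<Phi> B a u + \<Phi> B' a u"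
    and "\<Phi> (\<lambda>f a u. e u * B f a u) a u = e u * \<Phi> B a u"
proof -
  obtain L where L: "\<And>B a u. a \<in> Cinf M \<Longrightarrow> \<Phi> B a u = (\<Sum>(c, g, b)\<leftarrow>L. c * B g (\<lambda>x. b x * a x) u)"
    by (rule tensorialE) blast
  show "\<Phi> (\<lambda>f a u. B f a u + B' f a u) a u = \<Phi> B a u + \<Phi> B' a u"
    unfolding L[OF assms] by (induction L) (auto simp: algebra_simps)
  show "\<Phi> (\<lambda>f a u. e u * B f a u) a u = e u * \<Phi> B a u"
    unfolding L[OF assms] by (induction L) (auto simp: algebra_simps)
qed

lemma tensorial_cong:
  assumes "a \<in> Cinf M" and "\<And>f a. f \<in> Cinf P \<Longrightarrow> a \<in> Cinf M \<Longrightarrow> B f a u = B' f a u"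
  shows "\<Phi> B a u = \<Phi> B' a u"
proof -
  obtain L where L: "\<And>c g b. (c, g, b) \<in> set L \<Longrightarrow> g \<in> Cinf P" "\<And>c g b. (c, g, b) \<in> set L \<Longrightarrow> b \<in> Cinf M"
    "\<And>B a u. a \<in> Cinf M \<Longrightarrow> \<Phi> B a u = (\<Sum>(c, g, b)\<leftarrow>L. c * B g (\<lambda>x. b x * a x) u)"
    by (rule tensorialE) blast
  show ?thesis unfolding L(3)[OF assms(1)]
    by (intro arg_cong[where f=sum_list] map_cong refl) (use L(1,2) assms Cinf_mult[OF M] in auto)
qed

lemma tensorial_mult_argument:
  assumes "a \<in> Cinf M" "b \<in> Cinf M"
  shows "\<Phi> (\<lambda>f a. B f (\<lambda>x. a x * b x)) a = \<Phi> B (\<lambda>x. a x * b x)"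
proof -
  obtain L where L: "\<And>B a u. a \<in> Cinf M \<Longrightarrow> \<Phi> B a u = (\<Sum>(c, g, b)\<leftarrow>L. c * B g (\<lambda>x. b x * a x) u)"
    by (rule tensorialE) blast
  show ?thesis unfolding fun_eq_iff L[OF assms(1)] L[OF Cinf_mult[OF M assms]]
    by (simp add: mult.assoc)
qed

text \<open>The functions and constants in the combination do not depend on \<open>B\<close>, so a
  parameter of \<open>B\<close> passes through a finite sum with its order bound unchanged.\<close>

lemma tensorial_diffop_lt:
  assumes a: "a \<in> Cinf M" and B: "\<And>f a. f \<in> Cinf P \<Longrightarrow> a \<in> Cinf M \<Longrightarrow> diffop_lt M P p s (\<lambda>b. B b f a)"
  shows "diffop_lt M P p s (\<lambda>b. \<Phi> (B b) a)"
proof -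
  obtain L where L: "\<And>c g b. (c, g, b) \<in> set L \<Longrightarrow> g \<in> Cinf P" "\<And>c g b. (c, g, b) \<in> set L \<Longrightarrow> b \<in> Cinf M"
    "\<And>B a u. a \<in> Cinf M \<Longrightarrow> \<Phi> B a u = (\<Sum>(c, g, b)\<leftarrow>L. c * B g (\<lambda>x. b x * a x) u)"
    by (rule tensorialE) blast
  have "diffop_lt M P p s (\<lambda>b' u. \<Sum>(c, g, b)\<leftarrow>L. c * B b' g (\<lambda>x. b x * a x) u)"
    using L(1,2)
  proof (induction L)
    case (Cons y L)
    obtain c g b where y: "y = (c, g, b)" by (cases y)
    have "diffop_lt M P p s (\<lambda>b' u. c * B b' g (\<lambda>x. b x * a x) u)"
      using Cons.prems(1)[of c g b] Cons.prems(2)[of c g b] y by (intro pm.diffop_lt_scale B Cinf_mult[OF M _ a]) auto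
    moreover have "diffop_lt M P p s (\<lambda>b' u. \<Sum>(c, g, b)\<leftarrow>L. c * B b' g (\<lambda>x. b x * a x) u)"
      using Cons.prems by (intro Cons.IH) (meson list.set_intros(2))+
    ultimately show ?case using y by (auto intro: pm.diffop_lt_add)
  qed (simp add: pm.diffop_lt_zero)
  moreover have "(\<lambda>b'. \<Phi> (B b') a) = (\<lambda>b' u. \<Sum>(c, g, b)\<leftarrow>L. c * B b' g (\<lambda>x. b x * a x) u)"
    by (simp add: fun_eq_iff L(3)[OF a])
  ultimately show ?thesis by simp
qed

end

subsection \<open>Special arguments\<close>

lemma derivation_one:
  assumes X: "derivation P X" shows "X (one_fun P) = (\<lambda>u. 0)"
proof
  fix u
  have C: "X (one_fun P) \<in> Cinf P" using X Cinf_one[OF P] by (auto simp: derivation_def linear_op_def)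
  have "X (\<lambda>x. one_fun P x * one_fun P x) = (\<lambda>x. X (one_fun P) x * one_fun P x + one_fun P x * X (one_fun P) x)"
    using X Cinf_one[OF P] by (simp add: derivation_def)
  moreover have "(\<lambda>x. one_fun P x * one_fun P x) = one_fun P" by (auto simp: one_fun_def)
  ultimately have "X (one_fun P) u = X (one_fun P) u * one_fun P u + one_fun P u * X (one_fun P) u" by metis
  then show "X (one_fun P) u = 0"
    using Cinf_zero_outside[OF C] by (cases "u \<in> points P") (auto simp: one_fun_def)
qed

lemma derivation_pow_one: "derivation P X \<Longrightarrow> (X ^^ k) (one_fun P) = (if k = 0 then one_fun P else (\<lambda>u. 0))"
  using linear_op_zero[of P P X "one_fun P"] Cinf_one[OF P]
  by (induction k) (auto simp: derivation_one derivation_def)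

lemma bidiff_fuse:
  assumes B: "bidiff k l B" and "\<And>i. i < j \<Longrightarrow> \<xi> i \<in> Cinf M \<and> derivation P (X i)"
  shows "bidiff (fuse_order k l j) l (fuse k l \<xi> X j B)"
  using assms(2)
proof (induction j)
  case (Suc j)
  then show ?case using bidiff_transfer[of "fuse_order k l j" l "fuse k l \<xi> X j B" "X j" "\<xi> j" "Suc (fuse_order k l j + l)"] by simp
qed (use B in simp)

text \<open>Derivations kill the constant 1, so only the zeroth Taylor term survives.\<close>

lemma fuse_one:
  assumes B: "bidiff k l B" and "\<And>i. i < j \<Longrightarrow> \<xi> i \<in> Cinf M \<and> derivation P (X i)" and a: "a \<in> Cinf M"
  shows "fuse k l \<xi> X j B (one_fun P) a = B (one_fun P) a"
  using assms(2)
proof (induction j)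
  case (Suc j)
  have X: "derivation P (X j)" and \<xi>: "\<xi> j \<in> Cinf M" using Suc.prems by auto
  let ?F = "fuse k l \<xi> X j B"
  have F: "bidiff (fuse_order k l j) l ?F" by (rule bidiff_fuse[OF B]) (use Suc.prems in auto)
  have z: "(\<Delta> (\<xi> j) ^^ i) ?F (\<lambda>u. 0) a = (\<lambda>u. 0)" for i
    by (rule linear_op_zero[OF bidiff_linear(1)[OF bidiff_\<Delta>_pow[OF F \<xi>] a] Cinf_zero[OF P]])
  have "transfer (Suc N) (\<xi> j) (X j) ?F (one_fun P) a u = ?F (one_fun P) a u" for N u
    by (induction N) (simp_all add: transfer_def derivation_pow_one[OF X] z del: funpow.simps(2))
  then show ?case using Suc by (simp add: fun_eq_iff)
qed simp

text \<open>An operator that sees only the product of \<open>f\<close> and \<open>a\<close> is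
  annihilated by every \<open>\<Delta>\<close>, so again only the zeroth Taylor term
  survives.\<close>

lemma fuse_rmul: "fuse k l \<xi> X j (\<lambda>f a. D (rmul f a)) = (\<lambda>f a. D (rmul f a))"
proof (induction j)
  case (Suc j)
  have "\<Delta> h (\<lambda>f a. D (rmul f a)) = (\<lambda>f a u. 0)" for h
    by (auto simp: \<Delta>_def rmul_def pb_p_mult mult_ac)
  moreover have "\<Delta> h (\<lambda>f a u. 0) = (\<lambda>f a u. 0)" for h by (auto simp: \<Delta>_def)
  ultimately have z: "(\<Delta> h ^^ Suc i) (\<lambda>f a. D (rmul f a)) = (\<lambda>f a u. 0)" for h i
    by (induction i) auto
  have "transfer (Suc N) h Y (\<lambda>f a. D (rmul f a)) f a u = D (rmul f a) u" for N h Y f a u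
    by (induction N) (simp_all add: transfer_def z del: funpow.simps(2))
  then show ?case by (simp add: Suc fun_eq_iff)
qed simp

definition invariant :: "('p, 'm) bop \<Rightarrow> bool"
  where "invariant B \<longleftrightarrow> (\<forall>g\<in>carrier G. \<forall>f\<in>Cinf P. \<forall>a\<in>Cinf M. B (tr g f) a = tr g (B f a))"

lemma tr_pb_p_mult:
  assumes g: "g \<in> carrier G" shows "tr g (\<lambda>u. pb_p a u * f u) = (\<lambda>u. pb_p a u * tr g f u)"
  using p_r[OF _ g] r_closed[OF _ g] by (auto simp: pullback_def)

lemma tr_rmul: "g \<in> carrier G \<Longrightarrow> tr g (rmul f a) = rmul (tr g f) a"
  using tr_pb_p_mult[of g a f] by (simp add: rmul_def mult.commute)

lemma invariant_\<Delta>: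
  assumes B: "invariant B" and \<xi>: "\<xi> \<in> Cinf M" shows "invariant (\<Delta> \<xi> B)"
  unfolding invariant_def
proof (intro ballI)
  fix g f a assume g: "g \<in> carrier G" and f: "f \<in> Cinf P" and a: "a \<in> Cinf M"
  have "B (tr g f) (\<lambda>x. \<xi> x * a x) = tr g (B f (\<lambda>x. \<xi> x * a x))"
    "B (tr g (\<lambda>u. pb_p \<xi> u * f u)) a = tr g (B (\<lambda>u. pb_p \<xi> u * f u) a)"
    using B g f a \<xi> by (auto simp: invariant_def Cinf_mult[OF M] Cinf_mult[OF P] pb_p_Cinf)
  then have "\<Delta> \<xi> B (tr g f) a = (\<lambda>u. tr g (B f (\<lambda>x. \<xi> x * a x)) u - tr g (B (\<lambda>u. pb_p \<xi> u * f u) a) u)"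
    unfolding \<Delta>_def tr_pb_p_mult[OF g] by simp
  also have "\<dots> = tr g (\<Delta> \<xi> B f a)"
    by (auto simp: \<Delta>_def pullback_def)
  finally show "\<Delta> \<xi> B (tr g f) a = tr g (\<Delta> \<xi> B f a)" .
qed

lemma invariant_fuse:
  assumes B: "invariant B"
    and "\<And>i. i < j \<Longrightarrow> \<xi> i \<in> Cinf M \<and> derivation P (X i) \<and> (\<forall>g\<in>carrier G. \<forall>f\<in>Cinf P. tr g (X i f) = X i (tr g f))"
  shows "invariant (fuse k l \<xi> X j B)"
  using assms(2)
proof (induction j)
  case (Suc j)
  have X: "derivation P (X j)" and \<xi>: "\<xi> j \<in> Cinf M"
    and Xg: "\<And>g f. g \<in> carrier G \<Longrightarrow> f \<in> Cinf P \<Longrightarrow> tr g (X j f) = X j (tr g f)"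
    using Suc.prems by auto
  have inv: "invariant ((\<Delta> (\<xi> j) ^^ i) (fuse k l \<xi> X j B))" for i
    by (induction i) (use Suc \<xi> in \<open>auto intro: invariant_\<Delta>\<close>)
  have pow: "(X j ^^ i) (tr g f) = tr g ((X j ^^ i) f)" if "g \<in> carrier G" "f \<in> Cinf P" for g f i
    by (induction i) (use Xg derivation_pow_Cinf[OF X] that in auto)
  show ?case
    using inv derivation_pow_Cinf[OF X] tr_Cinf
    by (auto simp: invariant_def transfer_def pow) (auto simp: pullback_def fun_eq_iff)
qed (use B in simp)

end

section \<open>The fused operator depends on its two arguments only through their product\<close>

context principal_patch
begin

abbreviation "m \<equiv> mdim M"

lemma \<Delta>_pow_vanish:
  assumes \<xi>: "\<zeta> \<in> Cinf M" and B: "\<And>f a. f \<in> Cinf P \<Longrightarrow> a \<in> Cinf M \<Longrightarrow> B f a u = 0"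
  shows "f \<in> Cinf P \<Longrightarrow> a \<in> Cinf M \<Longrightarrow> (\<Delta> \<zeta> ^^ k) B f a u = 0"
  by (induction k arbitrary: f a) (auto simp: B \<Delta>_def Cinf_mult[OF M] Cinf_mult[OF P] pb_p_Cinf \<xi>)

text \<open>As \<open>X i\<close> kills \<open>\<xi> j\<close>, its powers commute with
  multiplication by \<open>\<xi> j\<close>, and the operators \<open>\<Delta>\<close> of different
  coordinates commute. Hence clearing coordinate \<open>i\<close> does not disturb a coordinate
  cleared before.\<close>

lemma transfer_\<Delta>_other:
  assumes i: "i < m" and j: "j < m" "j \<noteq> i" and B: "bidiff k l B"
    and z: "\<And>f a. f \<in> Cinf P \<Longrightarrow> a \<in> Cinf M \<Longrightarrow> \<Delta> (\<xi> j) B f a u = 0"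
    and f: "f \<in> Cinf P" and a: "a \<in> Cinf M" and u: "nz u"
  shows "\<Delta> (\<xi> j) (transfer N (\<xi> i) (X i) B) f a u = 0"
proof -
  note D = X[OF i] and xi = pb_p_Cinf[OF \<xi>[OF j(1)]]
  note C = derivation_pow_Cinf[OF D f]
  let ?D = "\<lambda>s. (\<Delta> (\<xi> i) ^^ s) B"
  have "?D s ((X i ^^ s) (\<lambda>u. pb_p (\<xi> j) u * f u)) a u = ?D s (\<lambda>u. pb_p (\<xi> j) u * (X i ^^ s) f u) a u" for s
  proof (rule nz_local[OF bidiffD(1)[OF bidiff_\<Delta>_pow[OF B \<xi>[OF i]] a] u])
    show "(X i ^^ s) (\<lambda>u. pb_p (\<xi> j) u * f u) \<in> Cinf P"
      by (intro derivation_pow_Cinf[OF D] Cinf_mult[OF P xi f])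
  qed (use X_pow_mult[OF i j(1) f] C xi j in \<open>auto intro: Cinf_mult[OF P]\<close>)
  moreover have "\<Delta> (\<xi> j) (?D s) ((X i ^^ s) f) a u = 0" for s
    unfolding \<Delta>_pow_commute by (rule \<Delta>_pow_vanish[where B="\<Delta> (\<xi> j) B" and f="(X i ^^ s) f" and a=a, OF \<xi>[OF i] z C a])
  ultimately have "?D s ((X i ^^ s) f) (\<lambda>x. \<xi> j x * a x) u - ?D s ((X i ^^ s) (\<lambda>u. pb_p (\<xi> j) u * f u)) a u = 0" for s
    by (simp add: \<Delta>_def[of "\<xi> j"])
  then show ?thesis
    unfolding \<Delta>_def[of "\<xi> j"] transfer_def by (simp add: sum_subtractf[symmetric] right_diff_distrib[symmetric] diff_divide_distrib[symmetric])
qed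

text \<open>The coordinate treated last is cleared because the Taylor remainder vanishes by
  nilpotency; the earlier ones stay cleared.\<close>

lemma fuse_\<Delta>:
  assumes B: "bidiff k l B"
  shows "j \<le> m \<Longrightarrow> i < j \<Longrightarrow> f \<in> Cinf P \<Longrightarrow> a \<in> Cinf M \<Longrightarrow> nz u \<Longrightarrow> \<Delta> (\<xi> i) (fuse k l \<xi> X j B) f a u = 0"
proof (induction j arbitrary: f a i)
  case (Suc j)
  have F: "bidiff (fuse_order k l j) l (fuse k l \<xi> X j B)"
    by (rule bidiff_fuse[OF B]) (use \<xi> X Suc.prems in auto)
  have j: "j < m" using Suc.prems by simp
  show ?case
  proof (cases "i = j")
    case True
    have "(\<Delta> (\<xi> j) ^^ Suc (fuse_order k l j + l)) (fuse k l \<xi> X j B) ((X j ^^ (fuse_order k l j + l)) f) a = (\<lambda>u. 0)"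
      by (rule \<Delta>_nilpotent[OF \<xi>[OF j] F _ derivation_pow_Cinf[OF X[OF j]]]) (use Suc.prems in auto)
    then show ?thesis
      using transfer_\<Delta>_self[OF j F Suc.prems(3,4,5), of "fuse_order k l j + l"] True by simp
  next
    case False
    then have ij: "i < j" using Suc.prems by simp
    have "\<Delta> (\<xi> i) (fuse k l \<xi> X j B) f a u = 0" if "f \<in> Cinf P" "a \<in> Cinf M" for f a
      by (rule Suc.IH) (use Suc.prems ij that in auto)
    from transfer_\<Delta>_other[OF j _ _ F this Suc.prems(3-5)]
    show ?thesis using ij j by simp
  qed
qed simp

text \<open>By Hadamard's lemma, an operator that commutes with the coordinates in \<open>a\<close> is determined by its
  value at \<open>a = 1\<close>.\<close>

lemma vanish_if_\<Delta>_vanish: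
  "bidiff k l E \<Longrightarrow> (\<And>i f a u. i < m \<Longrightarrow> f \<in> Cinf P \<Longrightarrow> a \<in> Cinf M \<Longrightarrow> nz u \<Longrightarrow> \<Delta> (\<xi> i) E f a u = 0) \<Longrightarrow>
   (\<And>f u. f \<in> Cinf P \<Longrightarrow> nz u \<Longrightarrow> E f (one_fun M) u = 0) \<Longrightarrow>
   f \<in> Cinf P \<Longrightarrow> a \<in> Cinf M \<Longrightarrow> nz u \<Longrightarrow> E f a u = 0"
proof (induction k arbitrary: E f a u)
  case 0
  then show ?case by (simp add: bidiff_def)
next
  case (Suc k)
  \<comment> \<open>The commutator of \<open>E\<close> with a function on \<open>P\<close> satisfies
    the same hypotheses with a smaller order, hence vanishes where
    \<open>\<eta> (p u) \<noteq> 0\<close>. There \<open>E\<close> is linear over functions on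
    \<open>P\<close> in its first argument.\<close>
  have L: "E (\<lambda>u. h u * f u) a u = h u * E f a u" if h: "h \<in> Cinf P" and f: "f \<in> Cinf P" and a: "a \<in> Cinf M" and u: "nz u" for h f a u
  proof -
    have "commL h E f a u = 0"
    proof (rule Suc.IH[OF bidiff_commL[OF Suc.prems(1) h] _ _ f a u])
      fix i f a u assume *: "i < m" "f \<in> Cinf P" "a \<in> Cinf M" "nz u"
      have "\<Delta> (\<xi> i) (commL h E) f a u = h u * \<Delta> (\<xi> i) E f a u - \<Delta> (\<xi> i) E (\<lambda>u. h u * f u) a u"
        by (simp add: \<Delta>_def commL_def algebra_simps)
      then show "\<Delta> (\<xi> i) (commL h E) f a u = 0"
        using Suc.prems(2)[OF *] Suc.prems(2)[OF *(1) Cinf_mult[OF P h *(2)] *(3,4)] by simp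
    next
      fix f u assume "f \<in> Cinf P" "nz u"
      then show "commL h E f (one_fun M) u = 0"
        using Suc.prems(3) Cinf_mult[OF P h] by (simp add: commL_def)
    qed
    then show ?thesis by (simp add: commL_def)
  qed
  let ?x = "p u"
  have uP: "u \<in> points P" and nx: "\<eta> ?x \<noteq> 0" using Suc.prems(6) by (auto simp: nz_def)
  \<comment> \<open>Vanishing of \<open>\<Delta>\<close> moves the coordinate from \<open>a\<close>
    to \<open>f\<close>, and linearity moves it out of the operator.\<close>
  have R: "E f (\<lambda>x. \<xi> i x * a x) u = \<xi> i ?x * E f a u" if i: "i < m" and a: "a \<in> Cinf M" for i a
    using Suc.prems(2)[OF i Suc.prems(4) a Suc.prems(6)] L[OF pb_p_Cinf[OF \<xi>[OF i]] Suc.prems(4) a Suc.prems(6)] uP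
    by (simp add: \<Delta>_def pullback_def)
  note LE = bidiff_linear(2)[OF Suc.prems(1,4)]
  \<comment> \<open>Hadamard's lemma puts \<open>\<eta> (g - g (p u))\<close> into the ideal
    generated by the differences \<open>\<xi> i - \<xi> i (p u)\<close>, and by \<open>R\<close>
    evaluation of \<open>E f\<close> at \<open>u\<close> kills this ideal.\<close>
  have H: "E f (\<lambda>x. \<eta> x * g x) u = g ?x * E f \<eta> u" if g: "g \<in> Cinf M" for g
  proof -
    obtain b where b: "\<forall>i<m. b i \<in> Cinf M" "\<And>y. \<eta> y * (g y - g ?x) = (\<Sum>i<m. (\<xi> i y - \<xi> i ?x) * b i y)"
      using patch g nx unfolding patch_def by blast
    have eta_g: "(\<lambda>x. \<eta> x * g x) \<in> Cinf M" by (rule Cinf_mult[OF M \<eta> g])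
    have t: "(\<lambda>y. \<xi> i y * b i y) \<in> Cinf M" "(\<lambda>y. \<xi> i ?x * b i y) \<in> Cinf M" if "i < m" for i
      using b(1) that Cinf_mult[OF M \<xi>] Cinf_scale[OF M] by auto
    have "E f (\<lambda>x. \<eta> x * g x) u - g ?x * E f \<eta> u = E f (\<lambda>x. \<eta> x * g x - g ?x * \<eta> x) u"
      using linear_op_diff[OF LE M eta_g Cinf_scale[OF M \<eta>]] linear_opD(3)[OF LE \<eta>] by simp
    also have "(\<lambda>x. \<eta> x * g x - g ?x * \<eta> x) = (\<lambda>y. \<Sum>i<m. \<xi> i y * b i y - \<xi> i ?x * b i y)"
      using b(2) by (simp add: algebra_simps fun_eq_iff)
    also have "E f \<dots> u = (\<Sum>i<m. E f (\<lambda>y. \<xi> i y * b i y - \<xi> i ?x * b i y) u)"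
      using linear_op_sum[OF LE M, of "{..<m}" "\<lambda>i y. \<xi> i y * b i y - \<xi> i ?x * b i y"] t
      by (simp add: Cinf_minus[OF M])
    also have "\<dots> = 0"
    proof (rule sum.neutral, rule ballI)
      fix i assume "i \<in> {..<m}"
      then have i: "i < m" by simp
      show "E f (\<lambda>y. \<xi> i y * b i y - \<xi> i ?x * b i y) u = 0"
        using linear_op_diff[OF LE M t[OF i]] linear_opD(3)[OF LE, of "b i" "\<xi> i ?x"] b(1) i R[OF i] by simp
    qed
    finally show ?thesis by simp
  qed
  let ?e = "\<lambda>y. (1 / \<eta> ?x) * \<eta> y"
  have e: "?e \<in> Cinf M" by (rule Cinf_scale[OF M \<eta>])
  \<comment> \<open>The factor \<open>\<eta>\<close> is removed by descent on the order, with
    \<open>\<eta>\<close> scaled to 1 at \<open>p u\<close>; functions vanishing at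
    \<open>p u\<close> are stable under this factor.\<close>
  have V: "E f g u = 0" if "g \<in> {g \<in> Cinf M. g ?x = 0}" for g
  proof (rule pm.diffop_lt_cutoff_vanish[OF uP e _ _ _ bidiffD(2)[OF Suc.prems(1,4)] _ that])
    show "?e ?x = 1" using nx by simp
    show "\<And>g. g \<in> {g \<in> Cinf M. g ?x = 0} \<Longrightarrow> (\<lambda>x. ?e x * g x) \<in> {g \<in> Cinf M. g ?x = 0}"
      using Cinf_mult[OF M e] by auto
    fix g assume g: "g \<in> {g \<in> Cinf M. g ?x = 0}"
    have "(\<lambda>x. ?e x * g x) = (\<lambda>x. (1 / \<eta> ?x) * (\<eta> x * g x))" by (simp only: mult.assoc)
    moreover have "E f (\<lambda>x. (1 / \<eta> ?x) * (\<eta> x * g x)) = (\<lambda>u. (1 / \<eta> ?x) * E f (\<lambda>x. \<eta> x * g x) u)"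
      by (rule linear_opD(3)[OF LE]) (use g Cinf_mult[OF M \<eta>] in auto)
    moreover have "E f (\<lambda>x. \<eta> x * g x) u = 0" using H g by simp
    ultimately show "E f (\<lambda>x. ?e x * g x) u = 0" by (simp only: mult_zero_right)
  qed auto
  \<comment> \<open>Split \<open>a\<close> into its value at \<open>p u\<close> times 1, where
    \<open>E\<close> vanishes by hypothesis, and a function vanishing at \<open>p u\<close>.\<close>
  have o: "(\<lambda>x. a ?x * one_fun M x) \<in> Cinf M" by (rule Cinf_scale[OF M Cinf_one[OF M]])
  have "E f (\<lambda>x. a x - a ?x * one_fun M x) u = 0"
    using Cinf_minus[OF M Suc.prems(5) o] p_closed[OF uP] by (intro V) (simp add: one_fun_def)
  then show ?case
    using linear_op_diff[OF LE M Suc.prems(5) o] linear_opD(3)[OF LE Cinf_one[OF M]] Suc.prems(3)[OF Suc.prems(4,6)]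
    by simp
qed

text \<open>The difference of the two sides is killed by \<open>\<Delta>\<close> for every
  coordinate, since the right side depends on the product only, and it vanishes at
  \<open>a = 1\<close>.\<close>

lemma fuse_eq_rmul:
  assumes B: "bidiff k l B" and f: "f \<in> Cinf P" and a: "a \<in> Cinf M" and u: "nz u"
  shows "fuse k l \<xi> X m B f a u = fuse k l \<xi> X m B (rmul f a) (one_fun M) u"
proof -
  define F where "F = fuse k l \<xi> X m B"
  define K where "K = fuse_order k l m"
  have F: "bidiff K l F" unfolding F_def K_def by (rule bidiff_fuse[OF B]) (use \<xi> X in auto)
  have z: "\<Delta> (\<xi> i) F f a u = 0" if "i < m" "f \<in> Cinf P" "a \<in> Cinf M" "nz u" for i f a u
    unfolding F_def by (rule fuse_\<Delta>[OF B order_refl that])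
  define E where "E = (\<lambda>f a u. F f a u - F (rmul f a) (one_fun M) u)"
  have "bidiff (Suc K) (l + (2 + K)) (\<lambda>f a. F (rmul f a) (one_fun M))"
    unfolding bidiff_def
  proof (intro conjI ballI)
    fix a assume a: "a \<in> Cinf M"
    have "diffop_lt P P (\<lambda>u. u) 1 (\<lambda>f. rmul f a)"
      using diffop_lt_multiplication[OF P pb_p_Cinf[OF a]] by (simp add: rmul_def[abs_def] mult.commute)
    from diffop_lt_compose_right[OF pp.smooth_pullback_axioms _ this bidiffD(1)[OF F Cinf_one[OF M]]]
    show "diffop_lt P P (\<lambda>u. u) (Suc K) (\<lambda>f. F (rmul f a) (one_fun M))" by simp
  next
    fix f assume f: "f \<in> Cinf P"
    have "diffop_lt M P p 1 pb_p" by (rule pm.diffop_lt_pullback[OF p_closed])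
    from pm.diffop_lt_mult_left[OF Cinf_mult[OF P f] this]
    have "diffop_lt M P p 1 (\<lambda>a. rmul f a)" by (simp add: rmul_def[abs_def])
    from diffop_lt_compose_left[OF pm.smooth_pullback_axioms this bidiffD(1)[OF F Cinf_one[OF M]]]
    show "diffop_lt M P p (l + (2 + K)) (\<lambda>a. F (rmul f a) (one_fun M))"
      by (rule pm.diffop_lt_mono) simp
  qed
  then have bE: "bidiff (Suc K) (l + (2 + K)) E"
    unfolding E_def by (intro bidiff_diff bidiff_mono[OF F]) auto
  have "E f a u = 0"
  proof (rule vanish_if_\<Delta>_vanish[OF bE _ _ f a u])
    fix i f a u assume *: "i < m" "f \<in> Cinf P" "a \<in> Cinf M" "nz u"
    have "rmul f (\<lambda>x. \<xi> i x * a x) = rmul (\<lambda>u. pb_p (\<xi> i) u * f u) a"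
      by (auto simp: rmul_def pb_p_mult)
    then show "\<Delta> (\<xi> i) E f a u = 0" using z[OF *] by (simp add: \<Delta>_def E_def)
  qed (simp add: E_def rmul_one)
  then show ?thesis by (simp add: E_def F_def)
qed

end

subsection \<open>Partition of unity\<close>

text \<open>Shrinking the set where \<open>\<eta>\<close> is nonzero keeps the coordinates and lifts
  and multiplies the Hadamard quotients. So the partition of unity can be formed from the patch
  functions themselves.\<close>

lemma patch_mult:
  assumes "patch P M G r p \<eta> \<xi> X" and M: "locally_euclidean M" and h: "h \<in> Cinf M"
  shows "patch P M G r p (\<lambda>x. \<eta> x * h x) \<xi> X"
proof -
  have "\<exists>b. (\<forall>i<mdim M. b i \<in> Cinf M) \<and>
      (\<forall>y. \<eta> y * h y * (a y - a x) = (\<Sum>i<mdim M. (\<xi> i y - \<xi> i x) * b i y))"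
    if a: "a \<in> Cinf M" and x: "\<eta> x * h x \<noteq> 0" for a x
  proof -
    obtain b where b: "\<forall>i<mdim M. b i \<in> Cinf M" "\<And>y. \<eta> y * (a y - a x) = (\<Sum>i<mdim M. (\<xi> i y - \<xi> i x) * b i y)"
    proof -
      have "\<forall>a\<in>Cinf M. \<forall>x. \<eta> x \<noteq> 0 \<longrightarrow> (\<exists>b. (\<forall>i<mdim M. b i \<in> Cinf M) \<and>
         (\<forall>y. \<eta> y * (a y - a x) = (\<Sum>i<mdim M. (\<xi> i y - \<xi> i x) * b i y)))"
        using assms(1) by (simp add: patch_def)
      moreover have "\<eta> x \<noteq> 0" using x by auto
      ultimately show ?thesis using a that by blast
    qed
    have "\<eta> y * h y * (a y - a x) = (\<Sum>i<mdim M. (\<xi> i y - \<xi> i x) * (b i y * h y))" for y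
    proof -
      have "\<eta> y * h y * (a y - a x) = (\<eta> y * (a y - a x)) * h y" by simp
      also have "\<dots> = (\<Sum>i<mdim M. (\<xi> i y - \<xi> i x) * (b i y * h y))"
        unfolding b(2) by (simp add: sum_distrib_right mult.assoc)
      finally show ?thesis .
    qed
    then show ?thesis using b(1) Cinf_mult[OF M _ h] by (intro exI[of _ "\<lambda>i y. b i y * h y"]) auto
  qed
  then show ?thesis using assms(1) Cinf_mult[OF M _ h] unfolding patch_def by auto
qed

text \<open>Serves the empty base, where there is no point around which to choose a patch.\<close>

lemma patch_zero:
  assumes "locally_euclidean P" "locally_euclidean M"
  shows "patch P M G r p (\<lambda>x. 0) (\<lambda>i x. 0) (\<lambda>i f u. 0)"
  using Cinf_zero[OF assms(1)] Cinf_zero[OF assms(2)]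
  by (auto simp: patch_def derivation_def linear_op_def pullback_def)

lemma partition_telescope: "(\<Sum>n<N. c n * (\<Prod>i<n. 1 - c i)) = 1 - (\<Prod>i<N. 1 - c i :: 'a::comm_ring_1)" for N :: nat
  by (induction N) (auto simp: algebra_simps)

text \<open>Second countability leaves countably many patches whose regions with
  \<open>c x = 1\<close> still cover \<open>M\<close>. Of the telescoping sum
  \<open>1 - \<Prod>(1 - c)\<close> only the 1 remains, since every point makes one factor
  vanish.\<close>

lemma (in principal) partition_exists:
  obtains \<eta> \<xi> X where "\<And>n::nat. patch P M G r p (\<eta> n) (\<xi> n) (X n)"
    and "\<And>x. x \<in> points M \<Longrightarrow> \<exists>V N. openin (mtop M) V \<and> x \<in> V \<and> (\<forall>n\<ge>N. \<forall>y\<in>V. \<eta> n y = 0)"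
    and "\<And>x N. x \<in> points M \<Longrightarrow> \<forall>n\<ge>N. \<eta> n x = 0 \<Longrightarrow> (\<Sum>n<N. \<eta> n x) = 1"
proof (cases "points M = {}")
  case True
  show ?thesis
    by (rule that[of "\<lambda>n x. 0" "\<lambda>n i x. 0" "\<lambda>n i f u. 0"], rule patch_zero[OF P M]) (use True in blast)+
next
  case False
  have "\<forall>x. x \<in> points M \<longrightarrow> (\<exists>V \<eta> \<xi> X. openin (mtop M) V \<and> x \<in> V \<and> (\<forall>y\<in>V. \<eta> y = 1) \<and> patch P M G r p \<eta> \<xi> X)"
    using principal_bundle_patch[OF pb] by metis
  then obtain V c \<xi> X where V: "\<And>x. x \<in> points M \<Longrightarrow> openin (mtop M) (V x)" "\<And>x. x \<in> points M \<Longrightarrow> x \<in> V x"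
    "\<And>x y. x \<in> points M \<Longrightarrow> y \<in> V x \<Longrightarrow> c x y = 1" "\<And>x. x \<in> points M \<Longrightarrow> patch P M G r p (c x) (\<xi> x) (X x)"
    by metis
  have "Lindelof_space (mtop M)"
    using pb by (simp add: principal_bundle_def smooth_manifold_def second_countable_imp_Lindelof_space)
  moreover have "\<Union> (V ` points M) = points M"
    using V(1,2) openin_subset by fast
  ultimately obtain \<V> where \<V>: "countable \<V>" "\<V> \<subseteq> V ` points M" "\<Union> \<V> = points M"
    using V(1) unfolding Lindelof_space_def by (metis (no_types, lifting) imageE)
  have ne: "\<V> \<noteq> {}" using \<V>(3) False by blast
  have "\<forall>n. \<exists>x. x \<in> points M \<and> from_nat_into \<V> n = V x"
    using from_nat_into[OF ne] \<V>(2) by blast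
  then obtain s where s: "\<And>n. s n \<in> points M" "\<And>n. from_nat_into \<V> n = V (s n)" by metis
  have cover: "\<exists>n. x \<in> V (s n)" if "x \<in> points M" for x
    using that \<V>(3) s(2) range_from_nat_into[OF ne \<V>(1)] by (metis UnionE rangeE)
  text \<open>Locally finite without any shrinking: \<open>\<eta> n\<close> vanishes where some \<open>c (s i)\<close> with \<open>i < n\<close> is 1.\<close>
  define \<eta> where "\<eta> n = (\<lambda>x. c (s n) x * (\<Prod>i<n. one_fun M x - c (s i) x))" for n
  \<comment> \<open>For \<open>n = 0\<close> the empty product is 1 also off the manifold, so it is
    not normalised as members of \<open>Cinf\<close> are.\<close>
  have "(\<lambda>x. \<Prod>i<n. one_fun M x - c (s i) x) \<in> Cinf M \<or> n = 0" for n
  proof (induction n)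
    case (Suc n)
    have d: "(\<lambda>x. one_fun M x - c (s n) x) \<in> Cinf M"
      using V(4)[OF s(1)] by (intro Cinf_minus[OF M Cinf_one[OF M]]) (auto simp: patch_def)
    then show ?case using Suc Cinf_mult[OF M _ d] by (cases "n = 0") auto
  qed simp
  then have patch: "patch P M G r p (\<eta> n) (\<xi> (s n)) (X (s n))" for n
    using patch_mult[OF V(4)[OF s(1)] M] V(4)[OF s(1)] unfolding \<eta>_def by (cases "n = 0") auto
  have one: "\<eta> n x = c (s n) x * (\<Prod>i<n. 1 - c (s i) x)" if "x \<in> points M" for n x
    using that by (simp add: \<eta>_def one_fun_def)
  have zero: "(\<Prod>i<n. 1 - c (s i) x) = 0" if "x \<in> V (s k)" "k < n" for n k x
    using that V(3)[OF s(1)] by (intro prod_zero bexI[of _ k]) auto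
  have VM: "V (s k) \<subseteq> points M" for k using openin_subset[OF V(1)[OF s(1)]] .
  show ?thesis
  proof (rule that[of \<eta> "\<lambda>n. \<xi> (s n)" "\<lambda>n. X (s n)", OF patch])
    fix x assume x: "x \<in> points M"
    obtain k where k: "x \<in> V (s k)" using cover[OF x] by blast
    have z: "\<eta> n y = 0" if "n \<ge> Suc k" "y \<in> V (s k)" for n y
      using that one[of y n] zero[of y k n] VM[of k] by auto
    then show "\<exists>V N. openin (mtop M) V \<and> x \<in> V \<and> (\<forall>n\<ge>N. \<forall>y\<in>V. \<eta> n y = 0)"
      using V(1)[OF s(1)] k by blast
    fix N assume N: "\<forall>n\<ge>N. \<eta> n x = 0"
    \<comment> \<open>Enlarging the range changes nothing and ensures that the vanishing factor with
      index \<open>k\<close> occurs in the product.\<close>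
    have "(\<Sum>n<N. \<eta> n x) = (\<Sum>n<max N (Suc k). \<eta> n x)"
      by (rule sum.mono_neutral_left) (use N in auto)
    also have "\<dots> = 1" unfolding one[OF x] partition_telescope using zero[OF k, of "max N (Suc k)"] by simp
    finally show "(\<Sum>n<N. \<eta> n x) = 1" .
  qed
qed

section \<open>Gluing operators with a partition of unity\<close>

locale principal_partition = principal P M GM G r p
  for P :: "'p manifold" and M :: "'m manifold" and GM :: "'g manifold" and G :: "'g monoid"
    and r :: "'p \<Rightarrow> 'g \<Rightarrow> 'p" and p :: "'p \<Rightarrow> 'm" +
  fixes \<eta> :: "nat \<Rightarrow> 'm \<Rightarrow> complex" and \<xi> :: "nat \<Rightarrow> nat \<Rightarrow> 'm \<Rightarrow> complex"
    and X :: "nat \<Rightarrow> nat \<Rightarrow> ('p \<Rightarrow> complex) \<Rightarrow> 'p \<Rightarrow> complex"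
  assumes patches: "patch P M G r p (\<eta> n) (\<xi> n) (X n)"
    and locally_finite: "x \<in> points M \<Longrightarrow> \<exists>V N. openin (mtop M) V \<and> x \<in> V \<and> (\<forall>n\<ge>N. \<forall>y\<in>V. \<eta> n y = 0)"
    and sum_one: "x \<in> points M \<Longrightarrow> \<forall>n\<ge>N. \<eta> n x = 0 \<Longrightarrow> (\<Sum>n<N. \<eta> n x) = 1"
begin

abbreviation "m \<equiv> mdim M"

lemma principal_patch: "principal_patch P M GM G r p (\<eta> n) (\<xi> n) (X n)"
  by unfold_locales (rule patches)

lemma patchD: "\<eta> n \<in> Cinf M" "i < m \<Longrightarrow> \<xi> n i \<in> Cinf M" "i < m \<Longrightarrow> derivation P (X n i)"
  "i < m \<Longrightarrow> g \<in> carrier G \<Longrightarrow> f \<in> Cinf P \<Longrightarrow> tr g (X n i f) = X n i (tr g f)"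
  using patches[of n] by (auto simp: patch_def)

abbreviation "e n \<equiv> pb_p (\<eta> n)"

text \<open>Local finiteness makes the index set finite at every point. The type of the argument is
  left open, since operators on \<open>P\<close>, operators on \<open>M\<close> and families with a
  parameter are all glued.\<close>

definition glue :: "(nat \<Rightarrow> 'a \<Rightarrow> 'p \<Rightarrow> complex) \<Rightarrow> 'a \<Rightarrow> 'p \<Rightarrow> complex"
  where "glue D f u = (\<Sum>n\<in>{n. e n u \<noteq> 0}. e n u * D n f u)"

lemma glue_local:
  assumes u: "u \<in> points P"
  obtains V N where "openin (mtop P) V" "u \<in> V" "\<And>v n. v \<in> V \<Longrightarrow> n \<ge> N \<Longrightarrow> e n v = 0"
    "\<And>v D f. v \<in> V \<Longrightarrow> glue D f v = (\<Sum>n<N. e n v * D n f v)"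
proof -
  obtain V N where V: "openin (mtop M) V" "p u \<in> V" "\<forall>n\<ge>N. \<forall>y\<in>V. \<eta> n y = 0"
    using locally_finite[OF p_closed[OF u]] by blast
  let ?V = "{v \<in> points P. p v \<in> V}"
  have z: "e n v = 0" if "v \<in> ?V" "n \<ge> N" for v n using that V(3) by (auto simp: pullback_def)
  show ?thesis
  proof (rule that[of ?V N])
    show "openin (mtop P) ?V" by (rule openin_continuous_map_preimage[OF smooth_mapD(2)[OF p] V(1)])
    show "glue D f v = (\<Sum>n<N. e n v * D n f v)" if "v \<in> ?V" for v D and f :: 'a
      unfolding glue_def
      by (rule sum.mono_neutral_left) (use z[OF that] in \<open>auto simp: not_less[symmetric]\<close>)
  qed (use u V z in auto)
qed

lemma glue_outside: "u \<notin> points P \<Longrightarrow> glue D f u = 0"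
  by (simp add: glue_def pullback_def)

lemma glue_Cinf:
  assumes "\<And>n. D n f \<in> Cinf P" shows "glue D f \<in> Cinf P"
proof (rule Cinf_local_eq[OF P glue_outside])
  fix u assume u: "u \<in> points P"
  obtain V N where V: "openin (mtop P) V" "u \<in> V" "\<And>v n. v \<in> V \<Longrightarrow> n \<ge> N \<Longrightarrow> e n v = 0"
    "\<And>v D (f::'a). v \<in> V \<Longrightarrow> glue D f v = (\<Sum>n<N. e n v * D n f v)"
    by (rule glue_local[OF u, where ?'a='a]) (rule that)
  have "(\<lambda>v. \<Sum>n<N. e n v * D n f v) \<in> Cinf P"
    by (intro Cinf_sum[OF P] Cinf_mult[OF P] pb_p_Cinf patchD(1) assms)
  then show "\<exists>B g. openin (mtop P) B \<and> u \<in> B \<and> g \<in> Cinf P \<and> (\<forall>y\<in>B. glue D f y = g y)"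
    by (intro exI[of _ V] exI[of _ "\<lambda>v. \<Sum>n<N. e n v * D n f v"]) (simp add: V)
qed

text \<open>Used where all patches that contribute at \<open>u\<close> give the same value, which
  the weights of sum 1 then reproduce.\<close>

lemma glue_const:
  assumes u: "u \<in> points P" and "\<And>n. e n u \<noteq> 0 \<Longrightarrow> D n f u = a" shows "glue D f u = a"
proof -
  obtain V N where V: "openin (mtop P) V" "u \<in> V" "\<And>v n. v \<in> V \<Longrightarrow> n \<ge> N \<Longrightarrow> e n v = 0"
    "\<And>v D (f::'a). v \<in> V \<Longrightarrow> glue D f v = (\<Sum>n<N. e n v * D n f v)"
    by (rule glue_local[OF u, where ?'a='a]) (rule that)
  have "glue D f u = (\<Sum>n<N. e n u * a)"
    unfolding V(4)[OF V(2)] by (intro sum.cong) (use assms(2) in auto)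
  also have "\<dots> = (\<Sum>n<N. \<eta> n (p u)) * a" using u by (simp add: sum_distrib_right pullback_def)
  also have "(\<Sum>n<N. \<eta> n (p u)) = 1"
  proof (rule sum_one[OF p_closed[OF u]], intro allI impI)
    show "\<eta> n (p u) = 0" if "n \<ge> N" for n using V(3)[OF V(2) that] u by (simp add: pullback_def)
  qed
  finally show ?thesis by simp
qed

lemma glue_cong: "(\<And>n. e n u \<noteq> 0 \<Longrightarrow> D n f u = D' n f' u) \<Longrightarrow> glue D f u = glue D' f' u"
  unfolding glue_def by (intro sum.cong) auto

lemma glue_linear:
  "glue (\<lambda>n f u. D n f u + D' n f u) f u = glue D f u + glue D' f u"
  "glue (\<lambda>n f u. c u * D n f u) f u = c u * glue D f u"
  by (simp_all add: glue_def sum.distrib[symmetric] sum_distrib_left algebra_simps)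

text \<open>The weights multiply the output, so gluing commutes with taking commutators. The bound
  \<open>k\<close> common to all patches is what keeps the order finite.\<close>

lemma glue_diffop_lt:
  assumes "smooth_pullback Z P q" shows "(\<And>n. diffop_lt Z P q k (D n)) \<Longrightarrow> diffop_lt Z P q k (glue D)"
proof (induction k arbitrary: D)
  case 0
  then show ?case by (simp add: glue_def fun_eq_iff)
next
  case (Suc k)
  interpret Z: smooth_pullback Z P q by fact
  have L: "linear_op Z P (D n)" for n using Suc.prems by (simp add: Z.diffop_lt_Suc)
  have "linear_op Z P (glue D)"
    unfolding linear_op_def
  proof (intro conjI ballI allI)
    show "glue D f \<in> Cinf P" if "f \<in> Cinf Z" for f by (intro glue_Cinf linear_opD(1)[OF L] that)
    show "glue D (\<lambda>x. f x + h x) = (\<lambda>y. glue D f y + glue D h y)" if "f \<in> Cinf Z" "h \<in> Cinf Z" for f h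
      by (simp add: glue_def linear_opD(2)[OF L that] sum.distrib[symmetric] algebra_simps fun_eq_iff)
    show "glue D (\<lambda>x. c * f x) = (\<lambda>y. c * glue D f y)" if "f \<in> Cinf Z" for c f
      by (simp add: glue_def linear_opD(3)[OF L that] sum_distrib_left algebra_simps fun_eq_iff)
  qed
  moreover have "diffop_lt Z P q k (Z.comm h (glue D))" if h: "h \<in> Cinf Z" for h
  proof -
    have "Z.comm h (glue D) = glue (\<lambda>n. Z.comm h (D n))"
      by (simp add: Z.comm_def glue_def fun_eq_iff sum_subtractf[symmetric] sum_distrib_left algebra_simps)
    then show ?thesis using Suc.IH[of "\<lambda>n. Z.comm h (D n)"] Suc.prems h by (simp add: Z.diffop_lt_Suc)
  qed
  ultimately show ?case by (simp add: Z.diffop_lt_Suc)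
qed

subsection \<open>Properties of the homotopy operator\<close>

text \<open>On a patch, let \<open>f\<close> be a base function \<open>\<alpha>\<close> times a
  function \<open>\<beta>\<close> killed by the lifts. The fused operator moves
  \<open>\<alpha>\<close> to the second argument, and only the zeroth Taylor term remains, so
  evaluation at 1 gives \<open>B \<beta> \<alpha>\<close>: the contraction.\<close>

definition homotopy :: "nat \<Rightarrow> nat \<Rightarrow> ('p, 'm) bop \<Rightarrow> ('p \<Rightarrow> complex) \<Rightarrow> 'p \<Rightarrow> complex"
  where "homotopy k l B = glue (\<lambda>n f. fuse k l (\<xi> n) (X n) m B f (one_fun M))"

lemma tensorial_fuse': "f \<in> Cinf P \<Longrightarrow> tensorial (\<lambda>B. fuse k l (\<xi> n) (X n) m B f)"
  using patchD by (intro tensorial_fuse) auto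

lemma homotopy_diffop_lt:
  assumes "bidiff k l B" shows "diffop_lt P P (\<lambda>u. u) (fuse_order k l m) (homotopy k l B)"
  unfolding homotopy_def
  by (intro glue_diffop_lt[OF pp.smooth_pullback_axioms] bidiffD(1)[OF bidiff_fuse[OF assms]] Cinf_one[OF M] conjI patchD)

lemma homotopy_linear_op: "bidiff k l B \<Longrightarrow> linear_op P P (homotopy k l B)"
  by (rule pp.diffop_lt_linear[OF homotopy_diffop_lt])

lemma homotopy_cong:
  assumes f: "f \<in> Cinf P" and "\<And>f a. f \<in> Cinf P \<Longrightarrow> a \<in> Cinf M \<Longrightarrow> B f a = B' f a"
  shows "homotopy k l B f = homotopy k l B' f"
  unfolding homotopy_def
  by (intro ext glue_cong tensorial_cong[OF tensorial_fuse'[OF f] Cinf_one[OF M]]) (simp add: assms(2))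

lemma homotopy_add:
  assumes f: "f \<in> Cinf P"
  shows "homotopy k l (\<lambda>f a u. B f a u + B' f a u) f u = homotopy k l B f u + homotopy k l B' f u"
  unfolding homotopy_def glue_linear(1)[symmetric]
  by (intro glue_cong tensorial_linear(1)[OF tensorial_fuse'[OF f] Cinf_one[OF M]])

lemma homotopy_mult:
  assumes f: "f \<in> Cinf P"
  shows "homotopy k l (\<lambda>f a u. c u * B f a u) f u = c u * homotopy k l B f u"
  unfolding homotopy_def glue_linear(2)[symmetric]
  by (intro glue_cong tensorial_linear(2)[OF tensorial_fuse'[OF f] Cinf_one[OF M]])

text \<open>Fusing leaves such an operator unchanged, so every patch contributes the same value
  \<open>D f\<close>.\<close>

lemma homotopy_rmul:
  assumes "linear_op P P D" and f: "f \<in> Cinf P" shows "homotopy k l (\<lambda>f a. D (rmul f a)) f = D f"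
proof
  fix u
  have C: "D f \<in> Cinf P" using assms by (auto simp: linear_op_def)
  show "homotopy k l (\<lambda>f a. D (rmul f a)) f u = D f u"
  proof (cases "u \<in> points P")
    case True
    then show ?thesis unfolding homotopy_def fuse_rmul by (rule glue_const) (simp add: rmul_one[OF f])
  qed (simp add: homotopy_def glue_outside Cinf_zero_outside[OF C])
qed

lemma e_nz: "e n u \<noteq> 0 \<Longrightarrow> principal_patch.nz P p (\<eta> n) u"
  unfolding principal_patch.nz_def[OF principal_patch] by (auto simp: pullback_def split: if_splits)

text \<open>Naturality in \<open>B\<close> turns the extra factor into the second argument of the
  fused operator, and this operator allows it to be moved over to \<open>f\<close>.\<close>

lemma homotopy_mult_argument:
  assumes B: "bidiff k l B" and f: "f \<in> Cinf P" and b: "b \<in> Cinf M"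
  shows "homotopy k l (\<lambda>f a. B f (\<lambda>x. a x * b x)) f = homotopy k l B (rmul f b)"
  unfolding homotopy_def
proof (intro ext glue_cong)
  fix u n assume "e n u \<noteq> 0"
  note nz = e_nz[OF this]
  have "fuse k l (\<xi> n) (X n) m (\<lambda>f a. B f (\<lambda>x. a x * b x)) f (one_fun M) u = fuse k l (\<xi> n) (X n) m B f b u"
    using tensorial_mult_argument[OF tensorial_fuse'[OF f] Cinf_one[OF M] b] one_mult(1)[OF b] by metis
  also have "\<dots> = fuse k l (\<xi> n) (X n) m B (rmul f b) (one_fun M) u"
    by (rule principal_patch.fuse_eq_rmul[OF principal_patch B f b nz])
  finally show "fuse k l (\<xi> n) (X n) m (\<lambda>f a. B f (\<lambda>x. a x * b x)) f (one_fun M) u =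
     fuse k l (\<xi> n) (X n) m B (rmul f b) (one_fun M) u" .
qed

text \<open>A pullback is 1 times a base function. The base function moves to the second argument,
  and at \<open>f = 1\<close> fusing has no effect. This is the source of compatibility with the
  fibration.\<close>

lemma homotopy_pullback:
  assumes B: "bidiff k l B" and c: "c \<in> Cinf M"
  shows "homotopy k l B (pb_p c) = B (one_fun P) c"
proof
  fix u
  have C: "B (one_fun P) c \<in> Cinf P" by (rule bidiff_Cinf[OF B Cinf_one[OF P] c])
  show "homotopy k l B (pb_p c) u = B (one_fun P) c u"
  proof (cases "u \<in> points P")
    case True
    show ?thesis unfolding homotopy_def
    proof (rule glue_const[OF True])
      fix n assume "e n u \<noteq> 0"
      note nz = e_nz[OF this]
      have "fuse k l (\<xi> n) (X n) m B (pb_p c) (one_fun M) u = fuse k l (\<xi> n) (X n) m B (one_fun P) c u"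
        using principal_patch.fuse_eq_rmul[OF principal_patch B Cinf_one[OF P] c nz] one_rmul[OF c] by simp
      also have "\<dots> = B (one_fun P) c u"
        using fuse_one[OF B _ c, of m "\<xi> n" "X n"] patchD by simp
      finally show "fuse k l (\<xi> n) (X n) m B (pb_p c) (one_fun M) u = B (one_fun P) c u" .
    qed
  qed (simp add: homotopy_def glue_outside Cinf_zero_outside[OF C])
qed

lemma homotopy_invariant:
  assumes B: "invariant B" and g: "g \<in> carrier G" and f: "f \<in> Cinf P"
  shows "homotopy k l B (tr g f) = tr g (homotopy k l B f)"
proof
  fix u
  have inv: "fuse k l (\<xi> n) (X n) m B (tr g f) (one_fun M) = tr g (fuse k l (\<xi> n) (X n) m B f (one_fun M))" for n
  proof -
    have "invariant (fuse k l (\<xi> n) (X n) m B)" by (rule invariant_fuse[OF B]) (use patchD in auto)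
    then show ?thesis using g f Cinf_one[OF M] by (simp add: invariant_def)
  qed
  show "homotopy k l B (tr g f) u = tr g (homotopy k l B f) u"
  proof (cases "u \<in> points P")
    case True
    have "e n (r u g) = e n u" for n
      using True r_closed[OF True g] p_r[OF True g] by (simp add: pullback_def)
    then show ?thesis using True unfolding homotopy_def glue_def inv by (simp add: pullback_def[of P "\<lambda>u. r u g"])
  qed (simp add: homotopy_def glue_outside pullback_def)
qed

text \<open>Contracting a 2-cochain treats its last argument as a parameter; the contraction has to
  remain a differential operator in it.\<close>

lemma homotopy_parameter:
  assumes "\<And>f a. f \<in> Cinf P \<Longrightarrow> a \<in> Cinf M \<Longrightarrow> diffop_lt M P p s (\<lambda>b. B b f a)" and f: "f \<in> Cinf P"
  shows "diffop_lt M P p s (\<lambda>b. homotopy k l (B b) f)"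
proof -
  have "diffop_lt M P p s (glue (\<lambda>n b. fuse k l (\<xi> n) (X n) m (B b) f (one_fun M)))"
    by (intro glue_diffop_lt[OF pm.smooth_pullback_axioms] tensorial_diffop_lt[OF tensorial_fuse'[OF f] Cinf_one[OF M]] assms(1))
  moreover have "(\<lambda>b. homotopy k l (B b) f) = glue (\<lambda>n b. fuse k l (\<xi> n) (X n) m (B b) f (one_fun M))"
    by (simp add: homotopy_def glue_def fun_eq_iff)
  ultimately show ?thesis by simp
qed

end

section \<open>Order by order construction\<close>

text \<open>The sum over all \<open>i + j + k = n\<close>, as a common form for the nested sums that
  arise from composing three formal series of operators.\<close>

definition tri :: "(nat \<Rightarrow> nat \<Rightarrow> nat \<Rightarrow> 'a::comm_monoid_add) \<Rightarrow> nat \<Rightarrow> 'a"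
  where "tri h n = (\<Sum>(i, j)\<in>{(i, j). i + j \<le> n}. h i j (n - i - j))"

lemma tri_12: "tri h n = (\<Sum>i\<le>n. \<Sum>j\<le>n - i. h i j (n - i - j))"
proof -
  have "(\<Sum>i\<le>n. \<Sum>j\<le>n - i. h i j (n - i - j)) = (\<Sum>(i, j)\<in>(SIGMA i:{..n}. {..n - i}). h i j (n - i - j))"
    by (rule sum.Sigma) auto
  also have "(SIGMA i:{..n}. {..n - i}) = {(i, j). i + j \<le> n}" by auto
  finally show ?thesis by (simp add: tri_def)
qed

lemma tri_31: "tri h n = (\<Sum>k\<le>n. \<Sum>i\<le>n - k. h i (n - k - i) k)"
proof -
  have "tri h n = tri (\<lambda>k i j. h i j k) n" unfolding tri_def
    by (rule sum.reindex_bij_witness[where j="\<lambda>(i, j). (n - i - j, i)" and i="\<lambda>(k, i). (i, n - k - i)"]) auto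
  then show ?thesis by (simp add: tri_12)
qed

lemma tri_21: "tri h n = (\<Sum>j\<le>n. \<Sum>i\<le>n - j. h i j (n - j - i))"
proof -
  have "tri h n = tri (\<lambda>j i k. h i j k) n" unfolding tri_def
    by (rule sum.reindex_bij_witness[where j="\<lambda>(i, j). (j, i)" and i="\<lambda>(i, j). (j, i)"]) (auto simp: add.commute)
  then show ?thesis by (simp add: tri_12)
qed

lemma tri_swap: "tri (\<lambda>i k j. h i j k) n = tri h n"
  unfolding tri_def
  by (rule sum.reindex_bij_witness[where j="\<lambda>(i, k). (i, n - i - k)" and i="\<lambda>(i, j). (i, n - i - j)"]) auto

lemma sum_leading:
  fixes f :: "nat \<Rightarrow> 'a::comm_monoid_add"
  assumes "\<And>j. 0 < j \<Longrightarrow> j \<le> n \<Longrightarrow> f j = 0" shows "(\<Sum>j\<le>n. f j) = f 0"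
proof -
  have "(\<Sum>j\<le>n. f j) = (\<Sum>j\<in>{0}. f j)" by (rule sum.mono_neutral_right) (use assms in auto)
  then show ?thesis by simp
qed

lemma sum_trailing:
  fixes f :: "nat \<Rightarrow> 'a::comm_monoid_add"
  assumes "\<And>j. j < n \<Longrightarrow> f j = 0" shows "(\<Sum>j\<le>n. f j) = f n"
proof -
  have "(\<Sum>j\<le>n. f j) = (\<Sum>j\<in>{n}. f j)" by (rule sum.mono_neutral_right) (use assms in auto)
  then show ?thesis by simp
qed

lemma common_bound:
  fixes Q :: "nat \<Rightarrow> nat \<Rightarrow> bool"
  assumes "\<And>i. \<exists>N. Q i N" "\<And>i N N'. Q i N \<Longrightarrow> N \<le> N' \<Longrightarrow> Q i N'"
  shows "\<exists>N. \<forall>i\<le>r. Q i N"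
proof (induction r)
  case 0
  then show ?case using assms(1) by auto
next
  case (Suc r)
  then obtain N N' where "\<forall>i\<le>r. Q i N" "Q (Suc r) N'" using assms(1) by blast
  then have "\<forall>i\<le>Suc r. Q i (max N N')" using assms(2) by (metis le_SucE max.cobounded1 max.cobounded2)
  then show ?case by blast
qed

locale star_coefficients = principal_partition P M GM G r p \<eta> \<xi> X
  for P :: "'p manifold" and M :: "'m manifold" and GM :: "'g manifold" and G :: "'g monoid"
    and r :: "'p \<Rightarrow> 'g \<Rightarrow> 'p" and p :: "'p \<Rightarrow> 'm" and \<eta> \<xi> X +
  fixes C :: "nat \<Rightarrow> ('m \<Rightarrow> complex) \<Rightarrow> ('m \<Rightarrow> complex) \<Rightarrow> 'm \<Rightarrow> complex"
  assumes C_bidiff: "\<exists>N. (\<forall>b\<in>Cinf M. diffop_lt M M (\<lambda>x. x) N (\<lambda>a. C i a b)) \<and> (\<forall>a\<in>Cinf M. diffop_lt M M (\<lambda>x. x) N (C i a))"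
    and C_0: "a \<in> Cinf M \<Longrightarrow> b \<in> Cinf M \<Longrightarrow> C 0 a b = (\<lambda>x. a x * b x)"
    and C_assoc: "a \<in> Cinf M \<Longrightarrow> b \<in> Cinf M \<Longrightarrow> c \<in> Cinf M \<Longrightarrow>
      (\<Sum>i\<le>n. C i (C (n - i) a b) c x) = (\<Sum>i\<le>n. C i a (C (n - i) b c) x)"
    and C_one: "0 < i \<Longrightarrow> a \<in> Cinf M \<Longrightarrow> C i (one_fun M) a = (\<lambda>x. 0)" "0 < i \<Longrightarrow> a \<in> Cinf M \<Longrightarrow> C i a (one_fun M) = (\<lambda>x. 0)"
begin

lemma C_linear: "b \<in> Cinf M \<Longrightarrow> linear_op M M (\<lambda>a. C i a b)" "a \<in> Cinf M \<Longrightarrow> linear_op M M (C i a)"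
  using C_bidiff[of i] mm.diffop_lt_linear by blast+

lemma C_Cinf: "a \<in> Cinf M \<Longrightarrow> b \<in> Cinf M \<Longrightarrow> C i a b \<in> Cinf M"
  using linear_opD(1)[OF C_linear(2)] by blast

definition module_at :: "(nat \<Rightarrow> ('p, 'm) bop) \<Rightarrow> nat \<Rightarrow> bool"
  where "module_at \<rho> n \<longleftrightarrow> (\<forall>f\<in>Cinf P. \<forall>a\<in>Cinf M. \<forall>b\<in>Cinf M. \<forall>u.
    (\<Sum>i\<le>n. \<rho> i (\<rho> (n - i) f a) b u) = (\<Sum>i\<le>n. \<rho> i f (C (n - i) a b) u))"

definition bidiffs :: "(nat \<Rightarrow> ('p, 'm) bop) \<Rightarrow> bool"
  where "bidiffs \<rho> \<longleftrightarrow> (\<forall>i. \<exists>N. bidiff N N (\<rho> i)) \<and> (\<forall>f\<in>Cinf P. \<forall>a\<in>Cinf M. \<rho> 0 f a = rmul f a)"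

lemma bidiffsD:
  assumes "bidiffs \<rho>"
  shows "a \<in> Cinf M \<Longrightarrow> linear_op P P (\<lambda>f. \<rho> i f a)" "f \<in> Cinf P \<Longrightarrow> linear_op M P (\<rho> i f)"
    "f \<in> Cinf P \<Longrightarrow> a \<in> Cinf M \<Longrightarrow> \<rho> i f a \<in> Cinf P" "f \<in> Cinf P \<Longrightarrow> a \<in> Cinf M \<Longrightarrow> \<rho> 0 f a = rmul f a"
    "\<exists>N. bidiff N N (\<rho> i)"
  using assms bidiff_linear bidiff_Cinf unfolding bidiffs_def by blast+

lemma bidiff_rmul: "bidiff 1 1 rmul"
  unfolding bidiff_def
proof (intro conjI ballI)
  fix a assume a: "a \<in> Cinf M"
  show "diffop_lt P P (\<lambda>u. u) 1 (\<lambda>f. rmul f a)"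
    using diffop_lt_multiplication[OF P pb_p_Cinf[OF a]] by (simp add: rmul_def[abs_def] mult.commute)
next
  fix f assume f: "f \<in> Cinf P"
  show "diffop_lt M P p 1 (rmul f)"
    using pm.diffop_lt_mult_left[OF Cinf_mult[OF P f] pm.diffop_lt_pullback[OF p_closed]]
    by (simp add: rmul_def[abs_def])
qed

subsection \<open>Uniqueness\<close>

context
  fixes \<rho> \<rho>' :: "nat \<Rightarrow> ('p, 'm) bop" and T :: "nat \<Rightarrow> ('p \<Rightarrow> complex) \<Rightarrow> 'p \<Rightarrow> complex"
  assumes \<rho>: "bidiffs \<rho>" and \<rho>': "bidiffs \<rho>'" and mod: "\<And>n. module_at \<rho> n" and mod': "\<And>n. module_at \<rho>' n"
    and T: "\<And>i. linear_op P P (T i)"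
begin

text \<open>The coefficient of order \<open>n\<close> of the failure of \<open>T\<close> to intertwine \<open>\<rho>\<close> and \<open>\<rho>'\<close>; its leading
  coefficient is a 1-cocycle.\<close>

definition defect1 :: "nat \<Rightarrow> ('p, 'm) bop"
  where "defect1 n = (\<lambda>f a u. \<Sum>i\<le>n. \<rho>' i (T (n - i) f) a u - T i (\<rho> (n - i) f a) u)"

text \<open>Every sum expands into triple sums. The module conditions rewrite the left side as terms
  \<open>\<rho>' \<rho>' T\<close> minus terms \<open>T \<rho> \<rho>\<close>; on the right the
  mixed terms \<open>\<rho>' T \<rho>\<close> cancel. No assumption is made on how far
  \<open>T\<close> intertwines.\<close>

lemma defect1_cocycle:
  assumes f: "f \<in> Cinf P" and a: "a \<in> Cinf M" and b: "b \<in> Cinf M"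
  shows "(\<Sum>j\<le>n. defect1 (n - j) f (C j a b) u) =
    (\<Sum>j\<le>n. \<rho>' j (defect1 (n - j) f a) b u) + (\<Sum>j\<le>n. defect1 (n - j) (\<rho> j f a) b u)"
proof -
  note [simp] = f a b C_Cinf bidiffsD(3)[OF \<rho>] bidiffsD(3)[OF \<rho>'] linear_opD(1)[OF T]
  have "(\<Sum>j\<le>n. defect1 (n - j) f (C j a b) u) =
     (\<Sum>j\<le>n. \<Sum>i\<le>n - j. \<rho>' i (T (n - j - i) f) (C j a b) u - T i (\<rho> (n - j - i) f (C j a b)) u)"
    by (simp add: defect1_def)
  also have "\<dots> = tri (\<lambda>i k j. \<rho>' i (T k f) (C j a b) u) n - tri (\<lambda>i k j. T i (\<rho> k f (C j a b)) u) n"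
    by (simp add: tri_31 sum_subtractf)
  also have "tri (\<lambda>i k j. \<rho>' i (T k f) (C j a b) u) n = (\<Sum>k\<le>n. \<Sum>i\<le>n - k. \<rho>' i (T k f) (C (n - k - i) a b) u)"
    by (rule tri_21)
  also have "\<dots> = (\<Sum>k\<le>n. \<Sum>i\<le>n - k. \<rho>' i (\<rho>' (n - k - i) (T k f) a) b u)"
  proof (rule sum.cong[OF refl])
    fix k
    show "(\<Sum>i\<le>n - k. \<rho>' i (T k f) (C (n - k - i) a b) u) = (\<Sum>i\<le>n - k. \<rho>' i (\<rho>' (n - k - i) (T k f) a) b u)"
      using mod'[of "n - k", unfolded module_at_def, rule_format, of "T k f" a b u] by simp
  qed
  also have "\<dots> = tri (\<lambda>i j k. \<rho>' i (\<rho>' j (T k f) a) b u) n" by (rule tri_31[symmetric])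
  also have "tri (\<lambda>i k j. T i (\<rho> k f (C j a b)) u) n = (\<Sum>i\<le>n. \<Sum>k\<le>n - i. T i (\<rho> k f (C (n - i - k) a b)) u)"
    by (rule tri_12)
  also have "\<dots> = (\<Sum>i\<le>n. T i (\<lambda>u. \<Sum>k\<le>n - i. \<rho> k f (C (n - i - k) a b) u) u)"
    by (simp add: linear_op_sum[OF T P])
  also have "\<dots> = (\<Sum>i\<le>n. T i (\<lambda>u. \<Sum>k\<le>n - i. \<rho> k (\<rho> (n - i - k) f a) b u) u)"
  proof -
    have "(\<lambda>u. \<Sum>k\<le>q. \<rho> k f (C (q - k) a b) u) = (\<lambda>u. \<Sum>k\<le>q. \<rho> k (\<rho> (q - k) f a) b u)" for q
      using mod unfolding module_at_def by (simp add: fun_eq_iff)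
    then show ?thesis by (simp only:)
  qed
  also have "\<dots> = (\<Sum>i\<le>n. \<Sum>k\<le>n - i. T i (\<rho> k (\<rho> (n - i - k) f a) b) u)"
    by (simp add: linear_op_sum[OF T P])
  also have "\<dots> = tri (\<lambda>i k j. T i (\<rho> k (\<rho> j f a) b) u) n" by (rule tri_12[symmetric])
  finally have A: "(\<Sum>j\<le>n. defect1 (n - j) f (C j a b) u) =
     tri (\<lambda>i j k. \<rho>' i (\<rho>' j (T k f) a) b u) n - tri (\<lambda>i k j. T i (\<rho> k (\<rho> j f a) b) u) n" .
  have "\<rho>' j (defect1 q f a) b u = (\<Sum>i\<le>q. \<rho>' j (\<rho>' i (T (q - i) f) a) b u - \<rho>' j (T i (\<rho> (q - i) f a)) b u)" for j q
    unfolding defect1_def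
    by (simp add: linear_op_sum[OF bidiffsD(1)[OF \<rho>'] P] Cinf_minus[OF P] linear_op_diff[OF bidiffsD(1)[OF \<rho>'] P])
  then have "(\<Sum>j\<le>n. \<rho>' j (defect1 (n - j) f a) b u) =
      tri (\<lambda>j i k. \<rho>' j (\<rho>' i (T k f) a) b u) n - tri (\<lambda>j i k. \<rho>' j (T i (\<rho> k f a)) b u) n"
    by (simp add: tri_12 sum_subtractf)
  moreover have "(\<Sum>j\<le>n. defect1 (n - j) (\<rho> j f a) b u) =
      tri (\<lambda>i k j. \<rho>' i (T k (\<rho> j f a)) b u) n - tri (\<lambda>i k j. T i (\<rho> k (\<rho> j f a) b) u) n"
    by (simp add: defect1_def tri_31 sum_subtractf)
  ultimately show ?thesis using A by simp
qed

lemma defect1_leading_cocycle: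
  assumes z: "\<And>n f a. n < s \<Longrightarrow> f \<in> Cinf P \<Longrightarrow> a \<in> Cinf M \<Longrightarrow> defect1 n f a = (\<lambda>u. 0)"
    and f: "f \<in> Cinf P" and a: "a \<in> Cinf M" and b: "b \<in> Cinf M"
  shows "defect1 s f (\<lambda>x. a x * b x) u = pb_p b u * defect1 s f a u + defect1 s (rmul f a) b u"
proof -
  note [simp] = f a b C_Cinf bidiffsD(3)[OF \<rho>] bidiffsD(3)[OF \<rho>'] linear_opD(1)[OF T]
  have "(\<Sum>j\<le>s. defect1 (s - j) f (C j a b) u) = defect1 (s - 0) f (C 0 a b) u"
    by (rule sum_leading) (simp add: z)
  moreover have "(\<Sum>j\<le>s. \<rho>' j (defect1 (s - j) f a) b u) = \<rho>' 0 (defect1 (s - 0) f a) b u"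
    by (rule sum_leading) (simp add: z linear_op_zero[OF bidiffsD(1)[OF \<rho>' b] f])
  moreover have "(\<Sum>j\<le>s. defect1 (s - j) (\<rho> j f a) b u) = defect1 (s - 0) (\<rho> 0 f a) b u"
    by (rule sum_leading) (simp add: z)
  moreover have "defect1 s f a \<in> Cinf P"
    unfolding defect1_def by (intro Cinf_sum[OF P] Cinf_minus[OF P]) simp_all
  ultimately show ?thesis
    using defect1_cocycle[OF f a b, of s u] bidiffsD(4)[OF \<rho>] bidiffsD(4)[OF \<rho>'] C_0[OF a b]
    by (simp add: rmul_def mult.commute[of "pb_p b u"])
qed

end

definition intertwines_at :: "(nat \<Rightarrow> ('p, 'm) bop) \<Rightarrow> (nat \<Rightarrow> ('p, 'm) bop) \<Rightarrow> (nat \<Rightarrow> ('p \<Rightarrow> complex) \<Rightarrow> 'p \<Rightarrow> complex) \<Rightarrow> nat \<Rightarrow> bool"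
  where "intertwines_at \<rho> \<rho>' T n \<longleftrightarrow> (\<forall>f\<in>Cinf P. \<forall>a\<in>Cinf M. \<forall>u.
    (\<Sum>i\<le>n. T i (\<rho> (n - i) f a) u) = (\<Sum>i\<le>n. \<rho>' i (T (n - i) f) a u))"

lemma intertwiner_step:
  assumes \<rho>: "bidiffs \<rho>" and \<rho>': "bidiffs \<rho>'" and mod: "\<And>n. module_at \<rho> n" and mod': "\<And>n. module_at \<rho>' n"
    and inv: "\<And>i. invariant (\<rho> i)" "\<And>i. invariant (\<rho>' i)"
    and T: "\<And>i. i < s \<Longrightarrow> \<exists>K. diffop_lt P P (\<lambda>u. u) K (T i)"
    and Tinv: "\<And>i g f. i < s \<Longrightarrow> g \<in> carrier G \<Longrightarrow> f \<in> Cinf P \<Longrightarrow> T i (tr g f) = tr g (T i f)"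
    and T0: "T 0 = (\<lambda>f. f)" and s: "0 < s"
    and int: "\<And>n. n < s \<Longrightarrow> intertwines_at \<rho> \<rho>' T n"
  shows "\<exists>R K. diffop_lt P P (\<lambda>u. u) K R \<and> (\<forall>g\<in>carrier G. \<forall>f\<in>Cinf P. R (tr g f) = tr g (R f)) \<and>
    intertwines_at \<rho> \<rho>' (T(s := R)) s"
proof -
  \<comment> \<open>With the unknown terms set to 0, \<open>defect1 s\<close> is the obstruction at
    order \<open>s\<close>. Inserting \<open>R\<close> changes it by
    \<open>\<rho>' 0 (R f) a - R (\<rho> 0 f a)\<close>, so this difference has to be cancelled
    against it.\<close>
  define T' where "T' = (\<lambda>i. if i < s then T i else (\<lambda>f u. 0))"
  have T'_diffop: "\<exists>K. diffop_lt P P (\<lambda>u. u) K (T' i)" for i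
    using T[of i] pp.diffop_lt_zero by (cases "i < s") (auto simp: T'_def)
  have T'_linear: "linear_op P P (T' i)" for i using T'_diffop pp.diffop_lt_linear by blast
  note TC = linear_opD(1)[OF T'_linear] and \<rho>C = bidiffsD(3)[OF \<rho>] and \<rho>'C = bidiffsD(3)[OF \<rho>']
  have T'inv: "T' i (tr g f) = tr g (T' i f)" if "g \<in> carrier G" "f \<in> Cinf P" for i g f
    using Tinv[OF _ that] by (auto simp: T'_def pullback_def)
  let ?\<Phi> = "defect1 \<rho> \<rho>' T'"
  note D = defect1_def[OF \<rho> \<rho>' mod mod' T'_linear]
  have z: "?\<Phi> n f a = (\<lambda>u. 0)" if "n < s" "f \<in> Cinf P" "a \<in> Cinf M" for n f a
  proof -
    have T: "T' i = T i" if "i \<le> n" for i using that \<open>n < s\<close> by (simp add: T'_def)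
    show ?thesis
      using int[OF that(1)] that(2,3) by (simp add: D sum_subtractf intertwines_at_def T)
  qed
  have "\<exists>N. \<forall>i\<le>s. bidiff N N (\<rho> i) \<and> bidiff N N (\<rho>' i) \<and> diffop_lt P P (\<lambda>u. u) N (T' i)"
  proof (rule common_bound)
    fix i
    obtain N1 N2 N3 where "bidiff N1 N1 (\<rho> i)" "bidiff N2 N2 (\<rho>' i)" "diffop_lt P P (\<lambda>u. u) N3 (T' i)"
      using bidiffsD(5)[OF \<rho>] bidiffsD(5)[OF \<rho>'] T'_diffop by metis
    then show "\<exists>N. bidiff N N (\<rho> i) \<and> bidiff N N (\<rho>' i) \<and> diffop_lt P P (\<lambda>u. u) N (T' i)"
      by (intro exI[of _ "max N1 (max N2 N3)"]) (auto intro: bidiff_mono pp.diffop_lt_mono)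
  qed (auto intro: bidiff_mono pp.diffop_lt_mono)
  then obtain N where N: "\<And>i. i \<le> s \<Longrightarrow> bidiff N N (\<rho> i)" "\<And>i. i \<le> s \<Longrightarrow> bidiff N N (\<rho>' i)"
    "\<And>i. i \<le> s \<Longrightarrow> diffop_lt P P (\<lambda>u. u) N (T' i)" by blast
  have bd: "bidiff (N + N) (N + N) (?\<Phi> s)"
    unfolding D
  proof (intro bidiff_sum bidiff_diff)
    fix i assume "i \<in> {..s}"
    then have i: "i \<le> s" "s - i \<le> s" by auto
    show "bidiff (N + N) (N + N) (\<lambda>f. \<rho>' i (T' (s - i) f))"
      unfolding bidiff_def
    proof (intro conjI ballI)
      show "diffop_lt P P (\<lambda>u. u) (N + N) (\<lambda>f. \<rho>' i (T' (s - i) f) a)" if "a \<in> Cinf M" for a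
        by (rule diffop_lt_compose_left[OF pp.smooth_pullback_axioms N(3)[OF i(2)] bidiffD(1)[OF N(2)[OF i(1)] that]])
      show "diffop_lt M P p (N + N) (\<rho>' i (T' (s - i) f))" if "f \<in> Cinf P" for f
        by (rule pm.diffop_lt_mono[OF bidiffD(2)[OF N(2)[OF i(1)] TC[OF that]]]) simp
    qed
    show "bidiff (N + N) (N + N) (\<lambda>f a. T' i (\<rho> (s - i) f a))"
      unfolding bidiff_def
    proof (intro conjI ballI)
      show "diffop_lt P P (\<lambda>u. u) (N + N) (\<lambda>f. T' i (\<rho> (s - i) f a))" if "a \<in> Cinf M" for a
        by (rule diffop_lt_compose_left[OF pp.smooth_pullback_axioms bidiffD(1)[OF N(1)[OF i(2)] that] N(3)[OF i(1)]])
      show "diffop_lt M P p (N + N) (\<lambda>a. T' i (\<rho> (s - i) f a))" if "f \<in> Cinf P" for f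
        by (rule diffop_lt_compose_left[OF pm.smooth_pullback_axioms bidiffD(2)[OF N(1)[OF i(2)] that] N(3)[OF i(1)]])
    qed
  qed
  define R where "R = homotopy (N + N) (N + N) (?\<Phi> s)"
  have inv\<Phi>: "invariant (?\<Phi> s)"
    unfolding invariant_def
  proof (intro ballI)
    fix g f a assume g: "g \<in> carrier G" and f: "f \<in> Cinf P" and a: "a \<in> Cinf M"
    have "\<rho>' i (T' (s - i) (tr g f)) a = tr g (\<rho>' i (T' (s - i) f) a)"
      "T' i (\<rho> (s - i) (tr g f) a) = tr g (T' i (\<rho> (s - i) f a))" for i
      using inv g f a TC \<rho>C T'inv by (simp_all add: invariant_def)
    then have "?\<Phi> s (tr g f) a = (\<lambda>u. \<Sum>i\<le>s. tr g (\<rho>' i (T' (s - i) f) a) u - tr g (T' i (\<rho> (s - i) f a)) u)"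
      by (simp only: D)
    also have "\<dots> = tr g (?\<Phi> s f a)" by (auto simp: D pullback_def)
    finally show "?\<Phi> s (tr g f) a = tr g (?\<Phi> s f a)" .
  qed
  \<comment> \<open>Contract the cocycle identity in \<open>a\<close>. The left side becomes
    \<open>R (rmul f b)\<close>; on the right the first term becomes \<open>pb_p b * R f\<close>,
    and the second, which involves only \<open>rmul f a\<close>, becomes the defect itself.\<close>
  have coboundary: "R (rmul f b) u = pb_p b u * R f u + ?\<Phi> s f b u" if f: "f \<in> Cinf P" and b: "b \<in> Cinf M" for f b u
  proof -
    have "R (rmul f b) u = homotopy (N + N) (N + N) (\<lambda>f a. ?\<Phi> s f (\<lambda>x. a x * b x)) f u"
      unfolding R_def by (simp add: homotopy_mult_argument[OF bd f b])
    also have "\<dots> = homotopy (N + N) (N + N) (\<lambda>f a u. pb_p b u * ?\<Phi> s f a u + ?\<Phi> s (rmul f a) b u) f u"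
      by (rule fun_cong[OF homotopy_cong[OF f]], rule ext)
        (rule defect1_leading_cocycle[OF \<rho> \<rho>' mod mod' T'_linear z _ _ b])
    also have "\<dots> = pb_p b u * R f u + ?\<Phi> s f b u"
      unfolding R_def
      using homotopy_add[OF f, of "N + N" "N + N" "\<lambda>f a u. pb_p b u * ?\<Phi> s f a u" "\<lambda>f a. ?\<Phi> s (rmul f a) b" u]
        homotopy_mult[OF f, of "N + N" "N + N" "pb_p b" "?\<Phi> s" u]
        homotopy_rmul[OF bidiff_linear(1)[OF bd b] f] by simp
    finally show ?thesis .
  qed
  have "intertwines_at \<rho> \<rho>' (T(s := R)) s"
    unfolding intertwines_at_def
  proof (intro ballI allI)
    fix f a u assume f: "f \<in> Cinf P" and a: "a \<in> Cinf M"
    have "R f \<in> Cinf P" unfolding R_def by (rule linear_opD(1)[OF homotopy_linear_op[OF bd] f])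
    then have c: "R (\<rho> 0 f a) u - \<rho>' 0 (R f) a u = ?\<Phi> s f a u"
      using coboundary[OF f a, of u] bidiffsD(4)[OF \<rho> f a] bidiffsD(4)[OF \<rho>' _ a] by (simp add: rmul_def)
    have T: "T' s = (\<lambda>f u. 0)" "\<And>i. i < s \<Longrightarrow> T' i = T i" by (auto simp: T'_def)
    have "(\<Sum>i\<le>s. (T(s := R)) i (\<rho> (s - i) f a) u) = (\<Sum>i<s. T i (\<rho> (s - i) f a) u) + R (\<rho> 0 f a) u"
      by (simp add: lessThan_Suc_atMost[symmetric])
    moreover have "(\<Sum>i\<le>s. T' i (\<rho> (s - i) f a) u) = (\<Sum>i<s. T i (\<rho> (s - i) f a) u)"
      by (simp add: lessThan_Suc_atMost[symmetric] T)
    moreover have "(\<Sum>i\<le>s. \<rho>' i ((T(s := R)) (s - i) f) a u) = \<rho>' 0 (R f) a u + (\<Sum>i\<in>{..s} - {0}. \<rho>' i (T (s - i) f) a u)"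
      using s by (subst sum.remove[of _ 0]) (auto intro!: sum.cong split: if_splits)
    moreover have "(\<Sum>i\<le>s. \<rho>' i (T' (s - i) f) a u) = (\<Sum>i\<in>{..s} - {0}. \<rho>' i (T (s - i) f) a u)"
      using s linear_op_zero[OF bidiffsD(1)[OF \<rho>' a] f]
      by (subst sum.remove[of _ 0]) (auto intro!: sum.cong simp: T)
    ultimately show "(\<Sum>i\<le>s. (T(s := R)) i (\<rho> (s - i) f a) u) = (\<Sum>i\<le>s. \<rho>' i ((T(s := R)) (s - i) f) a u)"
      using c by (simp add: D sum_subtractf algebra_simps)
  qed
  moreover have "diffop_lt P P (\<lambda>u. u) (fuse_order (N + N) (N + N) m) R"
    unfolding R_def by (rule homotopy_diffop_lt[OF bd])
  moreover have "R (tr g f) = tr g (R f)" if "g \<in> carrier G" "f \<in> Cinf P" for g f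
    unfolding R_def by (rule homotopy_invariant[OF inv\<Phi> that])
  ultimately show ?thesis by blast
qed

lemma intertwiner_exists:
  assumes \<rho>: "bidiffs \<rho>" and \<rho>': "bidiffs \<rho>'" and mod: "\<And>n. module_at \<rho> n" and mod': "\<And>n. module_at \<rho>' n"
    and inv: "\<And>i. invariant (\<rho> i)" "\<And>i. invariant (\<rho>' i)"
  shows "\<exists>T. T 0 = (\<lambda>f. f) \<and> (\<forall>i. \<exists>K. diffop_lt P P (\<lambda>u. u) K (T i)) \<and>
    (\<forall>i. \<forall>g\<in>carrier G. \<forall>f\<in>Cinf P. T i (tr g f) = tr g (T i f)) \<and> (\<forall>n. intertwines_at \<rho> \<rho>' T n)"
proof -
  define Q where "Q T s R \<longleftrightarrow> (s = 0 \<longrightarrow> R = (\<lambda>f. f)) \<and> (\<exists>K. diffop_lt P P (\<lambda>u. u) K R) \<and>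
    (\<forall>g\<in>carrier G. \<forall>f\<in>Cinf P. R (tr g f) = tr g (R f)) \<and> intertwines_at \<rho> \<rho>' (T(s := R)) s" for T s R
  \<comment> \<open>\<open>Q\<close> constrains the term of order \<open>s\<close> through the
    earlier terms only, so the terms can be chosen by well-founded recursion.\<close>
  have "\<exists>T. \<forall>s. Q T s (T s)"
  proof (rule dependent_wf_choice[OF wf_less])
    fix T T' :: "nat \<Rightarrow> ('p \<Rightarrow> complex) \<Rightarrow> 'p \<Rightarrow> complex" and s R
    assume eq: "\<And>z. (z, s) \<in> {(x, y). x < y} \<Longrightarrow> T z = T' z"
    have "intertwines_at \<rho> \<rho>' (T(s := R)) s = intertwines_at \<rho> \<rho>' (T'(s := R)) s"
    proof -
      have "(T(s := R)) i = (T'(s := R)) i" if "i \<le> s" for i using that eq by (cases "i = s") auto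
      then show ?thesis unfolding intertwines_at_def by simp
    qed
    then show "Q T s R = Q T' s R" by (simp add: Q_def)
  next
    fix s and T :: "nat \<Rightarrow> ('p \<Rightarrow> complex) \<Rightarrow> 'p \<Rightarrow> complex"
    assume "\<And>y. (y, s) \<in> {(x, y). x < y} \<Longrightarrow> Q T y (T y)"
    then have IH: "Q T y (T y)" if "y < s" for y using that by simp
    show "\<exists>R. Q T s R"
    proof (cases "s = 0")
      case True
      have "Q T s (\<lambda>f. f)"
        using True diffop_lt_identity[OF P] bidiffsD(4)[OF \<rho>] bidiffsD(4)[OF \<rho>']
        by (auto simp: Q_def intertwines_at_def)
      then show ?thesis by blast
    next
      case False
      have T0: "T 0 = (\<lambda>f. f)" using IH[of 0] False by (simp add: Q_def)
      have "\<exists>R K. diffop_lt P P (\<lambda>u. u) K R \<and> (\<forall>g\<in>carrier G. \<forall>f\<in>Cinf P. R (tr g f) = tr g (R f)) \<and>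
        intertwines_at \<rho> \<rho>' (T(s := R)) s"
      proof (rule intertwiner_step[OF \<rho> \<rho>' mod mod' inv(1) inv(2)])
        show "intertwines_at \<rho> \<rho>' T n" if "n < s" for n
          using IH[OF that] by (simp add: Q_def)
      qed (use IH False T0 in \<open>auto simp: Q_def\<close>)
      then show ?thesis using False by (auto simp: Q_def)
    qed
  qed
  then obtain T where T: "\<And>s. Q T s (T s)" by blast
  then show ?thesis by (intro exI[of _ T]) (auto simp: Q_def)
qed

subsection \<open>Existence\<close>

context
  fixes \<rho> :: "nat \<Rightarrow> ('p, 'm) bop"
  assumes \<rho>: "bidiffs \<rho>"
begin

text \<open>The coefficient of order \<open>n\<close> of the failure of \<open>\<rho>\<close> to be a module structure; its leading
  coefficient is a 2-cocycle.\<close>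

definition defect2 :: "nat \<Rightarrow> ('p \<Rightarrow> complex) \<Rightarrow> ('m \<Rightarrow> complex) \<Rightarrow> ('m \<Rightarrow> complex) \<Rightarrow> 'p \<Rightarrow> complex"
  where "defect2 n = (\<lambda>f a b u. \<Sum>i\<le>n. \<rho> i f (C (n - i) a b) u - \<rho> i (\<rho> (n - i) f a) b u)"

text \<open>After expansion into triple sums the terms with two \<open>\<rho>\<close> and one
  \<open>C\<close> cancel in pairs, those with three \<open>\<rho>\<close> agree on both sides, and
  those with one \<open>\<rho>\<close> agree by associativity of the star product.\<close>

lemma defect2_cocycle:
  assumes f: "f \<in> Cinf P" and a: "a \<in> Cinf M" and b: "b \<in> Cinf M" and c: "c \<in> Cinf M"
  shows "(\<Sum>j\<le>n. \<rho> j (defect2 (n - j) f a b) c u) + (\<Sum>j\<le>n. defect2 (n - j) f (C j a b) c u) =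
    (\<Sum>j\<le>n. defect2 (n - j) (\<rho> j f a) b c u) + (\<Sum>j\<le>n. defect2 (n - j) f a (C j b c) u)"
proof -
  note [simp] = f a b c C_Cinf bidiffsD(3)[OF \<rho>]
  have "\<rho> j (defect2 q f a b) c u = (\<Sum>i\<le>q. \<rho> j (\<rho> i f (C (q - i) a b)) c u - \<rho> j (\<rho> i (\<rho> (q - i) f a) b) c u)" for j q
    unfolding defect2_def
    by (simp add: linear_op_sum[OF bidiffsD(1)[OF \<rho>] P] Cinf_minus[OF P] linear_op_diff[OF bidiffsD(1)[OF \<rho>] P])
  then have S1: "(\<Sum>j\<le>n. \<rho> j (defect2 (n - j) f a b) c u) =
      tri (\<lambda>j i k. \<rho> j (\<rho> i f (C k a b)) c u) n - tri (\<lambda>j i k. \<rho> j (\<rho> i (\<rho> k f a) b) c u) n"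
    by (simp add: tri_12 sum_subtractf)
  have S2: "(\<Sum>j\<le>n. defect2 (n - j) f (C j a b) c u) =
      tri (\<lambda>i k j. \<rho> i f (C k (C j a b) c) u) n - tri (\<lambda>i k j. \<rho> i (\<rho> k f (C j a b)) c u) n"
    by (simp add: defect2_def tri_31 sum_subtractf)
  have S3: "(\<Sum>j\<le>n. defect2 (n - j) (\<rho> j f a) b c u) =
      tri (\<lambda>i k j. \<rho> i (\<rho> j f a) (C k b c) u) n - tri (\<lambda>i k j. \<rho> i (\<rho> k (\<rho> j f a) b) c u) n"
    by (simp add: defect2_def tri_31 sum_subtractf)
  have S4: "(\<Sum>j\<le>n. defect2 (n - j) f a (C j b c) u) =
      tri (\<lambda>i k j. \<rho> i f (C k a (C j b c)) u) n - tri (\<lambda>i k j. \<rho> i (\<rho> k f a) (C j b c) u) n"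
    by (simp add: defect2_def tri_31 sum_subtractf)
  have "tri (\<lambda>i k j. \<rho> i f (C k (C j a b) c) u) n = (\<Sum>i\<le>n. \<Sum>k\<le>n - i. \<rho> i f (C k (C (n - i - k) a b) c) u)"
    by (rule tri_12)
  also have "\<dots> = (\<Sum>i\<le>n. \<rho> i f (\<lambda>x. \<Sum>k\<le>n - i. C k (C (n - i - k) a b) c x) u)"
    by (simp add: linear_op_sum[OF bidiffsD(2)[OF \<rho>] M])
  also have "\<dots> = (\<Sum>i\<le>n. \<rho> i f (\<lambda>x. \<Sum>k\<le>n - i. C k a (C (n - i - k) b c) x) u)"
    by (simp only: C_assoc[OF a b c])
  also have "\<dots> = (\<Sum>i\<le>n. \<Sum>k\<le>n - i. \<rho> i f (C k a (C (n - i - k) b c)) u)"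
    by (simp add: linear_op_sum[OF bidiffsD(2)[OF \<rho>] M])
  also have "\<dots> = tri (\<lambda>i k j. \<rho> i f (C k a (C j b c)) u) n" by (rule tri_12[symmetric])
  finally have "tri (\<lambda>i k j. \<rho> i f (C k (C j a b) c) u) n = tri (\<lambda>i k j. \<rho> i f (C k a (C j b c)) u) n" .
  moreover have "tri (\<lambda>i k j. \<rho> i (\<rho> j f a) (C k b c) u) n = tri (\<lambda>i k j. \<rho> i (\<rho> k f a) (C j b c) u) n"
    by (rule tri_swap)
  ultimately show ?thesis unfolding S1 S2 S3 S4 by simp
qed

lemma defect2_leading_cocycle:
  assumes z: "\<And>n f a b. n < s \<Longrightarrow> f \<in> Cinf P \<Longrightarrow> a \<in> Cinf M \<Longrightarrow> b \<in> Cinf M \<Longrightarrow> defect2 n f a b = (\<lambda>u. 0)"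
    and f: "f \<in> Cinf P" and a: "a \<in> Cinf M" and b: "b \<in> Cinf M" and c: "c \<in> Cinf M"
  shows "pb_p c u * defect2 s f a b u + defect2 s f (\<lambda>x. a x * b x) c u =
    defect2 s (rmul f a) b c u + defect2 s f a (\<lambda>x. b x * c x) u"
proof -
  note [simp] = f a b c C_Cinf bidiffsD(3)[OF \<rho>]
  have "(\<Sum>j\<le>s. \<rho> j (defect2 (s - j) f a b) c u) = \<rho> 0 (defect2 (s - 0) f a b) c u"
    by (rule sum_leading) (simp add: z linear_op_zero[OF bidiffsD(1)[OF \<rho> c] f])
  moreover have "(\<Sum>j\<le>s. defect2 (s - j) f (C j a b) c u) = defect2 (s - 0) f (C 0 a b) c u"
    by (rule sum_leading) (simp add: z)
  moreover have "(\<Sum>j\<le>s. defect2 (s - j) (\<rho> j f a) b c u) = defect2 (s - 0) (\<rho> 0 f a) b c u"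
    by (rule sum_leading) (simp add: z)
  moreover have "(\<Sum>j\<le>s. defect2 (s - j) f a (C j b c) u) = defect2 (s - 0) f a (C 0 b c) u"
    by (rule sum_leading) (simp add: z)
  moreover have "defect2 s f a b \<in> Cinf P"
    unfolding defect2_def by (intro Cinf_sum[OF P] Cinf_minus[OF P]) simp_all
  ultimately show ?thesis
    using defect2_cocycle[OF f a b c, of s u] bidiffsD(4)[OF \<rho>] C_0[OF a b] C_0[OF b c]
    by (simp add: rmul_def mult.commute[of "pb_p c u"])
qed

text \<open>The bound must be uniform in \<open>b\<close>: the homotopy is applied for each fixed
  \<open>b\<close>, and only with the same number of Taylor terms throughout is it an operation in
  which \<open>b\<close> enters through \<open>B\<close> alone.\<close>

lemma defect2_bidiff:
  shows "\<exists>N. (\<forall>b\<in>Cinf M. bidiff N N (\<lambda>f a. defect2 s f a b)) \<and>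
    (\<forall>f\<in>Cinf P. \<forall>a\<in>Cinf M. diffop_lt M P p N (\<lambda>b. defect2 s f a b))"
proof -
  define QC where "QC i N \<longleftrightarrow> (\<forall>b\<in>Cinf M. diffop_lt M M (\<lambda>x. x) N (\<lambda>a. C i a b)) \<and> (\<forall>a\<in>Cinf M. diffop_lt M M (\<lambda>x. x) N (C i a))" for i N
  have QC_mono: "QC i N \<Longrightarrow> N \<le> N' \<Longrightarrow> QC i N'" for i N N'
    by (auto simp: QC_def intro: mm.diffop_lt_mono)
  have "\<exists>N. \<forall>i\<le>s. bidiff N N (\<rho> i) \<and> QC i N"
  proof (rule common_bound)
    fix i
    obtain N1 N2 where "bidiff N1 N1 (\<rho> i)" "QC i N2"
      using bidiffsD(5)[OF \<rho>] C_bidiff unfolding QC_def by metis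
    then show "\<exists>N. bidiff N N (\<rho> i) \<and> QC i N"
      by (intro exI[of _ "max N1 N2"]) (auto intro: bidiff_mono QC_mono)
  qed (auto intro: bidiff_mono QC_mono)
  then obtain N where N: "\<And>i. i \<le> s \<Longrightarrow> bidiff N N (\<rho> i)"
    "\<And>i b. i \<le> s \<Longrightarrow> b \<in> Cinf M \<Longrightarrow> diffop_lt M M (\<lambda>x. x) N (\<lambda>a. C i a b)"
    "\<And>i a. i \<le> s \<Longrightarrow> a \<in> Cinf M \<Longrightarrow> diffop_lt M M (\<lambda>x. x) N (C i a)" unfolding QC_def by blast
  note \<rho>C = bidiffsD(3)[OF \<rho>]
  have "bidiff (N + N) (N + N) (\<lambda>f a. defect2 s f a b)" if b: "b \<in> Cinf M" for b
    unfolding defect2_def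
  proof (intro bidiff_sum bidiff_diff)
    fix i assume "i \<in> {..s}"
    then have i: "i \<le> s" "s - i \<le> s" by auto
    show "bidiff (N + N) (N + N) (\<lambda>f a. \<rho> i f (C (s - i) a b))"
      unfolding bidiff_def
    proof (intro conjI ballI)
      show "diffop_lt P P (\<lambda>u. u) (N + N) (\<lambda>f. \<rho> i f (C (s - i) a b))" if "a \<in> Cinf M" for a
        by (rule pp.diffop_lt_mono[OF bidiffD(1)[OF N(1)[OF i(1)] C_Cinf[OF that b]]]) simp
      show "diffop_lt M P p (N + N) (\<lambda>a. \<rho> i f (C (s - i) a b))" if "f \<in> Cinf P" for f
        by (rule diffop_lt_compose_right[OF pm.smooth_pullback_axioms p_closed N(2)[OF i(2) b] bidiffD(2)[OF N(1)[OF i(1)] that]])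
    qed
    show "bidiff (N + N) (N + N) (\<lambda>f a. \<rho> i (\<rho> (s - i) f a) b)"
      unfolding bidiff_def
    proof (intro conjI ballI)
      show "diffop_lt P P (\<lambda>u. u) (N + N) (\<lambda>f. \<rho> i (\<rho> (s - i) f a) b)" if "a \<in> Cinf M" for a
        by (rule diffop_lt_compose_left[OF pp.smooth_pullback_axioms bidiffD(1)[OF N(1)[OF i(2)] that] bidiffD(1)[OF N(1)[OF i(1)] b]])
      show "diffop_lt M P p (N + N) (\<lambda>a. \<rho> i (\<rho> (s - i) f a) b)" if "f \<in> Cinf P" for f
        by (rule diffop_lt_compose_left[OF pm.smooth_pullback_axioms bidiffD(2)[OF N(1)[OF i(2)] that] bidiffD(1)[OF N(1)[OF i(1)] b]])
    qed
  qed
  moreover have "diffop_lt M P p (N + N) (\<lambda>b. defect2 s f a b)" if f: "f \<in> Cinf P" and a: "a \<in> Cinf M" for f a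
    unfolding defect2_def
  proof (intro pm.diffop_lt_sum pm.diffop_lt_diff)
    fix i assume "i \<in> {..s}"
    then have i: "i \<le> s" "s - i \<le> s" by auto
    show "diffop_lt M P p (N + N) (\<lambda>b. \<rho> i f (C (s - i) a b))"
      by (rule diffop_lt_compose_right[OF pm.smooth_pullback_axioms p_closed N(3)[OF i(2) a] bidiffD(2)[OF N(1)[OF i(1)] f]])
    show "diffop_lt M P p (N + N) (\<rho> i (\<rho> (s - i) f a))"
      by (rule pm.diffop_lt_mono[OF bidiffD(2)[OF N(1)[OF i(1)] \<rho>C[OF f a]]]) simp
  qed
  ultimately show ?thesis by blast
qed

end

lemma homotopy_zero: "f \<in> Cinf P \<Longrightarrow> (\<And>f a. f \<in> Cinf P \<Longrightarrow> a \<in> Cinf M \<Longrightarrow> B f a = (\<lambda>u. 0)) \<Longrightarrow> homotopy k l B f = (\<lambda>u. 0)"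
  using homotopy_cong[of f B "\<lambda>f a u. 0 * B f a u" k l] homotopy_mult[of f k l "\<lambda>u. 0" B] by (simp add: fun_eq_iff)

text \<open>The condition on pullbacks is part of the induction, not a later correction: the value
  of the new coefficient on pullbacks is the defect at \<open>f = 1\<close>, which the earlier
  coefficients determine by this very condition.\<close>

lemma module_step:
  assumes \<rho>: "\<And>i. i < s \<Longrightarrow> \<exists>N. bidiff N N (\<rho> i)" and inv: "\<And>i. i < s \<Longrightarrow> invariant (\<rho> i)"
    and one: "\<And>i f. 0 < i \<Longrightarrow> i < s \<Longrightarrow> f \<in> Cinf P \<Longrightarrow> \<rho> i f (one_fun M) = (\<lambda>u. 0)"
    and fib: "\<And>i c b. i < s \<Longrightarrow> c \<in> Cinf M \<Longrightarrow> b \<in> Cinf M \<Longrightarrow> \<rho> i (pb_p c) b = pb_p (C i c b)"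
    and \<rho>0: "\<rho> 0 = rmul" and s: "0 < s" and mod: "\<And>n. n < s \<Longrightarrow> module_at \<rho> n"
  shows "\<exists>R N. bidiff N N R \<and> invariant R \<and> (\<forall>f\<in>Cinf P. R f (one_fun M) = (\<lambda>u. 0)) \<and>
    (\<forall>c\<in>Cinf M. \<forall>b\<in>Cinf M. R (pb_p c) b = pb_p (C s c b)) \<and> module_at (\<rho>(s := R)) s"
proof -
  \<comment> \<open>Coefficients from order \<open>s\<close> on are set to 0, so that
    \<open>defect2 s\<close> is what the new coefficient has to compensate.\<close>
  define \<rho>' where "\<rho>' = (\<lambda>i. if i < s then \<rho> i else (\<lambda>f a u. 0))"
  have "bidiff 0 0 (\<lambda>f a u. 0)" by (simp add: bidiff_def)
  then have \<rho>': "bidiffs \<rho>'"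
    unfolding bidiffs_def using \<rho> s \<rho>0 by (auto simp: \<rho>'_def)
  have inv': "invariant (\<rho>' i)" for i
    using inv[of i] by (cases "i < s") (auto simp: \<rho>'_def invariant_def pullback_def)
  have \<rho>'s: "\<rho>' s = (\<lambda>f a u. 0)" and \<rho>'i: "\<And>i. i < s \<Longrightarrow> \<rho>' i = \<rho> i" and \<rho>'0: "\<rho>' 0 = rmul"
    using s \<rho>0 by (auto simp: \<rho>'_def)
  note \<rho>C = bidiffsD(3)[OF \<rho>'] and D = defect2_def[OF \<rho>'] and L1 = bidiffsD(1)[OF \<rho>'] and L2 = bidiffsD(2)[OF \<rho>']
  let ?\<Phi> = "defect2 \<rho>'"
  have z: "?\<Phi> n f a b = (\<lambda>u. 0)" if "n < s" "f \<in> Cinf P" "a \<in> Cinf M" "b \<in> Cinf M" for n f a b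
  proof -
    have T: "\<rho>' i = \<rho> i" if "i \<le> n" for i using that \<open>n < s\<close> by (simp add: \<rho>'_def)
    show ?thesis
      using mod[OF that(1)] that(2-4) by (simp add: D sum_subtractf module_at_def T)
  qed
  obtain N where N: "\<And>b. b \<in> Cinf M \<Longrightarrow> bidiff N N (\<lambda>f a. ?\<Phi> s f a b)"
    "\<And>f a. f \<in> Cinf P \<Longrightarrow> a \<in> Cinf M \<Longrightarrow> diffop_lt M P p N (\<lambda>b. ?\<Phi> s f a b)"
    using defect2_bidiff[OF \<rho>', of s] by blast
  \<comment> \<open>The contraction acts on the first argument \<open>a\<close>; the second one
    stays as a parameter and becomes the argument of the new coefficient.\<close>
  define R where "R f b = homotopy N N (\<lambda>f a. ?\<Phi> s f a b) f" for f b
  have RC: "R f b \<in> Cinf P" if "f \<in> Cinf P" "b \<in> Cinf M" for f b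
    unfolding R_def by (rule linear_opD(1)[OF homotopy_linear_op[OF N(1)[OF that(2)]] that(1)])
  have R_bidiff: "bidiff (fuse_order N N m + N) (fuse_order N N m + N) R"
    unfolding bidiff_def
  proof (intro conjI ballI)
    show "diffop_lt P P (\<lambda>u. u) (fuse_order N N m + N) (\<lambda>f. R f b)" if "b \<in> Cinf M" for b
      unfolding R_def by (rule pp.diffop_lt_mono[OF homotopy_diffop_lt[OF N(1)[OF that]]]) simp
    show "diffop_lt M P p (fuse_order N N m + N) (R f)" if "f \<in> Cinf P" for f
      unfolding R_def[abs_def]
      by (rule pm.diffop_lt_mono[OF homotopy_parameter[where B="\<lambda>b f a. ?\<Phi> s f a b", OF N(2) that]]) auto
  qed
  have R_inv: "invariant R"
    unfolding invariant_def
  proof (intro ballI)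
    fix g f b assume g: "g \<in> carrier G" and f: "f \<in> Cinf P" and b: "b \<in> Cinf M"
    have "invariant (\<lambda>f a. ?\<Phi> s f a b)"
      unfolding invariant_def
    proof (intro ballI)
      fix g f a assume g: "g \<in> carrier G" and f: "f \<in> Cinf P" and a: "a \<in> Cinf M"
      have "\<rho>' i (tr g f) (C (s - i) a b) = tr g (\<rho>' i f (C (s - i) a b))"
        "\<rho>' i (\<rho>' (s - i) (tr g f) a) b = tr g (\<rho>' i (\<rho>' (s - i) f a) b)" for i
        using inv' g f a b C_Cinf \<rho>C by (simp_all add: invariant_def)
      then have "?\<Phi> s (tr g f) a b = (\<lambda>u. \<Sum>i\<le>s. tr g (\<rho>' i f (C (s - i) a b)) u - tr g (\<rho>' i (\<rho>' (s - i) f a) b) u)"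
        by (simp only: D)
      also have "\<dots> = tr g (?\<Phi> s f a b)" by (auto simp: D pullback_def)
      finally show "?\<Phi> s (tr g f) a b = tr g (?\<Phi> s f a b)" .
    qed
    then show "R (tr g f) b = tr g (R f b)"
      unfolding R_def by (rule homotopy_invariant[OF _ g f])
  qed
  \<comment> \<open>The defect vanishes at \<open>b = 1\<close>, because higher coefficients of the
    star product and of the earlier module structure do. This keeps the unit law exact.\<close>
  have R_one: "R f (one_fun M) = (\<lambda>u. 0)" if f: "f \<in> Cinf P" for f
    unfolding R_def
  proof (rule homotopy_zero[OF f])
    fix f a assume f: "f \<in> Cinf P" and a: "a \<in> Cinf M"
    have "\<rho>' i f (C (s - i) a (one_fun M)) = (\<lambda>u. 0)" if "i \<le> s" for i
      using that a C_one(2)[of "s - i" a] linear_op_zero[OF L2[OF f] a] \<rho>'s by (cases "i = s") auto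
    moreover have "\<rho>' i (\<rho>' (s - i) f a) (one_fun M) = (\<lambda>u. 0)" if "i \<le> s" for i
    proof (cases "i = 0")
      case True
      then show ?thesis using \<rho>'s \<rho>'0 by (simp add: rmul_def)
    next
      case False
      have "\<rho>' i g (one_fun M) = (\<lambda>u. 0)" if "g \<in> Cinf P" for g
        using False \<open>i \<le> s\<close> one[OF _ _ that] \<rho>'s \<rho>'i by (cases "i = s") auto
      then show ?thesis using \<rho>C[OF f a] by blast
    qed
    ultimately show "?\<Phi> s f a (one_fun M) = (\<lambda>u. 0)" by (simp add: D fun_eq_iff)
  qed
  have R_fib: "R (pb_p c) b = pb_p (C s c b)" if c: "c \<in> Cinf M" and b: "b \<in> Cinf M" for b c
  proof -
    \<comment> \<open>The constant 1 on \<open>P\<close> is a pullback, so the condition on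
      pullbacks reduces this to the unit law of the star product.\<close>
    have one0: "\<rho>' i (one_fun P) a = (\<lambda>u. 0)" if "0 < i" "a \<in> Cinf M" for i a
      using fib[of i "one_fun M" a] C_one(1)[OF that] Cinf_one[OF M] that pb_p_one \<rho>'i
      by (cases "i < s") (auto simp: \<rho>'_def pullback_def)
    have "R (pb_p c) b = ?\<Phi> s (one_fun P) c b"
      unfolding R_def by (rule homotopy_pullback[OF N(1)[OF b] c])
    moreover have "?\<Phi> s (one_fun P) c b u = pb_p (C s c b) u" for u
    proof -
      have "\<rho>' i (\<rho>' (s - i) (one_fun P) c) b = (\<lambda>u. 0)" if "i \<le> s" for i
        using that one0[of "s - i" c] c linear_op_zero[OF L1[OF b] Cinf_one[OF P]] \<rho>'s by (cases "i = s") auto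
      then have "?\<Phi> s (one_fun P) c b u = (\<Sum>i\<le>s. \<rho>' i (one_fun P) (C (s - i) c b) u)"
        by (simp add: D)
      also have "\<dots> = \<rho>' 0 (one_fun P) (C (s - 0) c b) u"
        by (rule sum_leading) (simp add: one0 C_Cinf c b)
      finally show ?thesis using one_rmul[OF C_Cinf[OF c b]] \<rho>'0 by simp
    qed
    ultimately show ?thesis by (simp add: fun_eq_iff)
  qed
  \<comment> \<open>Contract the cocycle identity in \<open>a\<close>, with \<open>b\<close> and
    \<open>c\<close> fixed: multiplying \<open>a\<close> by \<open>b\<close> moves \<open>b\<close>
    to \<open>f\<close>, and the term depending on \<open>rmul f a\<close> alone returns the
    defect.\<close>
  have coboundary: "pb_p c u * R f b u + R (rmul f b) c u = ?\<Phi> s f b c u + R f (\<lambda>x. b x * c x) u"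
    if f: "f \<in> Cinf P" and b: "b \<in> Cinf M" and c: "c \<in> Cinf M" for f b c u
  proof -
    have "pb_p c u * R f b u + R (rmul f b) c u =
       homotopy N N (\<lambda>f a u. pb_p c u * ?\<Phi> s f a b u + ?\<Phi> s f (\<lambda>x. a x * b x) c u) f u"
      using homotopy_add[OF f, of N N "\<lambda>f a u. pb_p c u * ?\<Phi> s f a b u" "\<lambda>f a. ?\<Phi> s f (\<lambda>x. a x * b x) c" u]
        homotopy_mult[OF f, of N N "pb_p c" "\<lambda>f a. ?\<Phi> s f a b" u] homotopy_mult_argument[OF N(1)[OF c] f b]
      by (simp add: R_def)
    also have "\<dots> = homotopy N N (\<lambda>f a u. ?\<Phi> s (rmul f a) b c u + ?\<Phi> s f a (\<lambda>x. b x * c x) u) f u"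
      by (rule fun_cong[OF homotopy_cong[OF f]], rule ext)
        (rule defect2_leading_cocycle[OF \<rho>' z _ _ b c])
    also have "\<dots> = ?\<Phi> s f b c u + R f (\<lambda>x. b x * c x) u"
      using homotopy_add[OF f, of N N "\<lambda>f a. ?\<Phi> s (rmul f a) b c" "\<lambda>f a. ?\<Phi> s f a (\<lambda>x. b x * c x)" u]
        homotopy_rmul[OF bidiff_linear(1)[OF N(1)[OF c] b] f] by (simp add: R_def)
    finally show ?thesis .
  qed
  have "module_at (\<rho>(s := R)) s"
    unfolding module_at_def
  proof (intro ballI allI)
    fix f a b u assume f: "f \<in> Cinf P" and a: "a \<in> Cinf M" and b: "b \<in> Cinf M"
    let ?\<sigma> = "\<rho>(s := R)"
    have split: "(\<Sum>i\<le>s. g i) = g 0 + g s + (\<Sum>i\<in>{0<..<s}. g i)" for g :: "nat \<Rightarrow> complex"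
    proof -
      have "{..s} = insert 0 (insert s {0<..<s})" using s by auto
      then show ?thesis using s by simp
    qed
    have mid: "(\<Sum>i\<in>{0<..<s}. ?\<sigma> i (?\<sigma> (s - i) f a) b u) = (\<Sum>i\<in>{0<..<s}. \<rho> i (\<rho> (s - i) f a) b u)"
      by (rule sum.cong) auto
    have lhs: "(\<Sum>i\<le>s. ?\<sigma> i (?\<sigma> (s - i) f a) b u) =
       pb_p b u * R f a u + R (rmul f a) b u + (\<Sum>i\<in>{0<..<s}. \<rho> i (\<rho> (s - i) f a) b u)"
      unfolding split mid using s \<rho>0 by (simp add: rmul_def mult.commute)
    have rhs: "(\<Sum>i\<le>s. ?\<sigma> i f (C (s - i) a b) u) =
       rmul f (C s a b) u + R f (\<lambda>x. a x * b x) u + (\<Sum>i\<in>{0<..<s}. \<rho> i f (C (s - i) a b) u)"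
      unfolding split using s \<rho>0 by (simp add: C_0[OF a b])
    have phi: "?\<Phi> s f a b u = rmul f (C s a b) u +
       (\<Sum>i\<in>{0<..<s}. \<rho> i f (C (s - i) a b) u) - (\<Sum>i\<in>{0<..<s}. \<rho> i (\<rho> (s - i) f a) b u)"
      unfolding D split using s by (simp add: \<rho>'s \<rho>'0 \<rho>'i sum_subtractf rmul_def)
    show "(\<Sum>i\<le>s. ?\<sigma> i (?\<sigma> (s - i) f a) b u) = (\<Sum>i\<le>s. ?\<sigma> i f (C (s - i) a b) u)"
      unfolding lhs rhs coboundary[OF f a b, of u] phi by simp
  qed
  then show ?thesis using R_bidiff R_inv R_one R_fib by blast
qed

lemma module_exists:
  "\<exists>\<rho>. \<rho> 0 = rmul \<and> (\<forall>i. \<exists>N. bidiff N N (\<rho> i)) \<and> (\<forall>i. invariant (\<rho> i)) \<and>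
    (\<forall>i>0. \<forall>f\<in>Cinf P. \<rho> i f (one_fun M) = (\<lambda>u. 0)) \<and>
    (\<forall>i. \<forall>c\<in>Cinf M. \<forall>b\<in>Cinf M. \<rho> i (pb_p c) b = pb_p (C i c b)) \<and> (\<forall>n. module_at \<rho> n)"
proof -
  define Q where "Q \<rho> s R \<longleftrightarrow> (s = 0 \<longrightarrow> R = rmul) \<and> (\<exists>N. bidiff N N R) \<and> invariant R \<and>
    (0 < s \<longrightarrow> (\<forall>f\<in>Cinf P. R f (one_fun M) = (\<lambda>u. 0))) \<and>
    (\<forall>c\<in>Cinf M. \<forall>b\<in>Cinf M. R (pb_p c) b = pb_p (C s c b)) \<and> module_at (\<rho>(s := R)) s" for \<rho> s R
  have "\<exists>\<rho>. \<forall>s. Q \<rho> s (\<rho> s)"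
  proof (rule dependent_wf_choice[OF wf_less])
    fix \<rho> \<rho>' :: "nat \<Rightarrow> ('p, 'm) bop" and s R
    assume eq: "\<And>z. (z, s) \<in> {(x, y). x < y} \<Longrightarrow> \<rho> z = \<rho>' z"
    have "module_at (\<rho>(s := R)) s = module_at (\<rho>'(s := R)) s"
    proof -
      have "(\<rho>(s := R)) i = (\<rho>'(s := R)) i" if "i \<le> s" for i using that eq by (cases "i = s") auto
      then show ?thesis unfolding module_at_def by simp
    qed
    then show "Q \<rho> s R = Q \<rho>' s R" by (simp add: Q_def)
  next
    fix s and \<rho> :: "nat \<Rightarrow> ('p, 'm) bop"
    assume "\<And>y. (y, s) \<in> {(x, y). x < y} \<Longrightarrow> Q \<rho> y (\<rho> y)"
    then have IH: "Q \<rho> y (\<rho> y)" if "y < s" for y using that by simp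
    show "\<exists>R. Q \<rho> s R"
    proof (cases "s = 0")
      case True
      have "invariant rmul" by (simp add: invariant_def tr_rmul)
      moreover have "rmul (pb_p c) b = pb_p (C 0 c b)" if "c \<in> Cinf M" "b \<in> Cinf M" for c b
        using C_0[OF that] by (simp add: rmul_def pb_p_mult)
      moreover have "module_at (\<rho>(0 := rmul)) 0"
        by (auto simp: module_at_def rmul_rmul C_0)
      ultimately have "Q \<rho> s rmul" using True bidiff_rmul by (auto simp: Q_def)
      then show ?thesis by blast
    next
      case False
      have \<rho>0: "\<rho> 0 = rmul" using IH[of 0] False by (simp add: Q_def)
      have "\<exists>R N. bidiff N N R \<and> invariant R \<and> (\<forall>f\<in>Cinf P. R f (one_fun M) = (\<lambda>u. 0)) \<and>
         (\<forall>c\<in>Cinf M. \<forall>b\<in>Cinf M. R (pb_p c) b = pb_p (C s c b)) \<and> module_at (\<rho>(s := R)) s"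
      proof (rule module_step)
        show "module_at \<rho> n" if "n < s" for n
          using IH[OF that] by (simp add: Q_def)
      qed (use IH False \<rho>0 in \<open>auto simp: Q_def\<close>)
      then show ?thesis using False by (auto simp: Q_def)
    qed
  qed
  then obtain \<rho> where \<rho>: "\<And>s. Q \<rho> s (\<rho> s)" by blast
  then show ?thesis by (intro exI[of _ \<rho>]) (auto simp: Q_def)
qed

end

section \<open>Formal power series\<close>

lemma fps_nth_formal_bilinear:
  "fps_nth (formal_bilinear B f a) n = (\<lambda>y. \<Sum>r\<le>n. \<Sum>i\<le>n - r. B r (fps_nth f i) (fps_nth a (n - r - i)) y)"
  by (simp add: formal_bilinear_def)

lemma formal_CinfD: "f \<in> formal_Cinf X \<Longrightarrow> fps_nth f n \<in> Cinf X"
  by (simp add: formal_Cinf_def)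

text \<open>Testing formal identities on series concentrated in order 0 recovers the identities
  between the coefficient operators.\<close>

definition formal_const :: "('x \<Rightarrow> complex) \<Rightarrow> ('x \<Rightarrow> complex) fps"
  where "formal_const f = Abs_fps (\<lambda>n. if n = 0 then f else (\<lambda>x. 0))"

lemma fps_nth_formal_const: "fps_nth (formal_const f) n = (if n = 0 then f else (\<lambda>x. 0))"
  by (simp add: formal_const_def)

lemma formal_one_eq: "formal_one M = formal_const (one_fun M)"
  by (simp add: formal_one_def formal_const_def)

locale bilinear_series =
  fixes X :: "'x manifold" and X' :: "'x2 manifold" and Y :: "'y manifold"
    and B :: "nat \<Rightarrow> ('x \<Rightarrow> complex) \<Rightarrow> ('x2 \<Rightarrow> complex) \<Rightarrow> 'y \<Rightarrow> complex"
  assumes X: "locally_euclidean X" and X': "locally_euclidean X'" and Y: "locally_euclidean Y"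
    and linear1: "a \<in> Cinf X' \<Longrightarrow> linear_op X Y (\<lambda>f. B k f a)"
    and linear2: "f \<in> Cinf X \<Longrightarrow> linear_op X' Y (B k f)"
begin

lemma B_Cinf: "f \<in> Cinf X \<Longrightarrow> a \<in> Cinf X' \<Longrightarrow> B k f a \<in> Cinf Y"
  using linear_opD(1)[OF linear2] by blast

lemma B_zero: "a \<in> Cinf X' \<Longrightarrow> B k (\<lambda>x. 0) a = (\<lambda>y. 0)" "f \<in> Cinf X \<Longrightarrow> B k f (\<lambda>x. 0) = (\<lambda>y. 0)"
  using linear_op_zero[OF linear1 Cinf_zero[OF X]] linear_op_zero[OF linear2 Cinf_zero[OF X']] by auto

lemma formal_bilinear_Cinf:
  "f \<in> formal_Cinf X \<Longrightarrow> a \<in> formal_Cinf X' \<Longrightarrow> formal_bilinear B f a \<in> formal_Cinf Y"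
  by (auto simp: formal_Cinf_def fps_nth_formal_bilinear intro!: Cinf_sum[OF Y] B_Cinf)

lemma formal_const_Cinf: "f \<in> Cinf X \<Longrightarrow> formal_const f \<in> formal_Cinf X"
  by (simp add: formal_Cinf_def fps_nth_formal_const Cinf_zero[OF X])

lemma formal_bilinear_const_right:
  assumes "f \<in> formal_Cinf X" "b \<in> Cinf X'"
  shows "fps_nth (formal_bilinear B f (formal_const b)) n = (\<lambda>y. \<Sum>r\<le>n. B r (fps_nth f (n - r)) b y)"
proof -
  have key: "(\<Sum>i\<le>q. B r (fps_nth f i) (fps_nth (formal_const b) (q - i)) y) = B r (fps_nth f q) b y" for q r y
    by (subst sum_trailing) (auto simp: fps_nth_formal_const B_zero formal_CinfD[OF assms(1)])
  show ?thesis unfolding fps_nth_formal_bilinear key ..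
qed

lemma formal_bilinear_const_left:
  assumes "f \<in> Cinf X" "a \<in> formal_Cinf X'"
  shows "fps_nth (formal_bilinear B (formal_const f) a) n = (\<lambda>y. \<Sum>r\<le>n. B r f (fps_nth a (n - r)) y)"
proof -
  have key: "(\<Sum>i\<le>q. B r (fps_nth (formal_const f) i) (fps_nth a (q - i)) y) = B r f (fps_nth a q) y" for q r y
    by (subst sum_leading) (auto simp: fps_nth_formal_const B_zero formal_CinfD[OF assms(2)])
  show ?thesis unfolding fps_nth_formal_bilinear key ..
qed

lemma formal_bilinear_const:
  assumes "f \<in> Cinf X" "a \<in> Cinf X'"
  shows "fps_nth (formal_bilinear B (formal_const f) (formal_const a)) n = B n f a"
proof -
  have "(\<Sum>r\<le>n. B r (fps_nth (formal_const f) (n - r)) a y) = B n f a y" for y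
    by (subst sum_trailing) (auto simp: fps_nth_formal_const B_zero assms)
  then show ?thesis by (simp add: formal_bilinear_const_right[OF formal_const_Cinf[OF assms(1)] assms(2)])
qed

end

text \<open>The total order \<open>q\<close> of the two operators is summed separately from the
  orders of the three series arguments. With the latter fixed, the inner sum over \<open>r\<close>
  is one instance of the coefficientwise module condition.\<close>

definition quad :: "(nat \<Rightarrow> nat \<Rightarrow> nat \<Rightarrow> nat \<Rightarrow> nat \<Rightarrow> 'a::comm_monoid_add) \<Rightarrow> nat \<Rightarrow> 'a"
  where "quad H n = (\<Sum>(q, j, k, r)\<in>{(q, j, k, r). q + j + k \<le> n \<and> r \<le> q}. H r (q - r) j k (n - q - j - k))"

lemma quad_eq: "quad H n = (\<Sum>q\<le>n. \<Sum>j\<le>n - q. \<Sum>k\<le>n - q - j. \<Sum>r\<le>q. H r (q - r) j k (n - q - j - k))"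
proof -
  have "(\<Sum>q\<le>n. \<Sum>j\<le>n - q. \<Sum>k\<le>n - q - j. \<Sum>r\<le>q. H r (q - r) j k (n - q - j - k)) =
     (\<Sum>(q, j, k, r)\<in>(SIGMA q:{..n}. SIGMA j:{..n - q}. SIGMA k:{..n - q - j}. {..q}). H r (q - r) j k (n - q - j - k))"
    by (simp add: sum.Sigma)
  also have "(SIGMA q:{..n}. SIGMA j:{..n - q}. SIGMA k:{..n - q - j}. {..q}) = {(q, j, k, r). q + j + k \<le> n \<and> r \<le> q}"
    by auto
  finally show ?thesis by (simp add: quad_def)
qed

lemma quad_left:
  "(\<Sum>r\<le>n. \<Sum>i\<le>n - r. \<Sum>s\<le>i. \<Sum>j\<le>i - s. H r s j (i - s - j) (n - r - i)) = quad H n"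
proof -
  have "(\<Sum>r\<le>n. \<Sum>i\<le>n - r. \<Sum>s\<le>i. \<Sum>j\<le>i - s. H r s j (i - s - j) (n - r - i)) =
     (\<Sum>(r, i, s, j)\<in>(SIGMA r:{..n}. SIGMA i:{..n - r}. SIGMA s:{..i}. {..i - s}). H r s j (i - s - j) (n - r - i))"
    by (simp add: sum.Sigma)
  also have "\<dots> = quad H n" unfolding quad_def
    by (rule sum.reindex_bij_witness[where j="\<lambda>(r, i, s, j). (r + s, j, i - s - j, r)" and i="\<lambda>(q, j, k, r). (r, q - r + j + k, q - r, j)"]) auto
  finally show ?thesis .
qed

lemma quad_right:
  "(\<Sum>r\<le>n. \<Sum>j\<le>n - r. \<Sum>s\<le>n - r - j. \<Sum>k\<le>n - r - j - s. H r s j k (n - r - j - s - k)) = quad H n"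
proof -
  have "(\<Sum>r\<le>n. \<Sum>j\<le>n - r. \<Sum>s\<le>n - r - j. \<Sum>k\<le>n - r - j - s. H r s j k (n - r - j - s - k)) =
     (\<Sum>(r, j, s, k)\<in>(SIGMA r:{..n}. SIGMA j:{..n - r}. SIGMA s:{..n - r - j}. {..n - r - j - s}). H r s j k (n - r - j - s - k))"
    by (simp add: sum.Sigma)
  also have "\<dots> = quad H n" unfolding quad_def
    by (rule sum.reindex_bij_witness[where j="\<lambda>(r, j, s, k). (r + s, j, k, r)" and i="\<lambda>(q, j, k, r). (r, j, q - r, k)"])
      (auto simp: algebra_simps)
  finally show ?thesis .
qed

text \<open>The same arrangement for two series arguments, where the inner sum is one instance of
  the intertwining condition.\<close>

definition trip :: "(nat \<Rightarrow> nat \<Rightarrow> nat \<Rightarrow> nat \<Rightarrow> 'a::comm_monoid_add) \<Rightarrow> nat \<Rightarrow> 'a"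
  where "trip H n = (\<Sum>(q, j, r)\<in>{(q, j, r). q + j \<le> n \<and> r \<le> q}. H r (q - r) j (n - q - j))"

lemma trip_eq: "trip H n = (\<Sum>q\<le>n. \<Sum>j\<le>n - q. \<Sum>r\<le>q. H r (q - r) j (n - q - j))"
proof -
  have "(\<Sum>q\<le>n. \<Sum>j\<le>n - q. \<Sum>r\<le>q. H r (q - r) j (n - q - j)) =
     (\<Sum>(q, j, r)\<in>(SIGMA q:{..n}. SIGMA j:{..n - q}. {..q}). H r (q - r) j (n - q - j))"
    by (simp add: sum.Sigma)
  also have "(SIGMA q:{..n}. SIGMA j:{..n - q}. {..q}) = {(q, j, r). q + j \<le> n \<and> r \<le> q}" by auto
  finally show ?thesis by (simp add: trip_def)
qed

lemma trip_left: "(\<Sum>r\<le>n. \<Sum>s\<le>n - r. \<Sum>j\<le>n - r - s. H r s j (n - r - s - j)) = trip H n"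
proof -
  have "(\<Sum>r\<le>n. \<Sum>s\<le>n - r. \<Sum>j\<le>n - r - s. H r s j (n - r - s - j)) =
     (\<Sum>(r, s, j)\<in>(SIGMA r:{..n}. SIGMA s:{..n - r}. {..n - r - s}). H r s j (n - r - s - j))"
    by (simp add: sum.Sigma)
  also have "\<dots> = trip H n" unfolding trip_def
    by (rule sum.reindex_bij_witness[where j="\<lambda>(r, s, j). (r + s, j, r)" and i="\<lambda>(q, j, r). (r, q - r, j)"]) auto
  finally show ?thesis .
qed

lemma trip_right: "(\<Sum>r\<le>n. \<Sum>i\<le>n - r. \<Sum>s\<le>i. H r s (i - s) (n - r - i)) = trip H n"
proof -
  have "(\<Sum>r\<le>n. \<Sum>i\<le>n - r. \<Sum>s\<le>i. H r s (i - s) (n - r - i)) =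
     (\<Sum>(r, i, s)\<in>(SIGMA r:{..n}. SIGMA i:{..n - r}. {..i}). H r s (i - s) (n - r - i))"
    by (simp add: sum.Sigma)
  also have "\<dots> = trip H n" unfolding trip_def
    by (rule sum.reindex_bij_witness[where j="\<lambda>(r, i, s). (r + s, i - s, r)" and i="\<lambda>(q, j, r). (r, q - r + j, q - r)"]) auto
  finally show ?thesis .
qed

section \<open>From coefficientwise identities to formal series and back\<close>

context star_coefficients
begin

lemma star_series: "bilinear_series M M M C"
  by unfold_locales (use M C_linear in auto)

lemma module_series: "bidiffs \<rho> \<Longrightarrow> bilinear_series P M P \<rho>"
  by unfold_locales (use M P bidiffsD in auto)

lemma formal_module:
  assumes \<rho>: "bidiffs \<rho>" and mod: "\<And>n. module_at \<rho> n"
    and f: "f \<in> formal_Cinf P" and a: "a \<in> formal_Cinf M" and b: "b \<in> formal_Cinf M"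
  shows "formal_bilinear \<rho> (formal_bilinear \<rho> f a) b = formal_bilinear \<rho> f (formal_bilinear C a b)"
proof (rule fps_ext, rule ext)
  fix n u
  note [simp] = formal_CinfD[OF f] formal_CinfD[OF a] formal_CinfD[OF b] C_Cinf bidiffsD(3)[OF \<rho>]
  have "fps_nth (formal_bilinear \<rho> (formal_bilinear \<rho> f a) b) n u =
    quad (\<lambda>r s j k l. \<rho> r (\<rho> s (fps_nth f j) (fps_nth a k)) (fps_nth b l) u) n"
    unfolding quad_left[symmetric]
    by (simp add: fps_nth_formal_bilinear linear_op_sum[OF bidiffsD(1)[OF \<rho>] P] Cinf_sum[OF P])
  also have "\<dots> = quad (\<lambda>r s j k l. \<rho> r (fps_nth f j) (C s (fps_nth a k) (fps_nth b l)) u) n"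
    unfolding quad_eq
  proof (rule sum.cong[OF refl], rule sum.cong[OF refl], rule sum.cong[OF refl])
    fix q j k
    show "(\<Sum>r\<le>q. \<rho> r (\<rho> (q - r) (fps_nth f j) (fps_nth a k)) (fps_nth b (n - q - j - k)) u) =
       (\<Sum>r\<le>q. \<rho> r (fps_nth f j) (C (q - r) (fps_nth a k) (fps_nth b (n - q - j - k))) u)"
      using mod[of q] unfolding module_at_def by simp
  qed
  also have "\<dots> = fps_nth (formal_bilinear \<rho> f (formal_bilinear C a b)) n u"
    unfolding quad_right[symmetric]
    by (simp add: fps_nth_formal_bilinear linear_op_sum[OF bidiffsD(2)[OF \<rho>] M] Cinf_sum[OF M])
  finally show "fps_nth (formal_bilinear \<rho> (formal_bilinear \<rho> f a) b) n u =
    fps_nth (formal_bilinear \<rho> f (formal_bilinear C a b)) n u" .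
qed

lemma formal_intertwiner:
  assumes \<rho>: "bidiffs \<rho>" and \<rho>': "bidiffs \<rho>'" and T: "\<And>i. linear_op P P (T i)" and int: "\<And>n. intertwines_at \<rho> \<rho>' T n"
    and f: "f \<in> formal_Cinf P" and a: "a \<in> formal_Cinf M"
  shows "formal_linear T (formal_bilinear \<rho> f a) = formal_bilinear \<rho>' (formal_linear T f) a"
proof (rule fps_ext, rule ext)
  fix n u
  note [simp] = formal_CinfD[OF f] formal_CinfD[OF a] bidiffsD(3)[OF \<rho>] bidiffsD(3)[OF \<rho>'] linear_opD(1)[OF T]
  have "fps_nth (formal_linear T (formal_bilinear \<rho> f a)) n u =
    trip (\<lambda>r s j k. T r (\<rho> s (fps_nth f j) (fps_nth a k)) u) n"
    unfolding trip_left[symmetric]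
    by (simp add: formal_linear_def fps_nth_formal_bilinear linear_op_sum[OF T P] Cinf_sum[OF P])
  also have "\<dots> = trip (\<lambda>r s j k. \<rho>' r (T s (fps_nth f j)) (fps_nth a k) u) n"
    unfolding trip_eq
  proof (rule sum.cong[OF refl], rule sum.cong[OF refl])
    fix q j
    show "(\<Sum>r\<le>q. T r (\<rho> (q - r) (fps_nth f j) (fps_nth a (n - q - j))) u) =
       (\<Sum>r\<le>q. \<rho>' r (T (q - r) (fps_nth f j)) (fps_nth a (n - q - j)) u)"
      using int[of q] unfolding intertwines_at_def by simp
  qed
  also have "\<dots> = fps_nth (formal_bilinear \<rho>' (formal_linear T f) a) n u"
    unfolding trip_right[symmetric]
    by (simp add: formal_linear_def fps_nth_formal_bilinear linear_op_sum[OF bidiffsD(1)[OF \<rho>'] P] Cinf_sum[OF P])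
  finally show "fps_nth (formal_linear T (formal_bilinear \<rho> f a)) n u =
    fps_nth (formal_bilinear \<rho>' (formal_linear T f) a) n u" .
qed

lemma bidiff_iff: "(\<exists>N. bidiff N N B) \<longleftrightarrow> bidifferential_operator P M P (\<lambda>u. u) p B"
proof
  assume "\<exists>N. bidiff N N B"
  then show "bidifferential_operator P M P (\<lambda>u. u) p B"
    using bidiff_linear unfolding bidifferential_operator_def bidiff_def by blast
next
  assume "bidifferential_operator P M P (\<lambda>u. u) p B"
  then obtain k l where "bidiff k l B" unfolding bidifferential_operator_def bidiff_def by blast
  then have "bidiff (max k l) (max k l) B" by (rule bidiff_mono) auto
  then show "\<exists>N. bidiff N N B" by blast
qed

context
  fixes star
  assumes star: "\<And>a b. a \<in> formal_Cinf M \<Longrightarrow> b \<in> formal_Cinf M \<Longrightarrow> star a b = formal_bilinear C a b"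
begin

lemma quantization_exists:
  "\<exists>act. deformation_quantization P M G r p star act \<and> preserves_fibration P M p star act"
proof -
  obtain \<rho> where \<rho>0: "\<rho> 0 = rmul" and bd: "\<forall>i. \<exists>N. bidiff N N (\<rho> i)" and inv: "\<forall>i. invariant (\<rho> i)"
    and one: "\<forall>i>0. \<forall>f\<in>Cinf P. \<rho> i f (one_fun M) = (\<lambda>u. 0)"
    and fib: "\<forall>i. \<forall>c\<in>Cinf M. \<forall>b\<in>Cinf M. \<rho> i (pb_p c) b = pb_p (C i c b)"
    and mod: "\<forall>n. module_at \<rho> n"
    using module_exists by (elim exE conjE)
  have \<rho>: "bidiffs \<rho>" using bd \<rho>0 by (simp add: bidiffs_def)
  interpret S: bilinear_series M M M C by (rule star_series)
  interpret R: bilinear_series P M P \<rho> by (rule module_series[OF \<rho>])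
  let ?act = "formal_bilinear \<rho>"
  have "deformation_quantization P M G r p star ?act"
    unfolding deformation_quantization_def
  proof (intro conjI exI[of _ \<rho>] ballI allI impI refl)
    show "\<rho> 0 f a = (\<lambda>u. f u * pb_p a u)" for f a by (simp add: \<rho>0 rmul_def)
    show "bidifferential_operator P M P (\<lambda>u. u) p (\<rho> k)" for k using bidiff_iff bd by blast
    show "?act (?act f a) b = ?act f (star a b)" if "f \<in> formal_Cinf P" "a \<in> formal_Cinf M" "b \<in> formal_Cinf M" for f a b
      using formal_module[OF \<rho> _ that] mod star S.formal_bilinear_Cinf that by simp
    show "?act f (formal_one M) = f" if f: "f \<in> formal_Cinf P" for f
    proof (rule fps_ext, rule ext)
      fix n u
      have "(\<Sum>s\<le>n. \<rho> s (fps_nth f (n - s)) (one_fun M) u) = \<rho> 0 (fps_nth f (n - 0)) (one_fun M) u"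
        by (rule sum_leading) (simp add: one formal_CinfD[OF f])
      then show "fps_nth (?act f (formal_one M)) n u = fps_nth f n u"
        unfolding formal_one_eq R.formal_bilinear_const_right[OF f Cinf_one[OF M]]
        by (simp add: \<rho>0 rmul_one formal_CinfD[OF f])
    qed
    show "formal_pullback P (\<lambda>u. r u g) (?act f a) = ?act (formal_pullback P (\<lambda>u. r u g) f) a"
      if f: "f \<in> formal_Cinf P" and a: "a \<in> formal_Cinf M" and g: "g \<in> carrier G" for f a g
    proof (rule fps_ext, rule ext)
      fix n u
      have "\<rho> s (tr g (fps_nth f i)) (fps_nth a j) = tr g (\<rho> s (fps_nth f i) (fps_nth a j))" for s i j
        using inv g formal_CinfD[OF f] formal_CinfD[OF a] by (simp add: invariant_def)
      then show "fps_nth (formal_pullback P (\<lambda>u. r u g) (?act f a)) n u = fps_nth (?act (formal_pullback P (\<lambda>u. r u g) f) a) n u"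
        by (simp add: formal_pullback_def fps_nth_formal_bilinear) (simp add: pullback_def)
    qed
  qed
  moreover have "preserves_fibration P M p star ?act"
    unfolding preserves_fibration_def
  proof (intro ballI fps_ext ext)
    fix a b n u assume a: "a \<in> formal_Cinf M" and b: "b \<in> formal_Cinf M"
    show "fps_nth (?act (formal_pullback P p a) b) n u = fps_nth (formal_pullback P p (star a b)) n u"
      by (simp add: star a b formal_pullback_def fps_nth_formal_bilinear fib formal_CinfD[OF a] formal_CinfD[OF b])
        (simp add: pullback_def)
  qed
  ultimately show ?thesis by blast
qed

text \<open>On constant series the coefficient of order \<open>n\<close> of the product is the
  \<open>n\<close>-th operator itself, so the module law and invariance can be read off order by
  order.\<close>

lemma quantization_coefficients:
  assumes "deformation_quantization P M G r p star act"
  obtains \<rho> where "bidiffs \<rho>" "\<And>n. module_at \<rho> n" "\<And>i. invariant (\<rho> i)"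
    "\<And>f a. f \<in> formal_Cinf P \<Longrightarrow> a \<in> formal_Cinf M \<Longrightarrow> act f a = formal_bilinear \<rho> f a"
proof -
  obtain \<rho> where \<rho>0: "\<forall>f\<in>Cinf P. \<forall>a\<in>Cinf M. \<rho> 0 f a = (\<lambda>u. f u * pullback P p a u)"
    and bd: "\<forall>k\<ge>1. bidifferential_operator P M P (\<lambda>u. u) p (\<rho> k)"
    and act: "\<forall>f\<in>formal_Cinf P. \<forall>a\<in>formal_Cinf M. act f a = formal_bilinear \<rho> f a"
    using assms unfolding deformation_quantization_def by blast
  have assoc: "act (act f a) b = act f (star a b)" if "f \<in> formal_Cinf P" "a \<in> formal_Cinf M" "b \<in> formal_Cinf M" for f a b
    using assms that unfolding deformation_quantization_def by blast
  have inv: "formal_pullback P (\<lambda>u. r u g) (act f a) = act (formal_pullback P (\<lambda>u. r u g) f) a"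
    if "f \<in> formal_Cinf P" "a \<in> formal_Cinf M" "g \<in> carrier G" for f a g
    using assms that unfolding deformation_quantization_def by blast
  have eq: "rmul f a = \<rho> 0 f a" if "f \<in> Cinf P" "a \<in> Cinf M" for f a
    using \<rho>0 that by (simp add: rmul_def)
  \<comment> \<open>The zeroth coefficient is prescribed on smooth functions only, so the bounds are
    transported from \<open>rmul\<close> by congruence on \<open>Cinf\<close>.\<close>
  have "bidiff 1 1 (\<rho> 0)"
    unfolding bidiff_def
  proof (intro conjI ballI)
    show "diffop_lt P P (\<lambda>u. u) 1 (\<lambda>f. \<rho> 0 f a)" if "a \<in> Cinf M" for a
      by (rule pp.diffop_lt_cong[OF bidiffD(1)[OF bidiff_rmul that]]) (rule eq[OF _ that])
    show "diffop_lt M P p 1 (\<rho> 0 f)" if "f \<in> Cinf P" for f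
      by (rule pm.diffop_lt_cong[OF bidiffD(2)[OF bidiff_rmul that]]) (rule eq[OF that])
  qed
  then have "\<exists>N. bidiff N N (\<rho> i)" for i using bd bidiff_iff by (cases "i = 0") auto
  then have \<rho>: "bidiffs \<rho>" using \<rho>0 by (simp add: bidiffs_def rmul_def)
  interpret S: bilinear_series M M M C by (rule star_series)
  interpret R: bilinear_series P M P \<rho> by (rule module_series[OF \<rho>])
  have "module_at \<rho> n" for n
    unfolding module_at_def
  proof (intro ballI allI)
    fix f a b u assume f: "f \<in> Cinf P" and a: "a \<in> Cinf M" and b: "b \<in> Cinf M"
    let ?f = "formal_const f" and ?a = "formal_const a" and ?b = "formal_const b"
    note c = R.formal_const_Cinf[OF f] S.formal_const_Cinf[OF a] S.formal_const_Cinf[OF b]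
    note fa = R.formal_bilinear_Cinf[OF c(1,2)] and ab = S.formal_bilinear_Cinf[OF c(2,3)]
    have "formal_bilinear \<rho> (formal_bilinear \<rho> ?f ?a) ?b = formal_bilinear \<rho> ?f (formal_bilinear C ?a ?b)"
      using assoc[OF c] act star c fa ab by simp
    then have "fps_nth (formal_bilinear \<rho> (formal_bilinear \<rho> ?f ?a) ?b) n u = fps_nth (formal_bilinear \<rho> ?f (formal_bilinear C ?a ?b)) n u"
      by simp
    then show "(\<Sum>i\<le>n. \<rho> i (\<rho> (n - i) f a) b u) = (\<Sum>i\<le>n. \<rho> i f (C (n - i) a b) u)"
      unfolding R.formal_bilinear_const_right[OF fa b] R.formal_bilinear_const_left[OF f ab]
        R.formal_bilinear_const[OF f a] S.formal_bilinear_const[OF a b] .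
  qed
  moreover have "invariant (\<rho> i)" for i
    unfolding invariant_def
  proof (intro ballI)
    fix g f a assume g: "g \<in> carrier G" and f: "f \<in> Cinf P" and a: "a \<in> Cinf M"
    note c = R.formal_const_Cinf[OF f] S.formal_const_Cinf[OF a] and tf = tr_Cinf[OF g f]
    have "formal_pullback P (\<lambda>u. r u g) (formal_const f) = formal_const (tr g f)"
      by (rule fps_ext) (auto simp: formal_pullback_def fps_nth_formal_const pullback_def)
    then have "formal_pullback P (\<lambda>u. r u g) (formal_bilinear \<rho> (formal_const f) (formal_const a)) =
       formal_bilinear \<rho> (formal_const (tr g f)) (formal_const a)"
      using inv[OF c g] act c R.formal_const_Cinf[OF tf] by simp
    then have "fps_nth (formal_pullback P (\<lambda>u. r u g) (formal_bilinear \<rho> (formal_const f) (formal_const a))) i =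
       fps_nth (formal_bilinear \<rho> (formal_const (tr g f)) (formal_const a)) i" by simp
    then show "\<rho> i (tr g f) a = tr g (\<rho> i f a)"
      unfolding R.formal_bilinear_const[OF tf a] by (simp add: formal_pullback_def R.formal_bilinear_const[OF f a])
  qed
  ultimately show ?thesis using that[OF \<rho>] act by blast
qed

lemma quantizations_equivalent:
  assumes "deformation_quantization P M G r p star act" "deformation_quantization P M G r p star act'"
  shows "equivalent_deformation_quantizations P M G r act act'"
proof -
  obtain \<rho> where \<rho>: "bidiffs \<rho>" "\<And>n. module_at \<rho> n" "\<And>i. invariant (\<rho> i)"
    "\<And>f a. f \<in> formal_Cinf P \<Longrightarrow> a \<in> formal_Cinf M \<Longrightarrow> act f a = formal_bilinear \<rho> f a"
    using quantization_coefficients[OF assms(1)] by metis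
  obtain \<rho>' where \<rho>': "bidiffs \<rho>'" "\<And>n. module_at \<rho>' n" "\<And>i. invariant (\<rho>' i)"
    "\<And>f a. f \<in> formal_Cinf P \<Longrightarrow> a \<in> formal_Cinf M \<Longrightarrow> act' f a = formal_bilinear \<rho>' f a"
    using quantization_coefficients[OF assms(2)] by metis
  obtain T where T: "T 0 = (\<lambda>f. f)" "\<And>i. \<exists>K. diffop_lt P P (\<lambda>u. u) K (T i)"
    "\<And>i g f. g \<in> carrier G \<Longrightarrow> f \<in> Cinf P \<Longrightarrow> T i (tr g f) = tr g (T i f)" "\<And>n. intertwines_at \<rho> \<rho>' T n"
    using intertwiner_exists[OF \<rho>(1) \<rho>'(1) \<rho>(2) \<rho>'(2) \<rho>(3) \<rho>'(3)] by blast
  have L: "linear_op P P (T i)" for i using T(2) pp.diffop_lt_linear by blast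
  show ?thesis
    unfolding equivalent_deformation_quantizations_def
  proof (intro exI[of _ T] conjI ballI allI impI)
    fix f a assume f: "f \<in> formal_Cinf P" and a: "a \<in> formal_Cinf M"
    have "formal_linear T f \<in> formal_Cinf P"
      using formal_CinfD[OF f] linear_opD(1)[OF L] by (auto simp: formal_Cinf_def formal_linear_def intro!: Cinf_sum[OF P])
    then show "formal_linear T (act f a) = act' (formal_linear T f) a"
      using \<rho>(4)[OF f a] \<rho>'(4)[OF _ a] formal_intertwiner[OF \<rho>(1) \<rho>'(1) L T(4) f a] by simp
  qed (use T L in \<open>auto simp: differential_operator_def\<close>)
qed

end

end

lemma star_product_coefficients:
  assumes M: "locally_euclidean M" and "star_product M star"
  obtains C where "\<And>i. \<exists>N. (\<forall>b\<in>Cinf M. diffop_lt M M (\<lambda>x. x) N (\<lambda>a. C i a b)) \<and> (\<forall>a\<in>Cinf M. diffop_lt M M (\<lambda>x. x) N (C i a))"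
    "\<And>a b. a \<in> Cinf M \<Longrightarrow> b \<in> Cinf M \<Longrightarrow> C 0 a b = (\<lambda>x. a x * b x)"
    "\<And>a b c n x. a \<in> Cinf M \<Longrightarrow> b \<in> Cinf M \<Longrightarrow> c \<in> Cinf M \<Longrightarrow>
      (\<Sum>i\<le>n. C i (C (n - i) a b) c x) = (\<Sum>i\<le>n. C i a (C (n - i) b c) x)"
    "\<And>i a. 0 < i \<Longrightarrow> a \<in> Cinf M \<Longrightarrow> C i (one_fun M) a = (\<lambda>x. 0)" "\<And>i a. 0 < i \<Longrightarrow> a \<in> Cinf M \<Longrightarrow> C i a (one_fun M) = (\<lambda>x. 0)"
    "\<And>a b. a \<in> formal_Cinf M \<Longrightarrow> b \<in> formal_Cinf M \<Longrightarrow> star a b = formal_bilinear C a b"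
proof -
  obtain C where bd: "\<And>i. bidifferential_operator M M M (\<lambda>x. x) (\<lambda>x. x) (C i)"
    and C0: "\<And>a b. a \<in> Cinf M \<Longrightarrow> b \<in> Cinf M \<Longrightarrow> C 0 a b = (\<lambda>x. a x * b x)"
    and star: "\<And>a b. a \<in> formal_Cinf M \<Longrightarrow> b \<in> formal_Cinf M \<Longrightarrow> star a b = formal_bilinear C a b"
    using assms(2) unfolding star_product_def by blast
  have assoc: "star (star a b) c = star a (star b c)" if "a \<in> formal_Cinf M" "b \<in> formal_Cinf M" "c \<in> formal_Cinf M" for a b c
    using assms(2) that unfolding star_product_def by blast
  have one: "star (formal_one M) a = a" "star a (formal_one M) = a" if "a \<in> formal_Cinf M" for a
    using assms(2) that unfolding star_product_def by blast+
  interpret mm: smooth_pullback M M "\<lambda>x. x" by (rule smooth_pullback_id[OF M])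
  interpret S: bilinear_series M M M C
    by unfold_locales (use M bd in \<open>auto simp: bidifferential_operator_def\<close>)
  have 1: "\<exists>N. (\<forall>b\<in>Cinf M. diffop_lt M M (\<lambda>x. x) N (\<lambda>a. C i a b)) \<and> (\<forall>a\<in>Cinf M. diffop_lt M M (\<lambda>x. x) N (C i a))" for i
  proof -
    obtain k l where "\<forall>b\<in>Cinf M. diffop_lt M M (\<lambda>x. x) k (\<lambda>a. C i a b)" "\<forall>a\<in>Cinf M. diffop_lt M M (\<lambda>x. x) l (C i a)"
      using bd[of i] unfolding bidifferential_operator_def by blast
    then show ?thesis by (intro exI[of _ "max k l"]) (auto intro: mm.diffop_lt_mono)
  qed
  have 2: "(\<Sum>i\<le>n. C i (C (n - i) a b) c x) = (\<Sum>i\<le>n. C i a (C (n - i) b c) x)"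
    if a: "a \<in> Cinf M" and b: "b \<in> Cinf M" and c: "c \<in> Cinf M" for a b c n x
  proof -
    let ?a = "formal_const a" and ?b = "formal_const b" and ?c = "formal_const c"
    note k = S.formal_const_Cinf[OF a] S.formal_const_Cinf[OF b] S.formal_const_Cinf[OF c]
    note ab = S.formal_bilinear_Cinf[OF k(1,2)] and bc = S.formal_bilinear_Cinf[OF k(2,3)]
    have "formal_bilinear C (formal_bilinear C ?a ?b) ?c = formal_bilinear C ?a (formal_bilinear C ?b ?c)"
      using assoc[OF k] star k ab bc by simp
    then have "fps_nth (formal_bilinear C (formal_bilinear C ?a ?b) ?c) n x = fps_nth (formal_bilinear C ?a (formal_bilinear C ?b ?c)) n x"
      by simp
    then show ?thesis
      unfolding S.formal_bilinear_const_right[OF ab c] S.formal_bilinear_const_left[OF a bc]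
        S.formal_bilinear_const[OF a b] S.formal_bilinear_const[OF b c] .
  qed
  have 3: "C i (one_fun M) a = (\<lambda>x. 0)" "C i a (one_fun M) = (\<lambda>x. 0)" if i: "0 < i" and a: "a \<in> Cinf M" for i a
  proof -
    note k = S.formal_const_Cinf[OF a] and o = Cinf_one[OF M]
    have "fps_nth (formal_bilinear C (formal_const (one_fun M)) (formal_const a)) i = fps_nth (formal_const a) i"
      using one(1)[OF k] star[OF S.formal_const_Cinf[OF o] k] by (simp add: formal_one_eq)
    then show "C i (one_fun M) a = (\<lambda>x. 0)"
      using i by (simp add: S.formal_bilinear_const[OF o a] fps_nth_formal_const)
    have "fps_nth (formal_bilinear C (formal_const a) (formal_const (one_fun M))) i = fps_nth (formal_const a) i"
      using one(2)[OF k] star[OF k S.formal_const_Cinf[OF o]] by (simp add: formal_one_eq)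
    then show "C i a (one_fun M) = (\<lambda>x. 0)"
      using i by (simp add: S.formal_bilinear_const[OF a o] fps_nth_formal_const)
  qed
  show ?thesis by (rule that[OF 1 C0 2 3 star])
qed

theorem theorem1p6:
  fixes P :: "'p manifold" and M :: "'m manifold"
    and GM :: "'g manifold" and G :: "'g monoid"
    and r :: "'p \<Rightarrow> 'g \<Rightarrow> 'p" and p :: "'p \<Rightarrow> 'm"
    and star :: "('m \<Rightarrow> complex) fps \<Rightarrow> ('m \<Rightarrow> complex) fps \<Rightarrow> ('m \<Rightarrow> complex) fps"
  assumes "principal_bundle P M GM G r p"
    and "star_product M star"
  shows "(\<exists>act. deformation_quantization P M G r p star act) \<and>
    (\<forall>act act'. deformation_quantization P M G r p star act \<longrightarrow>
       deformation_quantization P M G r p star act' \<longrightarrow>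
       equivalent_deformation_quantizations P M G r act act') \<and>
    (\<exists>act. deformation_quantization P M G r p star act \<and> preserves_fibration P M p star act)"
proof -
  interpret principal P M GM G r p by unfold_locales (rule assms(1))
  obtain \<eta> \<xi> X where patches: "\<And>n::nat. patch P M G r p (\<eta> n) (\<xi> n) (X n)"
    and "\<And>x. x \<in> points M \<Longrightarrow> \<exists>V N. openin (mtop M) V \<and> x \<in> V \<and> (\<forall>n\<ge>N. \<forall>y\<in>V. \<eta> n y = 0)"
    and "\<And>x N. x \<in> points M \<Longrightarrow> \<forall>n\<ge>N. \<eta> n x = 0 \<Longrightarrow> (\<Sum>n<N. \<eta> n x) = 1"
    by (rule partition_exists) blast
  then interpret principal_partition P M GM G r p \<eta> \<xi> X by unfold_locales
  obtain C where C: "\<And>i. \<exists>N. (\<forall>b\<in>Cinf M. diffop_lt M M (\<lambda>x. x) N (\<lambda>a. C i a b)) \<and> (\<forall>a\<in>Cinf M. diffop_lt M M (\<lambda>x. x) N (C i a))"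
    "\<And>a b. a \<in> Cinf M \<Longrightarrow> b \<in> Cinf M \<Longrightarrow> C 0 a b = (\<lambda>x. a x * b x)"
    "\<And>a b c n x. a \<in> Cinf M \<Longrightarrow> b \<in> Cinf M \<Longrightarrow> c \<in> Cinf M \<Longrightarrow>
      (\<Sum>i\<le>n. C i (C (n - i) a b) c x) = (\<Sum>i\<le>n. C i a (C (n - i) b c) x)"
    "\<And>i a. 0 < i \<Longrightarrow> a \<in> Cinf M \<Longrightarrow> C i (one_fun M) a = (\<lambda>x. 0)" "\<And>i a. 0 < i \<Longrightarrow> a \<in> Cinf M \<Longrightarrow> C i a (one_fun M) = (\<lambda>x. 0)"
    and star: "\<And>a b. a \<in> formal_Cinf M \<Longrightarrow> b \<in> formal_Cinf M \<Longrightarrow> star a b = formal_bilinear C a b"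
    by (rule star_product_coefficients[OF M assms(2)]) blast
  interpret star_coefficients P M GM G r p \<eta> \<xi> X C by unfold_locales (fact C)+
  \<comment> \<open>The bare existence claim is contained in the existence of a quantization that
    preserves the fibration.\<close>
  show ?thesis
    using quantization_exists[OF star] quantizations_equivalent[OF star] by blast
qed

end
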